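(* Let $(A\to X,\rho,[\cdot,\cdot])$ be a holomorphic Lie algebroid, with underlying real Lie algebroid $A_R$ and underlying imaginary Lie algebroid $A_I$. Let $(A\to X,\rho_\Re,[\cdot,\cdot]_\Re)$ and $(A\to X,\rho_\Im,[\cdot,\cdot]_\Im)$ be the real Lie algebroids on $A$ corresponding to the fiberwise $\mathbb R$-linear Poisson structures $\pi_\Re$ and $\pi_\Im$ on $\mathrm{Hom}_{\mathbb R}(A,\mathbb R)$ obtained from the real and imaginary parts of the holomorphic Lie–Poisson structure on $\mathrm{Hom}_{\mathbb C}(A,\mathbb C)$. Then: (a) the Lie algebroid $(A\to X,4\rho_\Re,4[\cdot,\cdot]_\Re)$ is isomorphic to $A_R$; (b) the Lie algebroid $(A\to X,-4\rho_\Im,-4[\cdot,\cdot]_\Im)$ is isomorphic to $A_I$.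
   Context: Holomorphic Lie algebroid over a complex manifold $X$: a holomorphic vector bundle $A\to X$ with a holomorphic bundle map $\rho:A\to TX$ and a sheaf of complex Lie algebras structure on its sheaf $\mathcal A$ of holomorphic sections, such that $\rho$ induces a homomorphism of sheaves of complex Lie algebras to holomorphic vector fields and $[V,fW]=(\rho(V)f)W+f[V,W]$ for holomorphic $V,W,f$. $A_R$ is the unique real smooth Lie algebroid structure on $A$ with anchor $\rho$ whose bracket on smooth sections extends that of $\mathcal A$. With $j:A\to A$ multiplication by $\sqrt{-1}$ in the fibers (its Nijenhuis torsion in $A_R$ vanishes), $A_I$ is the real Lie algebroid on $A$ with anchor $\rho\circ j$ and bracket $[V,W]_j=[jV,W]+[V,jW]-j[V,W]$. Holomorphic Lie–Poisson structure: let $p:\mathrm{Hom}_{\mathbb C}(A,\mathbb C)\to X$ be the complex dual bundle and, for a section $V$ of $A$, let $l_V(\alpha)=\alpha(V|_{p(\alpha)})$. There is a unique holomorphic Poisson structure $\pi$ on $\mathrm{Hom}_{\mathbb C}(A,\mathbb C)$, fiberwise linear, with $\{l_V,l_W\}=l_{[V,W]}$, $\{l_V,p^*f\}=p^*(\rho(V)f)$ and $\{p^*f,p^*g\}=0$ for all local holomorphic sections $V,W$ of $A$ and local holomorphic functions $f,g$ on $X$. Write $\pi=\pi_R+i\pi_I$ with $\pi_R,\pi_I$ real bivector fields (these are real Poisson structures). Let $\Psi=1-ij^*:\mathrm{Hom}_{\mathbb R}(A,\mathbb R)\to\mathrm{Hom}_{\mathbb C}(A,\mathbb C)$, an isomorphism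 of real vector bundles with inverse $\xi\mapsto\mathrm{Re}\circ\xi$, and put $\pi_\Re=\Psi^{-1}_*\pi_R$, $\pi_\Im=\Psi^{-1}_*\pi_I$. These are fiberwise $\mathbb R$-linear Poisson structures on the real dual $p_{\mathbb R}:\mathrm{Hom}_{\mathbb R}(A,\mathbb R)\to X$. A fiberwise $\mathbb R$-linear Poisson structure on $\mathrm{Hom}_{\mathbb R}(A,\mathbb R)$ corresponds to the real Lie algebroid structure $(\rho',[\cdot,\cdot]')$ on $A$ determined by $\{l'_V,l'_W\}=l'_{[V,W]'}$ and $\{l'_V,p_{\mathbb R}^*f\}=p_{\mathbb R}^*(\rho'(V)f)$ for smooth sections $V,W$ and smooth real functions $f$, where $l'_V$ is the fiberwise $\mathbb R$-linear function on $\mathrm{Hom}_{\mathbb R}(A,\mathbb R)$ defined by $V$. *)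

theory Defs
  imports "HOL-Analysis.Analysis"
begin

section \<open>Smooth and holomorphic maps between finite-dimensional spaces\<close>

text \<open>
  A finite-dimensional complex vector space is a finite-dimensional real normed space
  with a complex structure \<open>J\<close> (multiplication by \<open>\<i>\<close>).  The class \<open>real_normed_vector\<close> is
  used rather than \<open>euclidean_space\<close> or \<open>complex ^ 'n\<close> because the latter exclude dimension 0.
\<close>

definition complex_fin_dim :: "('e::real_normed_vector \<Rightarrow> 'e) \<Rightarrow> bool" where
  "complex_fin_dim J \<longleftrightarrow>
     (\<exists>B::'e set. finite B \<and> span B = UNIV) \<and> linear J \<and> (\<forall>v. J (J v) = - v)"

primrec Ck_on :: "nat \<Rightarrow> 'e::real_normed_vector set \<Rightarrow> ('e \<Rightarrow> 'f::real_normed_vector) \<Rightarrow> bool" where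
  "Ck_on 0 S f \<longleftrightarrow> continuous_on S f"
| "Ck_on (Suc k) S f \<longleftrightarrow> (\<forall>x\<in>S. f differentiable (at x)) \<and>
     (\<forall>v. Ck_on k S (\<lambda>x. frechet_derivative f (at x) v))"

text \<open>The following two notions are only used on open sets \<open>S\<close>.\<close>

definition smooth_on :: "'e::real_normed_vector set \<Rightarrow> ('e \<Rightarrow> 'f::real_normed_vector) \<Rightarrow> bool" where
  "smooth_on S f \<longleftrightarrow> (\<forall>k. Ck_on k S f)"

definition hol_on :: "('e \<Rightarrow> 'e) \<Rightarrow> ('f \<Rightarrow> 'f) \<Rightarrow> 'e::real_normed_vector set
    \<Rightarrow> ('e \<Rightarrow> 'f::real_normed_vector) \<Rightarrow> bool" where
  "hol_on J K S f \<longleftrightarrow> smooth_on S f \<and>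
     (\<forall>x\<in>S. \<forall>v. frechet_derivative f (at x) (J v) = K (frechet_derivative f (at x) v))"


section \<open>Manifolds\<close>

type_synonym ('m, 'e) chart = "'m set \<times> ('m \<Rightarrow> 'e)"

text \<open>The values of a chart outside its domain are irrelevant.\<close>

abbreviation chart_inv :: "('m, 'e) chart \<Rightarrow> 'e \<Rightarrow> 'm" where
  "chart_inv c \<equiv> inv_into (fst c) (snd c)"

definition points :: "('m, 'e) chart set \<Rightarrow> 'm set" where
  "points C = \<Union> (fst ` C)"

definition mtop :: "('m, 'e::topological_space) chart set \<Rightarrow> 'm topology" where
  "mtop C = topology (\<lambda>W. W \<subseteq> points C \<and> (\<forall>c\<in>C. open (snd c ` (fst c \<inter> W))))"

text \<open>
  \<open>P\<close> is the regularity class: \<open>smooth_on\<close> or \<open>hol_on J J\<close> below.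
\<close>

definition atlas :: "('e set \<Rightarrow> ('e \<Rightarrow> 'e) \<Rightarrow> bool) \<Rightarrow> ('m, 'e::real_normed_vector) chart set \<Rightarrow> bool" where
  "atlas P C \<longleftrightarrow>
     (\<forall>c\<in>C. inj_on (snd c) (fst c) \<and> open (snd c ` fst c)) \<and>
     (\<forall>c\<in>C. \<forall>d\<in>C. open (snd c ` (fst c \<inter> fst d)) \<and>
        P (snd c ` (fst c \<inter> fst d)) (snd d \<circ> chart_inv c))"

record ('m, 'e) cmfd =
  charts :: "('m, 'e) chart set"
  mJ :: "'e \<Rightarrow> 'e"

definition complex_manifold :: "('m, 'e::real_normed_vector) cmfd \<Rightarrow> bool" where
  "complex_manifold X \<longleftrightarrow> complex_fin_dim (mJ X) \<and> atlas (hol_on (mJ X) (mJ X)) (charts X) \<and>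
     Hausdorff_space (mtop (charts X)) \<and> second_countable (mtop (charts X))"

definition chart_map :: "('e set \<Rightarrow> ('e \<Rightarrow> 'f) \<Rightarrow> bool) \<Rightarrow> ('m, 'e::real_normed_vector) chart set
    \<Rightarrow> ('n, 'f::real_normed_vector) chart set \<Rightarrow> 'm set \<Rightarrow> ('m \<Rightarrow> 'n) \<Rightarrow> bool" where
  "chart_map P C D W F \<longleftrightarrow> F ` W \<subseteq> points D \<and>
     (\<forall>c\<in>C. \<forall>d\<in>D. let S = snd c ` {m \<in> fst c \<inter> W. F m \<in> fst d}
        in open S \<and> P S (snd d \<circ> F \<circ> chart_inv c))"

definition smooth_map :: "('m, 'e::real_normed_vector) chart set
    \<Rightarrow> ('n, 'f::real_normed_vector) chart set \<Rightarrow> 'm set \<Rightarrow> ('m \<Rightarrow> 'n) \<Rightarrow> bool" where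
  "smooth_map = chart_map smooth_on"

definition hol_map :: "('m, 'e::real_normed_vector) cmfd \<Rightarrow> ('n, 'f::real_normed_vector) cmfd
    \<Rightarrow> 'm set \<Rightarrow> ('m \<Rightarrow> 'n) \<Rightarrow> bool" where
  "hol_map M N = chart_map (hol_on (mJ M) (mJ N)) (charts M) (charts N)"

definition smooth_funs :: "('m, 'e::real_normed_vector) cmfd \<Rightarrow> 'm set \<Rightarrow> ('m \<Rightarrow> real) set" where
  "smooth_funs M W = {f. smooth_map (charts M) {(UNIV, id)} W f}"

definition hol_funs :: "('m, 'e::real_normed_vector) cmfd \<Rightarrow> 'm set \<Rightarrow> ('m \<Rightarrow> complex) set" where
  "hol_funs M W = {f. hol_map M \<lparr>charts = {(UNIV, id)}, mJ = (\<lambda>z. \<i> * z)\<rparr> W f}"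


section \<open>Tangent vectors and differentials\<close>

text \<open>
  A real tangent vector at \<open>m\<close> is the family of its coordinate vectors in the charts around \<open>m\<close>,
  related by the derivatives of the coordinate changes (and \<open>0\<close> for all other charts).
  On a complex manifold this real tangent bundle, with the complex structure \<open>mJ\<close> in every chart,
  is the holomorphic tangent bundle.
\<close>

type_synonym ('m, 'e) tvec = "('m, 'e) chart \<Rightarrow> 'e"

definition tangent_space :: "('m, 'e::real_normed_vector) chart set \<Rightarrow> 'm \<Rightarrow> ('m, 'e) tvec set" where
  "tangent_space C m = {v.
     (\<forall>c. c \<notin> C \<or> m \<notin> fst c \<longrightarrow> v c = 0) \<and>
     (\<forall>c\<in>C. \<forall>d\<in>C. m \<in> fst c \<inter> fst d \<longrightarrow>
        v d = frechet_derivative (snd d \<circ> chart_inv c) (at (snd c m)) (v c))}"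

definition chart_at :: "('m, 'e) chart set \<Rightarrow> 'm \<Rightarrow> ('m, 'e) chart" where
  "chart_at C m = (SOME c. c \<in> C \<and> m \<in> fst c)"

text \<open>The differential at \<open>m\<close>, extended by \<open>0\<close> outside the tangent space at \<open>m\<close>.\<close>

definition dif :: "('m, 'e::real_normed_vector) chart set \<Rightarrow> ('m \<Rightarrow> 'k::real_normed_vector)
    \<Rightarrow> 'm \<Rightarrow> ('m, 'e) tvec \<Rightarrow> 'k" where
  "dif C f m v = (let c = chart_at C m in
     if v \<in> tangent_space C m then frechet_derivative (f \<circ> chart_inv c) (at (snd c m)) (v c) else 0)"

definition tangent_map :: "('m, 'e::real_normed_vector) chart set
    \<Rightarrow> ('n, 'f::real_normed_vector) chart set \<Rightarrow> ('m \<Rightarrow> 'n) \<Rightarrow> 'm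
    \<Rightarrow> ('m, 'e) tvec \<Rightarrow> ('n, 'f) tvec" where
  "tangent_map C D F m v = (let c = chart_at C m in
     (\<lambda>d. if d \<in> D \<and> F m \<in> fst d
          then frechet_derivative (snd d \<circ> F \<circ> chart_inv c) (at (snd c m)) (v c) else 0))"

text \<open>
  The real cotangent space (\<open>'k = real\<close>) and its complexification (\<open>'k = complex\<close>).
\<close>

definition cotangent_space :: "('m, 'e::real_normed_vector) chart set \<Rightarrow> 'm
    \<Rightarrow> (('m, 'e) tvec \<Rightarrow> 'k::real_normed_field) set" where
  "cotangent_space C m = {\<omega>.
     (\<forall>v. v \<notin> tangent_space C m \<longrightarrow> \<omega> v = 0) \<and>
     (\<forall>v\<in>tangent_space C m. \<forall>w\<in>tangent_space C m. \<omega> (\<lambda>c. v c + w c) = \<omega> v + \<omega> w) \<and>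
     (\<forall>v\<in>tangent_space C m. \<forall>r::real. \<omega> (\<lambda>c. r *\<^sub>R v c) = r *\<^sub>R \<omega> v)}"


section \<open>Bivector fields and Poisson structures\<close>

text \<open>
  A bivector at \<open>m\<close> is an alternating bilinear form on the cotangent space at \<open>m\<close>.  For
  \<open>'k = complex\<close> this is an element of the second exterior power of the complexified tangent space.
\<close>

type_synonym ('m, 'e, 'k) bivec =
  "'m \<Rightarrow> (('m, 'e) tvec \<Rightarrow> 'k) \<Rightarrow> (('m, 'e) tvec \<Rightarrow> 'k) \<Rightarrow> 'k"

definition bivector_field :: "('m, 'e::real_normed_vector) chart set
    \<Rightarrow> ('m, 'e, 'k::real_normed_field) bivec \<Rightarrow> bool" where
  "bivector_field C \<pi> \<longleftrightarrow> (\<forall>m\<in>points C.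
     \<forall>\<omega>\<in>cotangent_space C m. \<forall>\<eta>\<in>cotangent_space C m. \<forall>\<theta>\<in>cotangent_space C m.
       \<pi> m \<omega> \<eta> = - \<pi> m \<eta> \<omega> \<and>
       \<pi> m (\<lambda>v. \<omega> v + \<eta> v) \<theta> = \<pi> m \<omega> \<theta> + \<pi> m \<eta> \<theta> \<and>
       (\<forall>k. \<pi> m (\<lambda>v. k * \<omega> v) \<eta> = k * \<pi> m \<omega> \<eta>))"

definition pbracket :: "('m, 'e::real_normed_vector) chart set \<Rightarrow> ('m, 'e, 'k::real_normed_field) bivec
    \<Rightarrow> ('m \<Rightarrow> 'k) \<Rightarrow> ('m \<Rightarrow> 'k) \<Rightarrow> 'm \<Rightarrow> 'k" where
  "pbracket C \<pi> f g m = \<pi> m (dif C f m) (dif C g m)"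

text \<open>
  A holomorphic bivector field is of type (2,0), i.e. it is annihilated by the covectors of
  type (0,1), and pairs holomorphic 1-forms to holomorphic functions.
\<close>

definition holomorphic_bivector_field :: "('m, 'e::real_normed_vector) cmfd
    \<Rightarrow> ('m, 'e, complex) bivec \<Rightarrow> bool" where
  "holomorphic_bivector_field M \<pi> \<longleftrightarrow> bivector_field (charts M) \<pi> \<and>
     (\<forall>m\<in>points (charts M). \<forall>\<omega>\<in>cotangent_space (charts M) m. \<forall>\<eta>\<in>cotangent_space (charts M) m.
        (\<forall>v\<in>tangent_space (charts M) m. \<omega> (\<lambda>c. mJ M (v c)) = - \<i> * \<omega> v) \<longrightarrow> \<pi> m \<omega> \<eta> = 0) \<and>
     (\<forall>W. openin (mtop (charts M)) W \<longrightarrow> (\<forall>f\<in>hol_funs M W. \<forall>g\<in>hol_funs M W.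
        pbracket (charts M) \<pi> f g \<in> hol_funs M W))"

definition holomorphic_poisson :: "('m, 'e::real_normed_vector) cmfd
    \<Rightarrow> ('m, 'e, complex) bivec \<Rightarrow> bool" where
  "holomorphic_poisson M \<pi> \<longleftrightarrow> holomorphic_bivector_field M \<pi> \<and>
     (\<forall>W. openin (mtop (charts M)) W \<longrightarrow>
       (\<forall>f\<in>hol_funs M W. \<forall>g\<in>hol_funs M W. \<forall>h\<in>hol_funs M W. \<forall>m\<in>W.
          let br = pbracket (charts M) \<pi>
          in br f (br g h) m + br g (br h f) m + br h (br f g) m = 0))"

text \<open>
  The real bivector fields \<open>\<pi>\<^sub>R\<close>, \<open>\<pi>\<^sub>I\<close> with \<open>\<pi> = \<pi>\<^sub>R + \<i> \<pi>\<^sub>I\<close>: as \<open>\<pi>\<^sub>R\<close> and \<open>\<pi>\<^sub>I\<close> take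
  real values on real covectors, evaluate \<open>\<pi>\<close> on these and take real and imaginary parts.
\<close>

definition Re_bivec :: "('m, 'e, complex) bivec \<Rightarrow> ('m, 'e, real) bivec" where
  "Re_bivec \<pi> m \<alpha> \<beta> = Re (\<pi> m (\<lambda>v. of_real (\<alpha> v)) (\<lambda>v. of_real (\<beta> v)))"

definition Im_bivec :: "('m, 'e, complex) bivec \<Rightarrow> ('m, 'e, real) bivec" where
  "Im_bivec \<pi> m \<alpha> \<beta> = Im (\<pi> m (\<lambda>v. of_real (\<alpha> v)) (\<lambda>v. of_real (\<beta> v)))"

text \<open>Push-forward along a diffeomorphism \<open>F\<close> from the manifold \<open>C\<close> to the manifold \<open>D\<close>.\<close>

definition push_bivec :: "('m, 'e::real_normed_vector) chart set
    \<Rightarrow> ('n, 'f::real_normed_vector) chart set \<Rightarrow> ('m \<Rightarrow> 'n)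
    \<Rightarrow> ('m, 'e, real) bivec \<Rightarrow> ('n, 'f, real) bivec" where
  "push_bivec C D F \<pi> n \<alpha> \<beta> = (let m = inv_into (points C) F n;
       pull = (\<lambda>\<omega> v. if v \<in> tangent_space C m then \<omega> (tangent_map C D F m v) else 0)
     in \<pi> m (pull \<alpha>) (pull \<beta>))"


section \<open>Vector bundles\<close>

text \<open>
  A trivialization is a pair of an open set \<open>U\<close> of the base and a map whose restriction to each
  fibre over \<open>U\<close> is an isomorphism onto the fibre model.  The vector space structure of the
  fibres is transported from the model; it does not depend on the trivialization.
\<close>

record ('x, 'a, 'f) vb =
  vtotal :: "'a set"
  vproj :: "'a \<Rightarrow> 'x"
  vtrivs :: "('x set \<times> ('a \<Rightarrow> 'f)) set"

record ('x, 'a, 'f) cvb = "('x, 'a, 'f) vb" +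
  fJ :: "'f \<Rightarrow> 'f"

definition fibre :: "('x, 'a, 'f, 'z) vb_scheme \<Rightarrow> 'x \<Rightarrow> 'a set" where
  "fibre A x = {a \<in> vtotal A. vproj A a = x}"

definition holomorphic_vb :: "('x, 'e::real_normed_vector) cmfd
    \<Rightarrow> ('x, 'a, 'f::real_normed_vector) cvb \<Rightarrow> bool" where
  "holomorphic_vb X A \<longleftrightarrow> complex_fin_dim (fJ A) \<and>
     vproj A ` vtotal A \<subseteq> points (charts X) \<and> \<Union> (fst ` vtrivs A) = points (charts X) \<and>
     (\<forall>(U, \<phi>)\<in>vtrivs A. openin (mtop (charts X)) U \<and> (\<forall>x\<in>U. bij_betw \<phi> (fibre A x) UNIV)) \<and>
     (\<forall>(U, \<phi>)\<in>vtrivs A. \<forall>(U', \<phi>')\<in>vtrivs A.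
        let g = (\<lambda>x v. \<phi>' (inv_into (fibre A x) \<phi> v)) in
        (\<forall>x \<in> U \<inter> U'. linear (g x) \<and> (\<forall>v. g x (fJ A v) = fJ A (g x v))) \<and>
        (\<forall>v. hol_map X \<lparr>charts = {(UNIV, id)}, mJ = fJ A\<rparr> (U \<inter> U') (\<lambda>x. g x v)))"

definition triv_at :: "('x, 'a, 'f, 'z) vb_scheme \<Rightarrow> 'x \<Rightarrow> 'a \<Rightarrow> 'f" where
  "triv_at A x = snd (SOME t. t \<in> vtrivs A \<and> x \<in> fst t)"

definition fib_inv :: "('x, 'a, 'f, 'z) vb_scheme \<Rightarrow> 'x \<Rightarrow> 'f \<Rightarrow> 'a" where
  "fib_inv A x = inv_into (fibre A x) (triv_at A x)"

definition fadd :: "('x, 'a, 'f::real_normed_vector, 'z) vb_scheme \<Rightarrow> 'a \<Rightarrow> 'a \<Rightarrow> 'a" where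
  "fadd A a b = (let x = vproj A a in fib_inv A x (triv_at A x a + triv_at A x b))"

definition fscaleR :: "('x, 'a, 'f::real_normed_vector, 'z) vb_scheme \<Rightarrow> real \<Rightarrow> 'a \<Rightarrow> 'a" where
  "fscaleR A r a = (let x = vproj A a in fib_inv A x (r *\<^sub>R triv_at A x a))"

definition fmulI :: "('x, 'a, 'f) cvb \<Rightarrow> 'a \<Rightarrow> 'a" where
  "fmulI A a = (let x = vproj A a in fib_inv A x (fJ A (triv_at A x a)))"

definition fscaleC :: "('x, 'a, 'f::real_normed_vector) cvb \<Rightarrow> complex \<Rightarrow> 'a \<Rightarrow> 'a" where
  "fscaleC A z a = fadd A (fscaleR A (Re z) a) (fscaleR A (Im z) (fmulI A a))"

definition total_atlas :: "('x, 'e) cmfd \<Rightarrow> ('x, 'a, 'f, 'z) vb_scheme \<Rightarrow> ('a, 'e \<times> 'f) chart set" where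
  "total_atlas X A = {({a \<in> vtotal A. vproj A a \<in> U \<inter> U'}, \<lambda>a. (\<psi> (vproj A a), \<phi> a)) | U \<psi> U' \<phi>.
     (U, \<psi>) \<in> charts X \<and> (U', \<phi>) \<in> vtrivs A}"

definition total_cmfd :: "('x, 'e) cmfd \<Rightarrow> ('x, 'a, 'f) cvb \<Rightarrow> ('a, 'e \<times> 'f) cmfd" where
  "total_cmfd X A = \<lparr>charts = total_atlas X A, mJ = map_prod (mJ X) (fJ A)\<rparr>"

text \<open>Sections over \<open>U\<close> are \<open>undefined\<close> outside \<open>U\<close>, so that they form a sheaf.\<close>

definition smooth_sections :: "('x, 'e::real_normed_vector) cmfd
    \<Rightarrow> ('x, 'a, 'f::real_normed_vector, 'z) vb_scheme \<Rightarrow> 'x set \<Rightarrow> ('x \<Rightarrow> 'a) set" where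
  "smooth_sections X A U = {s \<in> extensional U. (\<forall>x\<in>U. s x \<in> fibre A x) \<and>
     smooth_map (charts X) (total_atlas X A) U s}"

definition hol_sections :: "('x, 'e::real_normed_vector) cmfd
    \<Rightarrow> ('x, 'a, 'f::real_normed_vector) cvb \<Rightarrow> 'x set \<Rightarrow> ('x \<Rightarrow> 'a) set" where
  "hol_sections X A U = {s \<in> extensional U. (\<forall>x\<in>U. s x \<in> fibre A x) \<and>
     hol_map X (total_cmfd X A) U s}"

definition smooth_bundle_map :: "('x, 'e::real_normed_vector) cmfd
    \<Rightarrow> ('x, 'a, 'f::real_normed_vector, 'y) vb_scheme
    \<Rightarrow> ('x, 'b, 'g::real_normed_vector, 'z) vb_scheme \<Rightarrow> ('a \<Rightarrow> 'b) \<Rightarrow> bool" where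
  "smooth_bundle_map X A B F \<longleftrightarrow>
     (\<forall>a\<in>vtotal A. F a \<in> fibre B (vproj A a)) \<and>
     (\<forall>a\<in>vtotal A. \<forall>b\<in>fibre A (vproj A a). F (fadd A a b) = fadd B (F a) (F b)) \<and>
     (\<forall>a\<in>vtotal A. \<forall>r. F (fscaleR A r a) = fscaleR B r (F a)) \<and>
     smooth_map (total_atlas X A) (total_atlas X B) (vtotal A) F"

definition hol_bundle_map :: "('x, 'e::real_normed_vector) cmfd
    \<Rightarrow> ('x, 'a, 'f::real_normed_vector) cvb
    \<Rightarrow> ('x, 'b, 'g::real_normed_vector) cvb \<Rightarrow> ('a \<Rightarrow> 'b) \<Rightarrow> bool" where
  "hol_bundle_map X A B F \<longleftrightarrow>
     (\<forall>a\<in>vtotal A. F a \<in> fibre B (vproj A a)) \<and>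
     (\<forall>a\<in>vtotal A. \<forall>b\<in>fibre A (vproj A a). F (fadd A a b) = fadd B (F a) (F b)) \<and>
     (\<forall>a\<in>vtotal A. \<forall>z. F (fscaleC A z a) = fscaleC B z (F a)) \<and>
     hol_map (total_cmfd X A) (total_cmfd X B) (vtotal A) F"

definition tangent_bundle :: "('x, 'e::real_normed_vector) cmfd
    \<Rightarrow> ('x, 'x \<times> ('x, 'e) tvec, 'e) cvb" where
  "tangent_bundle X = \<lparr>vtotal = (SIGMA x : points (charts X). tangent_space (charts X) x),
     vproj = fst, vtrivs = {(fst c, \<lambda>(x, v). v c) | c. c \<in> charts X}, fJ = mJ X\<rparr>"

text \<open>
  The dual bundles; a functional on the fibre over \<open>x\<close> is extended by \<open>0\<close> to all of \<open>'a\<close>.  The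
  fibre model of the complex dual should be the space of complex linear functionals on \<open>'f\<close>.  As
  that is not a type, it is represented by the complex linearly isomorphic space of real parts of
  such functionals, i.e. by the real dual of \<open>'f\<close> with the complex structure
  \<open>\<alpha> \<mapsto> \<alpha> \<circ> fJ A\<close>; note \<open>Re (\<i> * \<xi> v) = Re (\<xi> (fJ A v))\<close>.
\<close>

definition homC :: "('x, 'a, 'f::real_normed_vector) cvb
    \<Rightarrow> ('x, 'x \<times> ('a \<Rightarrow> complex), 'f \<Rightarrow>\<^sub>L real) cvb" where
  "homC A = \<lparr>
     vtotal = {(x, \<xi>). x \<in> \<Union> (fst ` vtrivs A) \<and> (\<forall>a. a \<notin> fibre A x \<longrightarrow> \<xi> a = 0) \<and>
       (\<forall>a\<in>fibre A x. \<forall>b\<in>fibre A x. \<xi> (fadd A a b) = \<xi> a + \<xi> b) \<and>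
       (\<forall>a\<in>fibre A x. \<forall>z. \<xi> (fscaleC A z a) = z * \<xi> a)},
     vproj = fst,
     vtrivs = {(U, \<lambda>(x, \<xi>). Blinfun (\<lambda>v. Re (\<xi> (inv_into (fibre A x) \<phi> v)))) | U \<phi>.
       (U, \<phi>) \<in> vtrivs A},
     fJ = (\<lambda>\<alpha>. \<alpha> o\<^sub>L Blinfun (fJ A))\<rparr>"

definition homR :: "('x, 'a, 'f::real_normed_vector, 'z) vb_scheme
    \<Rightarrow> ('x, 'x \<times> ('a \<Rightarrow> real), 'f \<Rightarrow>\<^sub>L real) vb" where
  "homR A = \<lparr>
     vtotal = {(x, \<alpha>). x \<in> \<Union> (fst ` vtrivs A) \<and> (\<forall>a. a \<notin> fibre A x \<longrightarrow> \<alpha> a = 0) \<and>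
       (\<forall>a\<in>fibre A x. \<forall>b\<in>fibre A x. \<alpha> (fadd A a b) = \<alpha> a + \<alpha> b) \<and>
       (\<forall>a\<in>fibre A x. \<forall>r. \<alpha> (fscaleR A r a) = r * \<alpha> a)},
     vproj = fst,
     vtrivs = {(U, \<lambda>(x, \<alpha>). Blinfun (\<lambda>v. \<alpha> (inv_into (fibre A x) \<phi> v))) | U \<phi>.
       (U, \<phi>) \<in> vtrivs A}\<rparr>"

text \<open>The map \<open>\<Psi> = 1 - \<i> j\<^sup>*\<close> from the real to the complex dual.\<close>

definition Psi :: "('x, 'a, 'f::real_normed_vector) cvb \<Rightarrow> 'x \<times> ('a \<Rightarrow> real) \<Rightarrow> 'x \<times> ('a \<Rightarrow> complex)" where
  "Psi A = (\<lambda>(x, \<alpha>). (x, \<lambda>a. if a \<in> fibre A x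
     then of_real (\<alpha> a) - \<i> * of_real (\<alpha> (fmulI A a)) else 0))"

text \<open>
  The fibrewise linear function of a section \<open>V\<close>: \<open>l_V\<close> on the complex dual
  (\<open>'k = complex\<close>) and \<open>l'_V\<close> on the real dual (\<open>'k = real\<close>).
\<close>

definition lin_fun :: "('x \<Rightarrow> 'a) \<Rightarrow> 'x \<times> ('a \<Rightarrow> 'k) \<Rightarrow> 'k" where
  "lin_fun V = (\<lambda>(x, \<xi>). \<xi> (V x))"


section \<open>Lie algebroids\<close>

text \<open>The argument of the bracket of type \<open>'x set\<close> is the open set over which the sections live.\<close>

record ('x, 'a, 'e) algd =
  anchor :: "'a \<Rightarrow> 'x \<times> ('x, 'e) tvec"
  bracket :: "'x set \<Rightarrow> ('x \<Rightarrow> 'a) \<Rightarrow> ('x \<Rightarrow> 'a) \<Rightarrow> 'x \<Rightarrow> 'a"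

definition anchor_act :: "('x, 'e::real_normed_vector) cmfd \<Rightarrow> ('x, 'a, 'e) algd \<Rightarrow> ('x \<Rightarrow> 'a)
    \<Rightarrow> ('x \<Rightarrow> 'k::real_normed_vector) \<Rightarrow> 'x \<Rightarrow> 'k" where
  "anchor_act X L V f x = dif (charts X) f x (snd (anchor L (V x)))"

text \<open>
  The conditions common to real and holomorphic Lie algebroids, for a sheaf \<open>\<Gamma>\<close> of sections,
  a sheaf \<open>\<O>\<close> of functions, and the corresponding scalar multiplication \<open>sc\<close>: the bracket makes \<open>\<Gamma>\<close>
  a sheaf of Lie algebras, it satisfies the Leibniz rule, and the anchor maps it to the commutator
  of vector fields.
\<close>

definition lie_sheaf :: "('x, 'e::real_normed_vector) cmfd
    \<Rightarrow> ('x, 'a, 'f::real_normed_vector, 'z) vb_scheme \<Rightarrow> ('k::real_normed_field \<Rightarrow> 'a \<Rightarrow> 'a)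
    \<Rightarrow> ('x set \<Rightarrow> ('x \<Rightarrow> 'a) set) \<Rightarrow> ('x set \<Rightarrow> ('x \<Rightarrow> 'k) set) \<Rightarrow> ('x, 'a, 'e) algd \<Rightarrow> bool" where
  "lie_sheaf X A sc \<Gamma> \<O> L \<longleftrightarrow> (\<forall>U. openin (mtop (charts X)) U \<longrightarrow>
     (let br = bracket L U;
          add = (\<lambda>V W. \<lambda>x\<in>U. fadd A (V x) (W x));
          scl = (\<lambda>f V. \<lambda>x\<in>U. sc (f x) (V x));
          act = anchor_act X L
      in \<forall>V\<in>\<Gamma> U. \<forall>W\<in>\<Gamma> U.
        br V W \<in> \<Gamma> U \<and>
        (\<forall>U'. openin (mtop (charts X)) U' \<and> U' \<subseteq> U \<longrightarrow>
           bracket L U' (restrict V U') (restrict W U') = restrict (br V W) U') \<and>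
        br V W = scl (\<lambda>_. - 1) (br W V) \<and>
        (\<forall>k. br V (scl (\<lambda>_. k) W) = scl (\<lambda>_. k) (br V W)) \<and>
        (\<forall>Z\<in>\<Gamma> U.
           br V (add W Z) = add (br V W) (br V Z) \<and>
           br V (br W Z) = add (br (br V W) Z) (br W (br V Z))) \<and>
        (\<forall>f\<in>\<O> U.
           br V (scl f W) = add (scl (act V f) W) (scl f (br V W)) \<and>
           (\<forall>x\<in>U. act (br V W) f x = act V (act W f) x - act W (act V f) x))))"

definition holomorphic_lie_algebroid :: "('x, 'e::real_normed_vector) cmfd
    \<Rightarrow> ('x, 'a, 'f::real_normed_vector) cvb \<Rightarrow> ('x, 'a, 'e) algd \<Rightarrow> bool" where
  "holomorphic_lie_algebroid X A L \<longleftrightarrow> complex_manifold X \<and> holomorphic_vb X A \<and>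
     hol_bundle_map X A (tangent_bundle X) (anchor L) \<and>
     lie_sheaf X A (fscaleC A) (hol_sections X A) (hol_funs X) L"

definition real_lie_algebroid :: "('x, 'e::real_normed_vector) cmfd
    \<Rightarrow> ('x, 'a, 'f::real_normed_vector, 'z) vb_scheme \<Rightarrow> ('x, 'a, 'e) algd \<Rightarrow> bool" where
  "real_lie_algebroid X A L \<longleftrightarrow>
     smooth_bundle_map X A (tangent_bundle X) (anchor L) \<and>
     lie_sheaf X A (fscaleR A) (smooth_sections X A) (smooth_funs X) L"

text \<open>\<open>R\<close> is the (unique) real Lie algebroid \<open>A\<^sub>R\<close> underlying the holomorphic one \<open>L\<close>.\<close>

definition underlying_real :: "('x, 'e::real_normed_vector) cmfd
    \<Rightarrow> ('x, 'a, 'f::real_normed_vector) cvb \<Rightarrow> ('x, 'a, 'e) algd \<Rightarrow> ('x, 'a, 'e) algd \<Rightarrow> bool" where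
  "underlying_real X A L R \<longleftrightarrow> real_lie_algebroid X A R \<and>
     (\<forall>a\<in>vtotal A. anchor R a = anchor L a) \<and>
     (\<forall>U. openin (mtop (charts X)) U \<longrightarrow> (\<forall>V\<in>hol_sections X A U. \<forall>W\<in>hol_sections X A U.
        bracket R U V W = bracket L U V W))"

text \<open>\<open>A\<^sub>I\<close> in terms of \<open>A\<^sub>R\<close>.\<close>

definition imaginary_algd :: "('x, 'a, 'f::real_normed_vector) cvb \<Rightarrow> ('x, 'a, 'e) algd \<Rightarrow> ('x, 'a, 'e) algd" where
  "imaginary_algd A R = \<lparr>anchor = anchor R \<circ> fmulI A,
     bracket = (\<lambda>U V W. let jj = (\<lambda>s. \<lambda>x\<in>U. fmulI A (s x)) in
       (\<lambda>x\<in>U. fadd A (fadd A (bracket R U (jj V) W x) (bracket R U V (jj W) x))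
                 (fscaleR A (- 1) (fmulI A (bracket R U V W x)))))\<rparr>"

definition scale_algd :: "real \<Rightarrow> ('x, 'e::real_normed_vector) cmfd
    \<Rightarrow> ('x, 'a, 'f::real_normed_vector, 'z) vb_scheme \<Rightarrow> ('x, 'a, 'e) algd \<Rightarrow> ('x, 'a, 'e) algd" where
  "scale_algd r X A L = \<lparr>anchor = (\<lambda>a. fscaleR (tangent_bundle X) r (anchor L a)),
     bracket = (\<lambda>U V W. \<lambda>x\<in>U. fscaleR A r (bracket L U V W x))\<rparr>"

text \<open>Isomorphisms of real Lie algebroids are taken over the identity of \<open>X\<close>.\<close>

definition lie_algebroid_isomorphic :: "('x, 'e::real_normed_vector) cmfd
    \<Rightarrow> ('x, 'a, 'f::real_normed_vector, 'y) vb_scheme \<Rightarrow> ('x, 'a, 'e) algd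
    \<Rightarrow> ('x, 'b, 'g::real_normed_vector, 'z) vb_scheme \<Rightarrow> ('x, 'b, 'e) algd \<Rightarrow> bool" where
  "lie_algebroid_isomorphic X A L B L' \<longleftrightarrow>
     real_lie_algebroid X A L \<and> real_lie_algebroid X B L' \<and>
     (\<exists>F G. smooth_bundle_map X A B F \<and> smooth_bundle_map X B A G \<and>
        (\<forall>a\<in>vtotal A. G (F a) = a) \<and> (\<forall>b\<in>vtotal B. F (G b) = b) \<and>
        (\<forall>a\<in>vtotal A. anchor L' (F a) = anchor L a) \<and>
        (\<forall>U. openin (mtop (charts X)) U \<longrightarrow>
          (\<forall>V\<in>smooth_sections X A U. \<forall>W\<in>smooth_sections X A U.
             bracket L' U (\<lambda>x\<in>U. F (V x)) (\<lambda>x\<in>U. F (W x)) = (\<lambda>x\<in>U. F (bracket L U V W x)))))"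


section \<open>Lie--Poisson structures\<close>

text \<open>
  \<open>\<pi>\<close> is the (unique) holomorphic Lie--Poisson structure on the complex dual of \<open>A\<close>.  The right-hand
  sides of the three identities are fibrewise linear, fibrewise constant and zero, respectively, so
  that the identities contain the fibrewise linearity of \<open>\<pi>\<close>.
\<close>

definition holomorphic_lie_poisson :: "('x, 'e::real_normed_vector) cmfd
    \<Rightarrow> ('x, 'a, 'f::real_normed_vector) cvb \<Rightarrow> ('x, 'a, 'e) algd
    \<Rightarrow> ('x \<times> ('a \<Rightarrow> complex), 'e \<times> ('f \<Rightarrow>\<^sub>L real), complex) bivec \<Rightarrow> bool" where
  "holomorphic_lie_poisson X A L \<pi> \<longleftrightarrow> holomorphic_poisson (total_cmfd X (homC A)) \<pi> \<and>
     (let br = pbracket (total_atlas X (homC A)) \<pi> in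
      \<forall>U. openin (mtop (charts X)) U \<longrightarrow>
       (\<forall>V\<in>hol_sections X A U. \<forall>W\<in>hol_sections X A U. \<forall>f\<in>hol_funs X U. \<forall>g\<in>hol_funs X U.
        \<forall>m\<in>vtotal (homC A). fst m \<in> U \<longrightarrow>
          br (lin_fun V) (lin_fun W) m = lin_fun (bracket L U V W) m \<and>
          br (lin_fun V) (f \<circ> fst) m = anchor_act X L V f (fst m) \<and>
          br (f \<circ> fst) (g \<circ> fst) m = 0))"

text \<open>
  The bivector fields \<open>\<Psi>\<inverse>\<^sub>* \<pi>\<^sub>R\<close> and \<open>\<Psi>\<inverse>\<^sub>* \<pi>\<^sub>I\<close> on the real dual.
\<close>

definition pi_Re :: "('x, 'e::real_normed_vector) cmfd \<Rightarrow> ('x, 'a, 'f::real_normed_vector) cvb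
    \<Rightarrow> ('x \<times> ('a \<Rightarrow> complex), 'e \<times> ('f \<Rightarrow>\<^sub>L real), complex) bivec
    \<Rightarrow> ('x \<times> ('a \<Rightarrow> real), 'e \<times> ('f \<Rightarrow>\<^sub>L real), real) bivec" where
  "pi_Re X A \<pi> = push_bivec (total_atlas X (homC A)) (total_atlas X (homR A))
     (inv_into (vtotal (homR A)) (Psi A)) (Re_bivec \<pi>)"

definition pi_Im :: "('x, 'e::real_normed_vector) cmfd \<Rightarrow> ('x, 'a, 'f::real_normed_vector) cvb
    \<Rightarrow> ('x \<times> ('a \<Rightarrow> complex), 'e \<times> ('f \<Rightarrow>\<^sub>L real), complex) bivec
    \<Rightarrow> ('x \<times> ('a \<Rightarrow> real), 'e \<times> ('f \<Rightarrow>\<^sub>L real), real) bivec" where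
  "pi_Im X A \<pi> = push_bivec (total_atlas X (homC A)) (total_atlas X (homR A))
     (inv_into (vtotal (homR A)) (Psi A)) (Im_bivec \<pi>)"

text \<open>
  \<open>L\<close> is the real Lie algebroid structure on \<open>A\<close> determined by the fibrewise linear Poisson
  structure \<open>\<pi>\<close> on the real dual.
\<close>

definition corresponding_algebroid :: "('x, 'e::real_normed_vector) cmfd
    \<Rightarrow> ('x, 'a, 'f::real_normed_vector, 'z) vb_scheme
    \<Rightarrow> ('x \<times> ('a \<Rightarrow> real), 'e \<times> ('f \<Rightarrow>\<^sub>L real), real) bivec \<Rightarrow> ('x, 'a, 'e) algd \<Rightarrow> bool" where
  "corresponding_algebroid X A \<pi> L \<longleftrightarrow> real_lie_algebroid X A L \<and>
     (let br = pbracket (total_atlas X (homR A)) \<pi> in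
      \<forall>U. openin (mtop (charts X)) U \<longrightarrow>
       (\<forall>V\<in>smooth_sections X A U. \<forall>W\<in>smooth_sections X A U. \<forall>f\<in>smooth_funs X U.
        \<forall>m\<in>vtotal (homR A). fst m \<in> U \<longrightarrow>
          br (lin_fun V) (lin_fun W) m = lin_fun (bracket L U V W) m \<and>
          br (lin_fun V) (f \<circ> fst) m = anchor_act X L V f (fst m)))"

end

theory Submission
  imports Defs
begin

text \<open>
  Both isomorphisms are the identity of \<open>A\<close>: the claim is that \<open>4 \<rho>\<^sub>\<Re> = \<rho>\<close> and \<open>4 [V, W]\<^sub>\<Re> = [V, W]\<close> in
  \<open>A\<^sub>R\<close>, and that \<open>- 4 \<rho>\<^sub>\<Im> = \<rho> \<circ> j\<close> and \<open>- 4 [V, W]\<^sub>\<Im> = [V, W]\<^sub>j\<close>.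

  The constants come from the type of \<open>\<pi>\<close>.  For functions \<open>h, k\<close> with complex linear differential,
  \<open>d (Re h)\<close> is the mean of \<open>d h\<close> and its conjugate.  The conjugate has type (0,1) and is
  annihilated by \<open>\<pi>\<close>, whence \<open>\<pi> (d (Re h)) (d (Re k)) = {h, k} / 4\<close> (\<open>bivector_Re_Re\<close>).  Taking real and
  imaginary parts gives the brackets of \<open>Re h\<close> and \<open>Re k\<close> for \<open>\<pi>\<^sub>R\<close> and \<open>\<pi>\<^sub>I\<close>.  The map \<open>\<Psi>\<close> is the identity in
  corresponding bundle charts of the two duals, so these brackets can be read off on the real dual
  (\<open>pbracket_push_Re\<close>, \<open>pbracket_push_Im\<close>).  There \<open>l'\<^sub>V\<close> is \<open>Re l\<^sub>V\<close>, while \<open>Im l\<^sub>V\<close> is \<open>- l'\<close> of \<open>j V\<close>; the latter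
  is where the sign in the second part comes from.

  Apply this to \<open>l\<^sub>V\<close>, \<open>l\<^sub>W\<close> and \<open>p\<^sup>* f\<close> for holomorphic \<open>V\<close>, \<open>W\<close> and \<open>f\<close>.  Taking for \<open>f\<close> the complex linear
  functions of a chart determines the anchors (\<open>corresponding_anchor_eq\<close>).  For the brackets one
  obtains \<open>4 [V, W]\<^sub>\<Re> = [V, W]\<close> and \<open>- 4 [V, W]\<^sub>\<Im> = j [V, W]\<close> (\<open>corresponding_bracket_eq\<close>), and \<open>[V, W]\<^sub>j\<close> is
  \<open>j [V, W]\<close> too, because the holomorphic bracket is complex bilinear (\<open>imaginary_bracket_hol\<close>).

  To pass to smooth sections, note that two brackets which satisfy the Leibniz rule for the same
  anchor differ by a tensor.  Locally the smooth sections are generated over the smooth functions by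
  the constant sections of a trivialization, which are holomorphic; so the brackets agree on all smooth
  sections (\<open>derivation_brackets_agree\<close>, \<open>brackets_agree\<close>).  Rescaling a Lie algebroid by a constant is a pull-back
  (\<open>real_lie_algebroid_rescale\<close>), so the left-hand sides are Lie algebroids, and with them the structure with
  bracket \<open>[V, W]\<^sub>j\<close>.
\<close>

section \<open>Finite-dimensional normed spaces\<close>

text \<open>A bound on the coefficients makes the coefficients of a convergent sequence in the span Cauchy, and
  their limits are the coefficients of the limit.\<close>

lemma closed_span_if_coefficients_bounded:
  fixes B :: "'f::real_normed_vector set"
  assumes "finite B" and K: "\<And>c b. b \<in> B \<Longrightarrow> \<bar>c b\<bar> \<le> K * norm (\<Sum>b\<in>B. c b *\<^sub>R b)"
  shows "closed (span B)"
  unfolding closed_sequential_limits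
proof (intro allI impI)
  fix y l assume "(\<forall>n. y n \<in> span B) \<and> y \<longlonglongrightarrow> l"
  then have y: "\<And>n. y n \<in> span B" and lim: "y \<longlonglongrightarrow> l" by auto
  have "\<forall>n. \<exists>u. y n = (\<Sum>b\<in>B. u b *\<^sub>R b)"
    using y span_finite[OF \<open>finite B\<close>] by auto
  then obtain c where c: "\<And>n. y n = (\<Sum>b\<in>B. c n b *\<^sub>R b)" by metis
  have "Cauchy (\<lambda>n. c n b)" if b: "b \<in> B" for b
  proof (rule metric_CauchyI)
    fix e :: real assume e: "e > 0"
    define K' where "K' = max K 1"
    have K': "\<bar>d b\<bar> \<le> K' * norm (\<Sum>b\<in>B. d b *\<^sub>R b)" for d
    proof -
      have "K * norm (\<Sum>b\<in>B. d b *\<^sub>R b) \<le> K' * norm (\<Sum>b\<in>B. d b *\<^sub>R b)"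
        unfolding K'_def by (intro mult_right_mono) auto
      then show ?thesis using K[OF b, of d] by linarith
    qed
    have pos: "K' > 0" unfolding K'_def by simp
    have "Cauchy y" using lim LIMSEQ_imp_Cauchy by blast
    then obtain M where M: "\<forall>m\<ge>M. \<forall>n\<ge>M. dist (y m) (y n) < e / K'"
      using metric_CauchyD e pos by (metis divide_pos_pos)
    have "dist (c m b) (c n b) < e" if "m \<ge> M" "n \<ge> M" for m n
    proof -
      have "\<bar>c m b - c n b\<bar> \<le> K' * norm (y m - y n)"
        using K'[of "\<lambda>b. c m b - c n b"]
        by (simp add: c scaleR_diff_left sum_subtractf)
      moreover have "norm (y m - y n) < e / K'" using M that by (simp add: dist_norm)
      ultimately show ?thesis using pos
        by (simp add: dist_real_def pos_less_divide_eq mult.commute)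
    qed
    then show "\<exists>M. \<forall>m\<ge>M. \<forall>n\<ge>M. dist (c m b) (c n b) < e" by blast
  qed
  then have "\<forall>b\<in>B. \<exists>z. (\<lambda>n. c n b) \<longlonglongrightarrow> z"
    using Cauchy_convergent_iff convergent_def by blast
  then obtain z where z: "\<And>b. b \<in> B \<Longrightarrow> (\<lambda>n. c n b) \<longlonglongrightarrow> z b" by metis
  have "y \<longlonglongrightarrow> (\<Sum>b\<in>B. z b *\<^sub>R b)"
    unfolding c[abs_def] by (intro tendsto_intros z)
  then have "l = (\<Sum>b\<in>B. z b *\<^sub>R b)" using lim LIMSEQ_unique by blast
  then show "l \<in> span B" by (simp add: span_base span_scale span_sum)
qed

text \<open>Induction on the basis.  A vector \<open>a\<close> outside the closed set \<open>span B\<close> has positive distance \<open>d\<close> from it,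
  which bounds the coefficient of \<open>a\<close> by \<open>1 / d\<close> times the norm; the induction hypothesis, applied to the
  remaining sum, bounds the other coefficients.\<close>

lemma coefficients_bounded:
  fixes B :: "'f::real_normed_vector set"
  assumes "finite B" "independent B"
  shows "\<exists>K. \<forall>c. \<forall>b\<in>B. \<bar>c b\<bar> \<le> K * norm (\<Sum>b\<in>B. c b *\<^sub>R b)"
  using assms
proof (induction B rule: finite_induct)
  case empty then show ?case by auto
next
  case (insert a B)
  have indB: "independent B" and a: "a \<notin> span B"
    using insert.prems insert.hyps by (auto simp: independent_insert)
  obtain K where K: "\<And>c b. b \<in> B \<Longrightarrow> \<bar>c b\<bar> \<le> K * norm (\<Sum>b\<in>B. c b *\<^sub>R b)"
    using insert.IH[OF indB] by blast
  have "closed (span B)" using closed_span_if_coefficients_bounded[OF insert.hyps(1) K] .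
  then have "open (- span B)" by auto
  then obtain d where d: "d > 0" "\<And>y. dist y a < d \<Longrightarrow> y \<notin> span B"
    using a unfolding open_dist by force
  have away: "\<bar>t\<bar> * d \<le> norm (t *\<^sub>R a + y)" if "y \<in> span B" for t y
  proof (cases "t = 0")
    case False
    have "(- 1 / t) *\<^sub>R y \<in> span B" using that span_scale by blast
    then have "d \<le> dist ((- 1 / t) *\<^sub>R y) a" using d(2) not_le by blast
    then have "\<bar>t\<bar> * d \<le> norm (t *\<^sub>R ((- 1 / t) *\<^sub>R y - a))"
      by (simp add: dist_norm mult_left_mono)
    also have "t *\<^sub>R ((- 1 / t) *\<^sub>R y - a) = - (t *\<^sub>R a + y)"
      using False by (simp add: scaleR_diff_right)
    finally show ?thesis by (simp only: norm_minus_cancel)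
  qed simp
  \<comment> \<open>The first summand accounts for the coefficients of \<open>B\<close>, the second one for that of \<open>a\<close>.\<close>
  define K' where "K' = \<bar>K\<bar> * (1 + norm a / d) + 1 / d"
  have "\<bar>c b\<bar> \<le> K' * norm (\<Sum>b\<in>insert a B. c b *\<^sub>R b)" if b: "b \<in> insert a B" for c b
  proof -
    define y where "y = (\<Sum>b\<in>B. c b *\<^sub>R b)"
    define N where "N = norm (c a *\<^sub>R a + y)"
    have N: "norm (\<Sum>b\<in>insert a B. c b *\<^sub>R b) = N"
      using insert.hyps by (simp add: N_def y_def)
    have "y \<in> span B" unfolding y_def by (simp add: span_base span_scale span_sum)
    from away[OF this] have ca: "\<bar>c a\<bar> \<le> N / d"
      using d(1) by (simp add: N_def pos_le_divide_eq)
    have N0: "N \<ge> 0" by (simp add: N_def)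
    have "norm y \<le> N + norm (c a *\<^sub>R a)"
      unfolding N_def by (metis add_diff_cancel_left' norm_triangle_ineq4 norm_minus_commute)
    also have "norm (c a *\<^sub>R a) \<le> N / d * norm a"
      using mult_right_mono[OF ca, of "norm a"] by simp
    finally have y: "norm y \<le> (1 + norm a / d) * N" by (simp add: algebra_simps)
    show ?thesis
    proof (cases "b = a")
      case True
      have "0 \<le> \<bar>K\<bar> * (1 + norm a / d) * N" using N0 d(1) by simp
      then show ?thesis using ca True N by (simp add: K'_def algebra_simps)
    next
      case False
      then have "\<bar>c b\<bar> \<le> K * norm y" using K b by (auto simp: y_def)
      also have "\<dots> \<le> \<bar>K\<bar> * norm y" by (intro mult_right_mono) auto
      also have "\<dots> \<le> \<bar>K\<bar> * ((1 + norm a / d) * N)" using y by (intro mult_left_mono) auto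
      also have "\<dots> \<le> K' * N" using N0 d(1) by (simp add: K'_def algebra_simps)
      finally show ?thesis using N by simp
    qed
  qed
  then show ?case by blast
qed

lemma finite_dim_coordinates:
  assumes "\<exists>B::'f::real_normed_vector set. finite B \<and> span B = UNIV"
  obtains B :: "'f::real_normed_vector set" and \<kappa> :: "'f::real_normed_vector \<Rightarrow> 'f::real_normed_vector \<Rightarrow> real"
    where "finite B" "\<And>b. bounded_linear (\<kappa> b)" "\<And>v. (\<Sum>b\<in>B. \<kappa> b v *\<^sub>R b) = v"
proof -
  obtain B0 :: "'f set" where B0: "finite B0" "span B0 = UNIV" using assms by blast
  obtain B where B: "B \<subseteq> B0" "independent B" "span B = UNIV"
    using maximal_independent_subset[of B0] B0(2) by (metis span_mono span_span top.extremum_uniqueI)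
  have fin: "finite B" using B(1) B0(1) finite_subset by blast
  define \<kappa> where "\<kappa> b v = (if b \<in> B then representation B v b else 0)" for b v
  have repr: "(\<Sum>b\<in>B. \<kappa> b v *\<^sub>R b) = v" for v
    unfolding \<kappa>_def using sum_representation_eq[OF B(2) _ fin subset_refl, of v] B(3) by simp
  obtain K where K: "\<And>c b. b \<in> B \<Longrightarrow> \<bar>c b\<bar> \<le> K * norm (\<Sum>b\<in>B. c b *\<^sub>R b)"
    using coefficients_bounded[OF fin B(2)] by blast
  have "bounded_linear (\<kappa> b)" for b
  proof (rule bounded_linear_intro[where K = "\<bar>K\<bar>"])
    show "\<kappa> b (x + y) = \<kappa> b x + \<kappa> b y" for x y
      using B by (simp add: \<kappa>_def representation_add)
    show "\<kappa> b (r *\<^sub>R x) = r *\<^sub>R \<kappa> b x" for r x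
      using B by (simp add: \<kappa>_def representation_scale)
    show "norm (\<kappa> b x) \<le> norm x * \<bar>K\<bar>" for x
    proof (cases "b \<in> B")
      case True
      then have "\<bar>\<kappa> b x\<bar> \<le> K * norm x" using K[OF True, of "\<lambda>b. \<kappa> b x"] repr by simp
      also have "\<dots> \<le> \<bar>K\<bar> * norm x" by (intro mult_right_mono) auto
      finally show ?thesis by (simp add: mult.commute)
    qed (simp add: \<kappa>_def)
  qed
  then show ?thesis using that fin repr by blast
qed

lemma finite_dim_bounded_linear:
  fixes f :: "'f::real_normed_vector \<Rightarrow> 'g::real_normed_vector"
  assumes "\<exists>B::'f set. finite B \<and> span B = UNIV" "linear f"
  shows "bounded_linear f"
proof -
  obtain B :: "'f set" and \<kappa> where B: "finite B" "\<And>b. bounded_linear (\<kappa> b :: 'f \<Rightarrow> real)"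
    "\<And>v. (\<Sum>b\<in>B. \<kappa> b v *\<^sub>R b) = v" by (rule finite_dim_coordinates[OF assms(1)]) blast
  have "f v = (\<Sum>b\<in>B. \<kappa> b v *\<^sub>R f b)" for v
  proof -
    have "f v = f (\<Sum>b\<in>B. \<kappa> b v *\<^sub>R b)" using B(3) by simp
    also have "\<dots> = (\<Sum>b\<in>B. \<kappa> b v *\<^sub>R f b)"
      by (simp add: linear_sum[OF assms(2)] linear_scale[OF assms(2)])
    finally show ?thesis .
  qed
  then have eq: "f = (\<lambda>v. \<Sum>b\<in>B. \<kappa> b v *\<^sub>R f b)" by (rule ext)
  show ?thesis
    by (subst eq) (intro bounded_linear_sum bounded_linear_scaleR_const B(2))
qed

lemma finite_dim_functionals_separate:
  fixes u v :: "'f::real_normed_vector"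
  assumes "\<exists>B::'f set. finite B \<and> span B = UNIV"
    and "\<And>l::'f \<Rightarrow> real. bounded_linear l \<Longrightarrow> l u = l v"
  shows "u = v"
proof -
  obtain B :: "'f set" and \<kappa> where B: "finite B" "\<And>b. bounded_linear (\<kappa> b :: 'f \<Rightarrow> real)"
    "\<And>v. (\<Sum>b\<in>B. \<kappa> b v *\<^sub>R b) = v" by (rule finite_dim_coordinates[OF assms(1)]) blast
  have "(\<Sum>b\<in>B. \<kappa> b u *\<^sub>R b) = (\<Sum>b\<in>B. \<kappa> b v *\<^sub>R b)"
    using assms(2)[OF B(2)] by simp
  then show ?thesis by (simp only: B(3))
qed

section \<open>Closure properties of smooth maps\<close>

lemma frechet_derivative_unique: "(f has_derivative D) (at x) \<Longrightarrow> frechet_derivative f (at x) = D"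
  using frechet_derivative_at by metis

lemma has_derivative_frechet:
  "f differentiable (at x) \<Longrightarrow> (f has_derivative frechet_derivative f (at x)) (at x)"
  using frechet_derivative_works by blast

text \<open>\<open>frechet_derivative\<close> is a choice from the set of all derivatives.  It therefore depends on this set
  only, and the third equality also covers points where \<open>f\<close> is not differentiable.\<close>

lemma
  assumes "open S" "x \<in> S" "\<And>y. y \<in> S \<Longrightarrow> f y = g y"
  shows has_derivative_cong_open: "(f has_derivative D) (at x) \<longleftrightarrow> (g has_derivative D) (at x)"
    and differentiable_cong_open: "f differentiable (at x) \<longleftrightarrow> g differentiable (at x)"
    and frechet_derivative_cong_open: "frechet_derivative f (at x) = frechet_derivative g (at x)"
proof -
  have *: "(f has_derivative D) (at x) \<longleftrightarrow> (g has_derivative D) (at x)" for D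
    using has_derivative_transform_within_open[OF _ assms(1,2)] assms(3) by metis
  then show "(f has_derivative D) (at x) \<longleftrightarrow> (g has_derivative D) (at x)" .
  show "f differentiable (at x) \<longleftrightarrow> g differentiable (at x)"
    by (simp add: differentiable_def *)
  show "frechet_derivative f (at x) = frechet_derivative g (at x)"
    by (simp add: frechet_derivative_def *)
qed

lemma Ck_on_cong:
  "open S \<Longrightarrow> (\<And>x. x \<in> S \<Longrightarrow> f x = g x) \<Longrightarrow> Ck_on k S f \<longleftrightarrow> Ck_on k S g"
proof (induction k arbitrary: f g)
  case 0 then show ?case by (simp cong: continuous_on_cong)
next
  case (Suc k)
  have "Ck_on k S (\<lambda>x. frechet_derivative f (at x) v) \<longleftrightarrow> Ck_on k S (\<lambda>x. frechet_derivative g (at x) v)" for v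
    using Suc.prems by (intro Suc.IH) (auto simp: frechet_derivative_cong_open[of S _ f g])
  then show ?case using Suc.prems by (simp add: differentiable_cong_open[of S _ f g])
qed

lemma Ck_on_SucI:
  assumes "open S" "\<And>x. x \<in> S \<Longrightarrow> (f has_derivative D x) (at x)" "\<And>v. Ck_on k S (\<lambda>x. D x v)"
  shows "Ck_on (Suc k) S f"
proof -
  have "Ck_on k S (\<lambda>x. frechet_derivative f (at x) v)" for v
    using assms(3)[of v] frechet_derivative_unique[OF assms(2)]
    by (subst Ck_on_cong[OF assms(1), where g = "\<lambda>x. D x v"]) auto
  then show ?thesis using assms(2) by (auto simp: differentiable_def)
qed

lemma Ck_on_SucD:
  assumes "Ck_on (Suc k) S f"
  shows "x \<in> S \<Longrightarrow> (f has_derivative frechet_derivative f (at x)) (at x)"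
    and "Ck_on k S (\<lambda>x. frechet_derivative f (at x) v)"
  using assms by (auto intro: has_derivative_frechet)

lemma Ck_on_pred: "Ck_on (Suc k) S f \<Longrightarrow> Ck_on k S f"
proof (induction k arbitrary: f)
  case 0
  then show ?case
    by (auto intro!: differentiable_imp_continuous_within continuous_at_imp_continuous_on)
next
  case (Suc k)
  then show ?case by (metis Ck_on.simps(2))
qed

lemma Ck_on_subset: "T \<subseteq> S \<Longrightarrow> Ck_on k S f \<Longrightarrow> Ck_on k T f"
  by (induction k arbitrary: f) (auto intro: continuous_on_subset)

lemma Ck_on_const: "Ck_on k S (\<lambda>x. c)"
  by (induction k arbitrary: c) auto

lemma Ck_on_bounded_linear:
  assumes "bounded_linear L" "open S"
  shows "Ck_on k S f \<Longrightarrow> Ck_on k S (\<lambda>x. L (f x))"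
proof (induction k arbitrary: f)
  case 0 then show ?case
    using assms(1) by (auto intro: bounded_linear.continuous_on)
next
  case (Suc k)
  show ?case
    by (rule Ck_on_SucI[OF assms(2)],
        rule bounded_linear.has_derivative[OF assms(1) Ck_on_SucD(1)[OF Suc.prems]], assumption)
      (rule Suc.IH[OF Ck_on_SucD(2)[OF Suc.prems]])
qed

lemma Ck_on_add:
  assumes "open S"
  shows "Ck_on k S f \<Longrightarrow> Ck_on k S g \<Longrightarrow> Ck_on k S (\<lambda>x. f x + g x)"
proof (induction k arbitrary: f g)
  case 0 then show ?case by (simp add: continuous_intros)
next
  case (Suc k)
  note f = Suc.prems(1) and g = Suc.prems(2)
  show ?case
    by (rule Ck_on_SucI[OF assms],
        rule has_derivative_add[OF Ck_on_SucD(1)[OF f] Ck_on_SucD(1)[OF g]], assumption, assumption)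
      (rule Suc.IH[OF Ck_on_SucD(2)[OF f] Ck_on_SucD(2)[OF g]])
qed

lemma Ck_on_Pair:
  assumes "open S"
  shows "Ck_on k S f \<Longrightarrow> Ck_on k S g \<Longrightarrow> Ck_on k S (\<lambda>x. (f x, g x))"
proof (induction k arbitrary: f g)
  case 0 then show ?case by (simp add: continuous_intros)
next
  case (Suc k)
  note f = Suc.prems(1) and g = Suc.prems(2)
  show ?case
    by (rule Ck_on_SucI[OF assms],
        rule has_derivative_Pair[OF Ck_on_SucD(1)[OF f] Ck_on_SucD(1)[OF g]], assumption, assumption)
      (rule Suc.IH[OF Ck_on_SucD(2)[OF f] Ck_on_SucD(2)[OF g]])
qed

lemma Ck_on_scaleR:
  assumes "open S"
  shows "Ck_on k S f \<Longrightarrow> Ck_on k S g \<Longrightarrow> Ck_on k S (\<lambda>x. f x *\<^sub>R g x)"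
proof (induction k arbitrary: f g)
  case 0 then show ?case by (simp add: continuous_intros)
next
  case (Suc k)
  note f = Suc.prems(1) and g = Suc.prems(2)
  show ?case
    by (rule Ck_on_SucI[OF assms],
        rule has_derivative_scaleR[OF Ck_on_SucD(1)[OF f] Ck_on_SucD(1)[OF g]], assumption, assumption)
      (rule Ck_on_add[OF assms Suc.IH[OF Ck_on_pred[OF f] Ck_on_SucD(2)[OF g]]
          Suc.IH[OF Ck_on_SucD(2)[OF f] Ck_on_pred[OF g]]])
qed

lemma Ck_on_sum:
  assumes "open S"
  shows "(\<And>i. i \<in> I \<Longrightarrow> Ck_on k S (f i)) \<Longrightarrow> Ck_on k S (\<lambda>x. \<Sum>i\<in>I. f i x)"
  by (induction I rule: infinite_finite_induct) (auto intro: Ck_on_const Ck_on_add[OF assms])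

lemma Ck_on_compose_fst:
  fixes f :: "'a::real_normed_vector \<Rightarrow> 'b::real_normed_vector"
  assumes "open S"
  shows "Ck_on k S f \<Longrightarrow> Ck_on k (S \<times> (UNIV :: 'c::real_normed_vector set)) (\<lambda>p. f (fst p))"
proof (induction k arbitrary: f)
  case 0 then show ?case
    by (auto intro!: continuous_on_compose2[of S f] continuous_intros)
next
  case (Suc k)
  show ?case
  proof (rule Ck_on_SucI)
    show "open (S \<times> (UNIV :: 'c set))" using assms by (simp add: open_Times)
    show "((\<lambda>p. f (fst p)) has_derivative (\<lambda>v. frechet_derivative f (at (fst p)) (fst v))) (at p)"
      if "p \<in> S \<times> UNIV" for p :: "'a \<times> 'c"
      using that by (intro has_derivative_compose[OF has_derivative_fst[OF has_derivative_ident]]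
          Ck_on_SucD(1)[OF Suc.prems]) auto
    show "Ck_on k (S \<times> (UNIV :: 'c set)) (\<lambda>p. frechet_derivative f (at (fst p)) (fst v))" for v :: "'a \<times> 'c"
      using Suc.IH[OF Ck_on_SucD(2)[OF Suc.prems, of "fst v"]] .
  qed
qed

lemma Ck_on_bounded_linear_self:
  assumes "bounded_linear L" shows "Ck_on k S L"
proof (cases k)
  case 0 then show ?thesis using linear_continuous_on[OF assms] by simp
next
  case (Suc j)
  have "Ck_on (Suc j) UNIV L"
    by (rule Ck_on_SucI[OF open_UNIV bounded_linear_imp_has_derivative[OF assms]])
      (rule Ck_on_const)
  then show ?thesis using Suc Ck_on_subset by blast
qed

lemma smooth_on_cong:
  assumes "open S" "\<And>x. x \<in> S \<Longrightarrow> f x = g x"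
  shows "smooth_on S f \<longleftrightarrow> smooth_on S g"
  unfolding smooth_on_def using Ck_on_cong[OF assms(1), of f g] assms(2) by simp

lemma smooth_on_bounded_linear:
  "open S \<Longrightarrow> bounded_linear L \<Longrightarrow> smooth_on S f \<Longrightarrow> smooth_on S (\<lambda>x. L (f x))"
  unfolding smooth_on_def by (simp add: Ck_on_bounded_linear[of L S])

lemma smooth_on_add:
  "open S \<Longrightarrow> smooth_on S f \<Longrightarrow> smooth_on S g \<Longrightarrow> smooth_on S (\<lambda>x. f x + g x)"
  unfolding smooth_on_def by (simp add: Ck_on_add)

lemma smooth_on_Pair:
  "open S \<Longrightarrow> smooth_on S f \<Longrightarrow> smooth_on S g \<Longrightarrow> smooth_on S (\<lambda>x. (f x, g x))"
  unfolding smooth_on_def by (simp add: Ck_on_Pair)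

lemma smooth_on_scaleR:
  "open S \<Longrightarrow> smooth_on S f \<Longrightarrow> smooth_on S g \<Longrightarrow> smooth_on S (\<lambda>x. f x *\<^sub>R g x)"
  unfolding smooth_on_def by (simp add: Ck_on_scaleR)

lemma smooth_on_sum:
  "open S \<Longrightarrow> (\<And>i. i \<in> I \<Longrightarrow> smooth_on S (f i)) \<Longrightarrow> smooth_on S (\<lambda>x. \<Sum>i\<in>I. f i x)"
  unfolding smooth_on_def by (simp add: Ck_on_sum)

lemma smooth_on_compose_fst:
  "open S \<Longrightarrow> smooth_on S f \<Longrightarrow> smooth_on (S \<times> UNIV) (\<lambda>p. f (fst p))"
  unfolding smooth_on_def by (simp add: Ck_on_compose_fst)

lemma smooth_on_subset: "T \<subseteq> S \<Longrightarrow> smooth_on S f \<Longrightarrow> smooth_on T f"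
  unfolding smooth_on_def using Ck_on_subset by blast

lemma smooth_on_const: "smooth_on S (\<lambda>x. c)"
  unfolding smooth_on_def using Ck_on_const by blast

lemma smooth_on_linear: "bounded_linear L \<Longrightarrow> smooth_on S L"
  unfolding smooth_on_def using Ck_on_bounded_linear_self by blast

lemma smooth_on_differentiable: "smooth_on S f \<Longrightarrow> x \<in> S \<Longrightarrow> f differentiable (at x)"
  unfolding smooth_on_def by (metis Ck_on.simps(2))

section \<open>Holomorphic maps\<close>

text \<open>The first-order part of holomorphy: a real differential that commutes with the complex
  structures.  Tangent vectors, differentials and bivectors at a point involve first derivatives
  only, so on the complex dual this is the regularity that is established.\<close>

definition cdiff_on :: "('e \<Rightarrow> 'e) \<Rightarrow> ('f \<Rightarrow> 'f) \<Rightarrow> 'e::real_normed_vector set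
    \<Rightarrow> ('e \<Rightarrow> 'f::real_normed_vector) \<Rightarrow> bool" where
  "cdiff_on J K S f \<longleftrightarrow> (\<forall>x\<in>S. f differentiable (at x) \<and>
     (\<forall>v. frechet_derivative f (at x) (J v) = K (frechet_derivative f (at x) v)))"

lemma hol_on_iff: "hol_on J K S f \<longleftrightarrow> smooth_on S f \<and> cdiff_on J K S f"
  unfolding hol_on_def cdiff_on_def using smooth_on_differentiable by blast

lemma cdiff_onI:
  assumes "\<And>x. x \<in> S \<Longrightarrow> (f has_derivative D x) (at x)"
    and "\<And>x v. x \<in> S \<Longrightarrow> D x (J v) = K (D x v)"
  shows "cdiff_on J K S f"
  unfolding cdiff_on_def using assms frechet_derivative_unique[OF assms(1)]
  by (auto simp: differentiable_def)

lemma cdiff_onD: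
  assumes "cdiff_on J K S f" "x \<in> S"
  shows "(f has_derivative frechet_derivative f (at x)) (at x)"
    and "frechet_derivative f (at x) (J v) = K (frechet_derivative f (at x) v)"
  using assms has_derivative_frechet unfolding cdiff_on_def by blast+

lemma cdiff_on_cong:
  assumes "open S" "\<And>x. x \<in> S \<Longrightarrow> f x = g x"
  shows "cdiff_on J K S f \<longleftrightarrow> cdiff_on J K S g"
proof -
  have "f differentiable (at x) \<longleftrightarrow> g differentiable (at x)"
    "frechet_derivative f (at x) = frechet_derivative g (at x)" if "x \<in> S" for x
    using differentiable_cong_open[of S x f g] frechet_derivative_cong_open[of S x f g] assms that by auto
  then show ?thesis unfolding cdiff_on_def by auto
qed

lemma cdiff_on_eq:
  "cdiff_on J K S f \<Longrightarrow> open S \<Longrightarrow> (\<And>x. x \<in> S \<Longrightarrow> f x = g x) \<Longrightarrow> cdiff_on J K S g"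
  using cdiff_on_cong[of S f g] by blast

lemma cdiff_on_subset: "T \<subseteq> S \<Longrightarrow> cdiff_on J K S f \<Longrightarrow> cdiff_on J K T f"
  unfolding cdiff_on_def by blast

lemma cdiff_on_compose_linear:
  assumes "bounded_linear L" "\<And>v. L (K v) = K' (L v)" "cdiff_on J K S f"
  shows "cdiff_on J K' S (\<lambda>x. L (f x))"
  by (rule cdiff_onI, rule bounded_linear.has_derivative[OF assms(1) cdiff_onD(1)[OF assms(3)]])
    (simp_all add: assms(2) cdiff_onD(2)[OF assms(3)])

lemma cdiff_on_Pair:
  assumes "cdiff_on J K S f" "cdiff_on J K' S g"
  shows "cdiff_on J (map_prod K K') S (\<lambda>x. (f x, g x))"
  by (rule cdiff_onI, rule has_derivative_Pair[OF cdiff_onD(1)[OF assms(1)] cdiff_onD(1)[OF assms(2)]])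
    (simp_all add: cdiff_onD(2)[OF assms(1)] cdiff_onD(2)[OF assms(2)])

lemma cdiff_on_const: "K 0 = 0 \<Longrightarrow> cdiff_on J K S (\<lambda>x. c)"
  by (rule cdiff_onI[where D = "\<lambda>_ _. 0"]) auto

lemma hol_on_cong:
  "open S \<Longrightarrow> (\<And>x. x \<in> S \<Longrightarrow> f x = g x) \<Longrightarrow> hol_on J K S f \<longleftrightarrow> hol_on J K S g"
  unfolding hol_on_iff using smooth_on_cong cdiff_on_cong by metis

lemma hol_on_subset: "T \<subseteq> S \<Longrightarrow> hol_on J K S f \<Longrightarrow> hol_on J K T f"
  unfolding hol_on_iff using smooth_on_subset cdiff_on_subset by blast

section \<open>Charts, tangent vectors and differentials\<close>

text \<open>Charts are injective, so that their images commute with intersections and the sets on the right form a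
  topology.\<close>

lemma openin_mtop:
  assumes "atlas P C"
  shows "openin (mtop C) W \<longleftrightarrow> W \<subseteq> points C \<and> (\<forall>c\<in>C. open (snd c ` (fst c \<inter> W)))"
proof -
  define Q where "Q W \<longleftrightarrow> W \<subseteq> points C \<and> (\<forall>c\<in>C. open (snd c ` (fst c \<inter> W)))" for W
  have "istopology Q"
    unfolding istopology_def
  proof (intro conjI allI impI)
    fix S T assume ST: "Q S" "Q T"
    have "snd c ` (fst c \<inter> (S \<inter> T)) = snd c ` (fst c \<inter> S) \<inter> snd c ` (fst c \<inter> T)" if "c \<in> C" for c
      using assms that unfolding atlas_def inj_on_def by blast
    then show "Q (S \<inter> T)" using ST by (auto simp: Q_def)
  next
    fix K assume K: "\<forall>S\<in>K. Q S"
    have "snd c ` (fst c \<inter> \<Union> K) = (\<Union>S\<in>K. snd c ` (fst c \<inter> S))" if "c \<in> C" for c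
      by blast
    then show "Q (\<Union> K)" using K by (auto simp: Q_def intro!: open_UN)
  qed
  then show ?thesis unfolding mtop_def Q_def[abs_def] by (simp add: topology_inverse')
qed

lemma chart_at:
  assumes "m \<in> points C"
  shows "chart_at C m \<in> C" "m \<in> fst (chart_at C m)"
proof -
  have "\<exists>c. c \<in> C \<and> m \<in> fst c" using assms by (auto simp: points_def)
  then have "chart_at C m \<in> C \<and> m \<in> fst (chart_at C m)"
    unfolding chart_at_def by (rule someI_ex)
  then show "chart_at C m \<in> C" "m \<in> fst (chart_at C m)" by auto
qed

lemma in_pointsI: "c \<in> C \<Longrightarrow> m \<in> fst c \<Longrightarrow> m \<in> points C"
  by (auto simp: points_def)

text \<open>Differentiability of a complex function at a point, with complex linear differential.  It does
  not depend on the chart when the coordinate changes have complex linear differentials.\<close>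

definition cdiff_at :: "('m, 'e::real_normed_vector) chart set \<Rightarrow> ('e \<Rightarrow> 'e) \<Rightarrow> ('m \<Rightarrow> complex) \<Rightarrow> 'm \<Rightarrow> bool"
  where "cdiff_at C J h m \<longleftrightarrow> (\<exists>c\<in>C. m \<in> fst c \<and> cdiff_on J ((*) \<i>) {snd c m} (h \<circ> chart_inv c))"

definition differentiable_at ::
    "('m, 'e::real_normed_vector) chart set \<Rightarrow> ('m \<Rightarrow> 'k::real_normed_vector) \<Rightarrow> 'm \<Rightarrow> bool" where
  "differentiable_at C f m \<longleftrightarrow> (\<exists>c\<in>C. m \<in> fst c \<and> (f \<circ> chart_inv c) differentiable (at (snd c m)))"

lemma cdiff_at_differentiable: "cdiff_at C J h m \<Longrightarrow> differentiable_at C h m"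
  unfolding cdiff_at_def differentiable_at_def cdiff_on_def by auto

text \<open>The derivative at \<open>m\<close> of the change of coordinates from \<open>c\<close> to \<open>d\<close>.\<close>

abbreviation dchange ::
    "('m, 'e::real_normed_vector) chart \<Rightarrow> ('m, 'e) chart \<Rightarrow> 'm \<Rightarrow> 'e \<Rightarrow> 'e" where
  "dchange c d m \<equiv> frechet_derivative (snd d \<circ> chart_inv c) (at (snd c m))"

lemma tangent_spaceI:
  assumes "\<And>c. c \<notin> C \<or> m \<notin> fst c \<Longrightarrow> v c = 0"
    and "\<And>c d. c \<in> C \<Longrightarrow> d \<in> C \<Longrightarrow> m \<in> fst c \<Longrightarrow> m \<in> fst d \<Longrightarrow>
      v d = dchange c d m (v c)"
  shows "v \<in> tangent_space C m"
  using assms unfolding tangent_space_def by blast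

locale cdiff_atlas =
  fixes C :: "('m, 'e::real_normed_vector) chart set" and J :: "'e \<Rightarrow> 'e"
  assumes atl: "atlas (cdiff_on J J) C" and J0: "J 0 = 0"
begin

lemma inj: "c \<in> C \<Longrightarrow> inj_on (snd c) (fst c)"
  using atl unfolding atlas_def by blast

lemma chart_inv [simp]: "c \<in> C \<Longrightarrow> m \<in> fst c \<Longrightarrow> chart_inv c (snd c m) = m"
  using inj by simp

lemma open_image: "c \<in> C \<Longrightarrow> open (snd c ` fst c)"
  using atl unfolding atlas_def by blast

lemma open_overlap: "c \<in> C \<Longrightarrow> d \<in> C \<Longrightarrow> open (snd c ` (fst c \<inter> fst d))"
  using atl unfolding atlas_def by blast

lemma openin_iff:
  "openin (mtop C) W \<longleftrightarrow> W \<subseteq> points C \<and> (\<forall>c\<in>C. open (snd c ` (fst c \<inter> W)))"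
  using openin_mtop[OF atl] .

lemma openin_chart: "d \<in> C \<Longrightarrow> openin (mtop C) (fst d)"
  using open_overlap by (auto simp: openin_iff points_def)

lemma transition:
  assumes "c \<in> C" "d \<in> C" "m \<in> fst c" "m \<in> fst d"
  shows "((snd d \<circ> chart_inv c) has_derivative dchange c d m) (at (snd c m))"
    and "dchange c d m (J v) =
      J (dchange c d m v)"
proof -
  have "cdiff_on J J (snd c ` (fst c \<inter> fst d)) (snd d \<circ> chart_inv c)"
    using atl assms unfolding atlas_def by blast
  moreover have "snd c m \<in> snd c ` (fst c \<inter> fst d)" using assms by blast
  ultimately show "((snd d \<circ> chart_inv c) has_derivative dchange c d m) (at (snd c m))"
    and "dchange c d m (J v) =
      J (dchange c d m v)"
    by (blast dest: cdiff_onD)+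
qed

lemma transition_linear:
  assumes "c \<in> C" "d \<in> C" "m \<in> fst c" "m \<in> fst d"
  shows "linear (dchange c d m)"
  using transition(1)[OF assms] has_derivative_linear by blast

lemma tangent_spaceD:
  assumes "v \<in> tangent_space C m"
  shows "c \<notin> C \<or> m \<notin> fst c \<Longrightarrow> v c = 0"
    and "c \<in> C \<Longrightarrow> d \<in> C \<Longrightarrow> m \<in> fst c \<Longrightarrow> m \<in> fst d \<Longrightarrow>
      v d = dchange c d m (v c)"
  using assms unfolding tangent_space_def by blast+

lemma tangent_scaleR:
  assumes "v \<in> tangent_space C m"
  shows "(\<lambda>c. r *\<^sub>R v c) \<in> tangent_space C m"
proof (rule tangent_spaceI)
  fix c assume "c \<notin> C \<or> m \<notin> fst c"
  then show "r *\<^sub>R v c = 0" using tangent_spaceD(1)[OF assms] by simp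
next
  fix c d assume *: "c \<in> C" "d \<in> C" "m \<in> fst c" "m \<in> fst d"
  show "r *\<^sub>R v d = dchange c d m (r *\<^sub>R v c)"
    using tangent_spaceD(2)[OF assms *] linear_scale[OF transition_linear[OF *]] by simp
qed

lemma tangent_J:
  assumes "v \<in> tangent_space C m"
  shows "(\<lambda>c. J (v c)) \<in> tangent_space C m"
proof (rule tangent_spaceI)
  fix c assume "c \<notin> C \<or> m \<notin> fst c"
  then show "J (v c) = 0" using tangent_spaceD(1)[OF assms] J0 by simp
next
  fix c d assume *: "c \<in> C" "d \<in> C" "m \<in> fst c" "m \<in> fst d"
  show "J (v d) = dchange c d m (J (v c))"
    using tangent_spaceD(2)[OF assms *] transition(2)[OF *] by simp
qed

lemma tangent_add:
  assumes "v \<in> tangent_space C m" "w \<in> tangent_space C m"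
  shows "(\<lambda>c. v c + w c) \<in> tangent_space C m"
proof (rule tangent_spaceI)
  fix c assume "c \<notin> C \<or> m \<notin> fst c"
  then show "v c + w c = 0" using tangent_spaceD(1)[OF assms(1)] tangent_spaceD(1)[OF assms(2)] by simp
next
  fix c d assume *: "c \<in> C" "d \<in> C" "m \<in> fst c" "m \<in> fst d"
  show "v d + w d = dchange c d m (v c + w c)"
    using tangent_spaceD(2)[OF assms(1) *] tangent_spaceD(2)[OF assms(2) *] linear_add[OF transition_linear[OF *]] by simp
qed

lemma tangent_eqI:
  assumes "v \<in> tangent_space C m" "w \<in> tangent_space C m" "c \<in> C" "m \<in> fst c" "v c = w c"
  shows "v = w"
proof
  fix d show "v d = w d"
    using tangent_spaceD[OF assms(1), of d] tangent_spaceD[OF assms(2), of d]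
      tangent_spaceD(2)[OF assms(1), of c d] tangent_spaceD(2)[OF assms(2), of c d] assms(3-5) by metis
qed

lemma has_derivative_change_chart:
  assumes ce: "c \<in> C" "e \<in> C" "m \<in> fst c" "m \<in> fst e"
    and f: "((f \<circ> chart_inv c) has_derivative D) (at (snd c m))"
  shows "((f \<circ> chart_inv e) has_derivative
    (\<lambda>v. D (dchange e c m v))) (at (snd e m))"
proof -
  have t: "((snd c \<circ> chart_inv e) has_derivative dchange e c m) (at (snd e m))"
    using transition(1) ce by blast
  have "((f \<circ> chart_inv c) has_derivative D) (at ((snd c \<circ> chart_inv e) (snd e m)))"
    using f ce by simp
  from diff_chain_at[OF t this]
  have 1: "(((f \<circ> chart_inv c) \<circ> (snd c \<circ> chart_inv e)) has_derivative
      D \<circ> dchange e c m) (at (snd e m))" .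
  have 2: "((f \<circ> chart_inv c) \<circ> (snd c \<circ> chart_inv e)) y = (f \<circ> chart_inv e) y"
    if "y \<in> snd e ` (fst e \<inter> fst c)" for y
    using that ce by auto
  have 3: "snd e m \<in> snd e ` (fst e \<inter> fst c)" using ce by blast
  have "((f \<circ> chart_inv e) has_derivative
      D \<circ> dchange e c m) (at (snd e m))"
    by (rule iffD1[OF has_derivative_cong_open[OF open_overlap[OF ce(2,1)] 3] 1]) (rule 2)
  then show ?thesis by (simp add: o_def[of D])
qed

text \<open>The definition of \<open>dif\<close> uses one chosen chart; by the chain rule every chart gives the same value.\<close>

lemma dif_eq:
  assumes v: "v \<in> tangent_space C m" and c: "c \<in> C" "m \<in> fst c"
    and f: "((f \<circ> chart_inv c) has_derivative D) (at (snd c m))"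
  shows "dif C f m v = D (v c)"
proof -
  let ?e = "chart_at C m"
  have e: "?e \<in> C" "m \<in> fst ?e" using chart_at[OF in_pointsI[OF c]] by auto
  have "frechet_derivative (f \<circ> chart_inv ?e) (at (snd ?e m)) =
      (\<lambda>v. D (dchange ?e c m v))"
    using has_derivative_change_chart[OF c(1) e(1) c(2) e(2) f] by (rule frechet_derivative_unique)
  then show ?thesis
    using v tangent_spaceD(2)[OF v e(1) c(1) e(2) c(2)] by (simp add: dif_def Let_def)
qed

text \<open>This allows iterated actions \<open>\<rho>(V) (\<rho>(W) f)\<close> of an anchor to be compared, the inner function being
  controlled only over the open set on which \<open>W\<close> lives.\<close>

lemma dif_cong_open:
  assumes "openin (mtop C) W" "m \<in> W" "\<And>x. x \<in> W \<Longrightarrow> f x = g x"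
  shows "dif C f m = dif C g m"
proof -
  let ?e = "chart_at C m"
  have "m \<in> points C" using assms(1,2) by (auto simp: openin_iff)
  note e = chart_at[OF this]
  have "frechet_derivative (f \<circ> chart_inv ?e) (at (snd ?e m)) =
      frechet_derivative (g \<circ> chart_inv ?e) (at (snd ?e m))"
  proof (rule frechet_derivative_cong_open)
    show "open (snd ?e ` (fst ?e \<inter> W))" using assms(1) e(1) by (simp add: openin_iff)
    show "snd ?e m \<in> snd ?e ` (fst ?e \<inter> W)" using e assms(2) by blast
    show "(f \<circ> chart_inv ?e) y = (g \<circ> chart_inv ?e) y" if "y \<in> snd ?e ` (fst ?e \<inter> W)" for y
      using that e(1) assms(3) by auto
  qed
  then show ?thesis by (auto simp: dif_def Let_def fun_eq_iff)
qed

lemma dif_outside: "v \<notin> tangent_space C m \<Longrightarrow> dif C f m v = 0"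
  by (simp add: dif_def Let_def)

lemma dif_cotangent:
  assumes "differentiable_at C f m"
  shows "dif C f m \<in> cotangent_space C m"
proof -
  obtain c D where c: "c \<in> C" "m \<in> fst c" "((f \<circ> chart_inv c) has_derivative D) (at (snd c m))"
    using assms by (auto simp: differentiable_at_def differentiable_def)
  interpret D: linear D using c(3) has_derivative_linear by blast
  note eq = dif_eq[OF _ c]
  show ?thesis
    unfolding cotangent_space_def
    by (auto simp: dif_outside eq tangent_add tangent_scaleR D.add D.scaleR)
qed

lemma dif_J:
  assumes "cdiff_at C J h m" "v \<in> tangent_space C m"
  shows "dif C h m (\<lambda>c. J (v c)) = \<i> * dif C h m v"
proof -
  obtain c where c: "c \<in> C" "m \<in> fst c" and "cdiff_on J ((*) \<i>) {snd c m} (h \<circ> chart_inv c)"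
    using assms(1) by (auto simp: cdiff_at_def)
  from cdiff_onD[OF this(3)]
  have h: "((h \<circ> chart_inv c) has_derivative frechet_derivative (h \<circ> chart_inv c) (at (snd c m))) (at (snd c m))"
    "\<And>v. frechet_derivative (h \<circ> chart_inv c) (at (snd c m)) (J v) =
        \<i> * frechet_derivative (h \<circ> chart_inv c) (at (snd c m)) v" by auto
  show ?thesis using dif_eq[OF assms(2) c h(1)] dif_eq[OF tangent_J[OF assms(2)] c h(1)] h(2) by simp
qed

lemma cotangent_add:
  "\<omega> \<in> cotangent_space C m \<Longrightarrow> \<eta> \<in> cotangent_space C m \<Longrightarrow> (\<lambda>v. \<omega> v + \<eta> v) \<in> cotangent_space C m"
  unfolding cotangent_space_def by (auto simp: algebra_simps)

lemma cotangent_cnj: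
  "\<omega> \<in> cotangent_space C m \<Longrightarrow> (\<lambda>v. cnj (\<omega> v)) \<in> cotangent_space C m"
  unfolding cotangent_space_def by auto

lemma cotangent_mult:
  fixes \<omega> :: "_ \<Rightarrow> 'k::real_normed_field"
  shows "\<omega> \<in> cotangent_space C m \<Longrightarrow> (\<lambda>v. k * \<omega> v) \<in> cotangent_space C m"
  unfolding cotangent_space_def by (auto simp: algebra_simps)

text \<open>Since \<open>Re \<omega>\<close> is the mean of \<open>\<omega>\<close> and its conjugate, and the conjugate is of type (0,1) and hence
  annihilated, each of the two arguments contributes a factor \<open>1/2\<close>.\<close>

lemma bivector_Re_Re:
  assumes m: "m \<in> points C" and biv: "bivector_field C \<pi>"
    and type20: "\<And>\<omega> \<eta>. \<omega> \<in> cotangent_space C m \<Longrightarrow> \<eta> \<in> cotangent_space C m \<Longrightarrow>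
      (\<forall>v\<in>tangent_space C m. \<omega> (\<lambda>c. J (v c)) = - \<i> * \<omega> v) \<Longrightarrow> \<pi> m \<omega> \<eta> = 0"
    and \<omega>: "\<omega> \<in> cotangent_space C m" "\<And>v. v \<in> tangent_space C m \<Longrightarrow> \<omega> (\<lambda>c. J (v c)) = \<i> * \<omega> v"
    and \<eta>: "\<eta> \<in> cotangent_space C m" "\<And>v. v \<in> tangent_space C m \<Longrightarrow> \<eta> (\<lambda>c. J (v c)) = \<i> * \<eta> v"
  shows "\<pi> m (\<lambda>v. of_real (Re (\<omega> v))) (\<lambda>v. of_real (Re (\<eta> v))) = \<pi> m \<omega> \<eta> / 4"
proof -
  have anti: "\<pi> m \<omega> \<eta> = - \<pi> m \<eta> \<omega>"
    and add: "\<pi> m (\<lambda>v. \<omega> v + \<eta> v) \<theta> = \<pi> m \<omega> \<theta> + \<pi> m \<eta> \<theta>"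
    and mult: "\<pi> m (\<lambda>v. k * \<omega> v) \<eta> = k * \<pi> m \<omega> \<eta>"
    if "\<omega> \<in> cotangent_space C m" "\<eta> \<in> cotangent_space C m" "\<theta> \<in> cotangent_space C m" for \<omega> \<eta> \<theta> k
    using biv m that unfolding bivector_field_def by blast+
  define r :: "(('m, 'e) tvec \<Rightarrow> complex) \<Rightarrow> ('m, 'e) tvec \<Rightarrow> complex"
    where "r \<omega> = (\<lambda>v. (1/2) * (\<omega> v + cnj (\<omega> v)))" for \<omega>
  have r: "(\<lambda>v. complex_of_real (Re (\<omega> v))) = r \<omega>" for \<omega> :: "('m, 'e) tvec \<Rightarrow> complex"
    unfolding r_def by (simp add: complex_add_cnj)
  have r_cot: "r \<omega> \<in> cotangent_space C m" if "\<omega> \<in> cotangent_space C m" for \<omega>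
    unfolding r_def using that by (intro cotangent_mult cotangent_add cotangent_cnj)
  have half: "\<pi> m (r \<omega>) \<theta> = (1/2) * \<pi> m \<omega> \<theta>"
    if \<omega>: "\<omega> \<in> cotangent_space C m" "\<And>v. v \<in> tangent_space C m \<Longrightarrow> \<omega> (\<lambda>c. J (v c)) = \<i> * \<omega> v"
      and \<theta>: "\<theta> \<in> cotangent_space C m" for \<omega> \<theta>
  proof -
    note cnj = cotangent_cnj[OF \<omega>(1)]
    have "\<pi> m (r \<omega>) \<theta> = (1/2) * \<pi> m (\<lambda>v. \<omega> v + cnj (\<omega> v)) \<theta>"
      unfolding r_def by (rule mult[OF cotangent_add[OF \<omega>(1) cnj] \<theta> \<theta>])
    also have "\<dots> = (1/2) * (\<pi> m \<omega> \<theta> + \<pi> m (\<lambda>v. cnj (\<omega> v)) \<theta>)"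
      using add[OF \<omega>(1) cnj \<theta>] by simp
    also have "\<pi> m (\<lambda>v. cnj (\<omega> v)) \<theta> = 0"
      using \<omega>(2) by (intro type20 cnj \<theta>) simp
    finally show ?thesis by simp
  qed
  have "\<pi> m (r \<omega>) (r \<eta>) = (1/2) * \<pi> m \<omega> (r \<eta>)" by (rule half[OF \<omega> r_cot[OF \<eta>(1)]])
  also have "\<pi> m \<omega> (r \<eta>) = - \<pi> m (r \<eta>) \<omega>" by (rule anti[OF \<omega>(1) r_cot[OF \<eta>(1)] \<omega>(1)])
  also have "\<pi> m (r \<eta>) \<omega> = (1/2) * \<pi> m \<eta> \<omega>" by (rule half[OF \<eta> \<omega>(1)])
  also have "\<pi> m \<eta> \<omega> = - \<pi> m \<omega> \<eta>" by (rule anti[OF \<eta>(1) \<omega>(1) \<omega>(1)])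
  finally show ?thesis by (simp add: r)
qed

end

section \<open>Real and imaginary part of a (2,0)-bivector field, seen through a diffeomorphism\<close>

text \<open>The map \<open>\<Psi>\<close> is the identity in suitable charts of \<open>D\<close> and \<open>C\<close>; so \<open>D\<close> is the manifold \<open>C\<close> with
  its points renamed.\<close>

locale chart_transport = cdiff_atlas C J
  for C :: "('m, 'e::real_normed_vector) chart set" and J +
  fixes D :: "('n, 'e) chart set" and \<Psi> :: "'n \<Rightarrow> 'm"
  assumes bij: "bij_betw \<Psi> (points D) (points C)"
    and corr: "\<And>d. d \<in> D \<Longrightarrow> \<exists>c\<in>C. fst c = \<Psi> ` fst d \<and> (\<forall>n\<in>fst d. snd c (\<Psi> n) = snd d n)"
begin

abbreviation "\<Phi> \<equiv> inv_into (points D) \<Psi>"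

text \<open>A chart of \<open>C\<close> that corresponds to the chart \<open>d\<close> under \<open>\<Psi>\<close>.\<close>

definition partner :: "('n, 'e) chart \<Rightarrow> ('m, 'e) chart" where
  "partner d = (SOME c. c \<in> C \<and> fst c = \<Psi> ` fst d \<and> (\<forall>n\<in>fst d. snd c (\<Psi> n) = snd d n))"

lemma partner:
  assumes "d \<in> D"
  shows "partner d \<in> C" "fst (partner d) = \<Psi> ` fst d" "n \<in> fst d \<Longrightarrow> snd (partner d) (\<Psi> n) = snd d n"
proof -
  have "\<exists>c. c \<in> C \<and> fst c = \<Psi> ` fst d \<and> (\<forall>n\<in>fst d. snd c (\<Psi> n) = snd d n)"
    using corr[OF assms] by blast
  from someI_ex[OF this, folded partner_def]
  show "partner d \<in> C" "fst (partner d) = \<Psi> ` fst d" "n \<in> fst d \<Longrightarrow> snd (partner d) (\<Psi> n) = snd d n"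
    by auto
qed

lemma \<Phi>_\<Psi>: "n \<in> points D \<Longrightarrow> \<Phi> (\<Psi> n) = n"
  using bij by (simp add: bij_betw_def)

lemma partner_mem_iff:
  assumes "d \<in> D" "n \<in> points D" shows "\<Psi> n \<in> fst (partner d) \<longleftrightarrow> n \<in> fst d"
proof -
  have "fst d \<subseteq> points D" using assms(1) by (auto simp: points_def)
  then show ?thesis using bij assms(2) partner(2)[OF assms(1)] unfolding bij_betw_def inj_on_def by blast
qed

lemma inj_D: assumes "d \<in> D" shows "inj_on (snd d) (fst d)"
proof -
  have "fst d \<subseteq> points D" using assms by (auto simp: points_def)
  then have "inj_on \<Psi> (fst d)" using bij inj_on_subset unfolding bij_betw_def by blast
  moreover have "inj_on (snd (partner d)) (\<Psi> ` fst d)"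
    using inj[OF partner(1)[OF assms]] partner(2)[OF assms] by simp
  ultimately have "inj_on (snd (partner d) \<circ> \<Psi>) (fst d)" by (rule comp_inj_on)
  then show ?thesis using partner(3)[OF assms] by (simp add: inj_on_def)
qed

lemma chart_inv_D [simp]: "d \<in> D \<Longrightarrow> n \<in> fst d \<Longrightarrow> chart_inv d (snd d n) = n"
  using inj_D by simp

lemma chart_inv_partner: "d \<in> D \<Longrightarrow> n \<in> fst d \<Longrightarrow> chart_inv (partner d) (snd d n) = \<Psi> n"
  using chart_inv[OF partner(1), of d "\<Psi> n"] partner(2,3) by (metis imageI)

text \<open>In corresponding charts the map is the identity, so that its tangent map only renames the charts in a
  family of coordinate vectors.\<close>

lemma tangent_map_eq:
  assumes n: "n \<in> points D" and v: "v \<in> tangent_space C (\<Psi> n)" and d: "d \<in> D"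
  shows "tangent_map C D \<Phi> (\<Psi> n) v d = v (partner d)"
proof (cases "n \<in> fst d")
  case True
  let ?e = "chart_at C (\<Psi> n)" and ?c = "partner d"
  have "\<Psi> n \<in> points C" using bij n bij_betwE by blast
  note e = chart_at[OF this]
  have c: "?c \<in> C" "\<Psi> n \<in> fst ?c" using partner(1)[OF d] partner_mem_iff[OF d n] True by auto
  have "frechet_derivative (snd d \<circ> \<Phi> \<circ> chart_inv ?e) (at (snd ?e (\<Psi> n))) =
      frechet_derivative (snd ?c \<circ> chart_inv ?e) (at (snd ?e (\<Psi> n)))"
  proof (rule frechet_derivative_cong_open[OF open_overlap[OF e(1) c(1)]])
    show "snd ?e (\<Psi> n) \<in> snd ?e ` (fst ?e \<inter> fst ?c)" using e c by blast
    fix y assume "y \<in> snd ?e ` (fst ?e \<inter> fst ?c)"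
    then obtain k where k: "k \<in> fst d" "\<Psi> k \<in> fst ?e" "y = snd ?e (\<Psi> k)"
      using partner(2)[OF d] by auto
    then show "(snd d \<circ> \<Phi> \<circ> chart_inv ?e) y = (snd ?c \<circ> chart_inv ?e) y"
      using e(1) partner(3)[OF d k(1)] \<Phi>_\<Psi>[OF in_pointsI[OF d k(1)]] by simp
  qed
  then show ?thesis
    using True n d \<Phi>_\<Psi>[OF n] tangent_spaceD(2)[OF v e(1) c(1) e(2) c(2)]
    by (simp add: tangent_map_def Let_def)
next
  case False
  then show ?thesis
    using tangent_spaceD(1)[OF v] partner_mem_iff[OF d n] \<Phi>_\<Psi>[OF n] by (simp add: tangent_map_def Let_def)
qed

lemma tangent_map_tangent:
  assumes n: "n \<in> points D" and v: "v \<in> tangent_space C (\<Psi> n)"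
  shows "tangent_map C D \<Phi> (\<Psi> n) v \<in> tangent_space D n"
proof (rule tangent_spaceI)
  fix d assume "d \<notin> D \<or> n \<notin> fst d"
  then show "tangent_map C D \<Phi> (\<Psi> n) v d = 0"
    using \<Phi>_\<Psi>[OF n] by (auto simp: tangent_map_def Let_def)
next
  fix d d' assume d: "d \<in> D" "d' \<in> D" and nd: "n \<in> fst d" "n \<in> fst d'"
  let ?c = "partner d" and ?c' = "partner d'"
  have c: "?c \<in> C" "?c' \<in> C" "\<Psi> n \<in> fst ?c" "\<Psi> n \<in> fst ?c'"
    using partner(1) partner_mem_iff n d nd by auto
  have "dchange d d' n =
      frechet_derivative (snd ?c' \<circ> chart_inv ?c) (at (snd d n))"
  proof (rule frechet_derivative_cong_open[OF open_overlap[OF c(1,2)]])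
    show "snd d n \<in> snd ?c ` (fst ?c \<inter> fst ?c')"
      using c partner(3)[OF d(1) nd(1)] by (metis IntI imageI)
    fix y assume "y \<in> snd ?c ` (fst ?c \<inter> fst ?c')"
    then obtain k where k: "k \<in> fst d" "\<Psi> k \<in> fst ?c'" "y = snd d k"
      using partner(2,3)[OF d(1)] by auto
    then have "k \<in> fst d'" using partner_mem_iff[OF d(2) in_pointsI[OF d(1)]] by blast
    then show "(snd d' \<circ> chart_inv d) y = (snd ?c' \<circ> chart_inv ?c) y"
      using k d partner(3)[OF d(2)] chart_inv_partner[OF d(1) k(1)] by simp
  qed
  then show "tangent_map C D \<Phi> (\<Psi> n) v d' = dchange d d' n
      (tangent_map C D \<Phi> (\<Psi> n) v d)"
    using tangent_spaceD(2)[OF v c] partner(3)[OF d(1) nd(1)]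
    by (simp add: tangent_map_eq[OF n v] d)
qed

lemma dif_tangent_map:
  assumes n: "n \<in> points D" and v: "v \<in> tangent_space C (\<Psi> n)"
    and h: "differentiable_at C h (\<Psi> n)" and L: "bounded_linear L"
    and f: "\<And>n. n \<in> points D \<Longrightarrow> f n = L (h (\<Psi> n))"
  shows "dif D f n (tangent_map C D \<Phi> (\<Psi> n) v) = L (dif C h (\<Psi> n) v)"
proof -
  let ?d = "chart_at D n"
  let ?c = "partner ?d"
  note d = chart_at[OF n]
  have c: "?c \<in> C" "\<Psi> n \<in> fst ?c" "snd ?c (\<Psi> n) = snd ?d n"
    using partner[OF d(1)] partner_mem_iff n d by auto
  obtain e De where e: "e \<in> C" "\<Psi> n \<in> fst e" "((h \<circ> chart_inv e) has_derivative De) (at (snd e (\<Psi> n)))"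
    using h by (auto simp: differentiable_at_def differentiable_def)
  define Dh where "Dh = (\<lambda>v. De (frechet_derivative (snd e \<circ> chart_inv ?c) (at (snd ?c (\<Psi> n))) v))"
  have Dh: "((h \<circ> chart_inv ?c) has_derivative Dh) (at (snd ?c (\<Psi> n)))"
    unfolding Dh_def by (rule has_derivative_change_chart[OF e(1) c(1) e(2) c(2) e(3)])
  have "((f \<circ> chart_inv ?d) has_derivative (\<lambda>v. L (Dh v))) (at (snd ?d n))"
  proof (subst has_derivative_cong_open[OF open_image[OF c(1)]])
    show "snd ?d n \<in> snd ?c ` fst ?c" using c by (metis imageI)
    show "((\<lambda>y. L ((h \<circ> chart_inv ?c) y)) has_derivative (\<lambda>v. L (Dh v))) (at (snd ?d n))"
      using bounded_linear.has_derivative[OF L Dh] c(3) by simp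
    fix y assume "y \<in> snd ?c ` fst ?c"
    then obtain k where "k \<in> fst ?d" "y = snd ?d k" using partner(2,3)[OF d(1)] by auto
    then show "(f \<circ> chart_inv ?d) y = L ((h \<circ> chart_inv ?c) y)"
      using d f in_pointsI[OF d(1)] chart_inv_partner[OF d(1)] by simp
  qed
  then have "frechet_derivative (f \<circ> chart_inv ?d) (at (snd ?d n)) = (\<lambda>v. L (Dh v))"
    by (rule frechet_derivative_unique)
  then show ?thesis
    using dif_eq[OF v c(1,2) Dh] tangent_map_tangent[OF n v]
    by (simp add: dif_def Let_def tangent_map_eq[OF n v d(1)])
qed

context
  fixes \<pi> f1 f2 h1 h2 n
  assumes n: "n \<in> points D" and biv: "bivector_field C \<pi>"
    and type20: "\<forall>m\<in>points C. \<forall>\<omega>\<in>cotangent_space C m. \<forall>\<eta>\<in>cotangent_space C m.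
      (\<forall>v\<in>tangent_space C m. \<omega> (\<lambda>c. J (v c)) = - \<i> * \<omega> v) \<longrightarrow> \<pi> m \<omega> \<eta> = 0"
    and h1: "cdiff_at C J h1 (\<Psi> n)" and h2: "cdiff_at C J h2 (\<Psi> n)"
    and f1: "\<And>n. n \<in> points D \<Longrightarrow> f1 n = Re (h1 (\<Psi> n))"
    and f2: "\<And>n. n \<in> points D \<Longrightarrow> f2 n = Re (h2 (\<Psi> n))"
begin

lemma pulled_back_covector:
  assumes "cdiff_at C J h (\<Psi> n)" "\<And>n. n \<in> points D \<Longrightarrow> f n = Re (h (\<Psi> n))"
  shows "(\<lambda>v. if v \<in> tangent_space C (\<Psi> n) then dif D f n (tangent_map C D \<Phi> (\<Psi> n) v) else 0) =
    (\<lambda>v. Re (dif C h (\<Psi> n) v))"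
  using dif_tangent_map[OF n _ cdiff_at_differentiable[OF assms(1)] bounded_linear_Re, of _ f] assms(2)
  by (auto simp: fun_eq_iff dif_outside)

lemma inv_\<Phi>: "inv_into (points C) \<Phi> n = \<Psi> n"
proof -
  have "\<Psi> n \<in> points C" using bij n bij_betwE by blast
  moreover have "inj_on \<Phi> (points C)" using bij by (metis bij_betw_def bij_betw_inv_into)
  ultimately show ?thesis using \<Phi>_\<Psi>[OF n] inv_into_f_f by metis
qed

lemma bivector_Re_dif:
  "\<pi> (\<Psi> n) (\<lambda>v. of_real (Re (dif C h1 (\<Psi> n) v))) (\<lambda>v. of_real (Re (dif C h2 (\<Psi> n) v))) =
    pbracket C \<pi> h1 h2 (\<Psi> n) / 4"
  unfolding pbracket_def
proof (rule bivector_Re_Re[OF _ biv])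
  show m: "\<Psi> n \<in> points C" using bij n bij_betwE by blast
  show "\<pi> (\<Psi> n) \<omega> \<eta> = 0" if "\<omega> \<in> cotangent_space C (\<Psi> n)" "\<eta> \<in> cotangent_space C (\<Psi> n)"
    "\<forall>v\<in>tangent_space C (\<Psi> n). \<omega> (\<lambda>c. J (v c)) = - \<i> * \<omega> v" for \<omega> \<eta>
    using type20 m that by blast
qed (auto intro: dif_cotangent cdiff_at_differentiable h1 h2 dif_J)

lemma pbracket_push:
  "pbracket D (push_bivec C D \<Phi> \<beta>) f1 f2 n =
    \<beta> (\<Psi> n) (\<lambda>v. Re (dif C h1 (\<Psi> n) v)) (\<lambda>v. Re (dif C h2 (\<Psi> n) v))"
proof -
  have "pbracket D (push_bivec C D \<Phi> \<beta>) f1 f2 n =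
    \<beta> (\<Psi> n) (\<lambda>v. if v \<in> tangent_space C (\<Psi> n) then dif D f1 n (tangent_map C D \<Phi> (\<Psi> n) v) else 0)
      (\<lambda>v. if v \<in> tangent_space C (\<Psi> n) then dif D f2 n (tangent_map C D \<Phi> (\<Psi> n) v) else 0)"
    unfolding pbracket_def push_bivec_def Let_def inv_\<Phi> ..
  also have "\<dots> = \<beta> (\<Psi> n) (\<lambda>v. Re (dif C h1 (\<Psi> n) v)) (\<lambda>v. Re (dif C h2 (\<Psi> n) v))"
    by (rule arg_cong2[where f = "\<beta> (\<Psi> n)"]; rule pulled_back_covector; fact h1 h2 f1 f2)
  finally show ?thesis .
qed

text \<open>The covectors \<open>d f1\<close> and \<open>d f2\<close> pull back to the real parts of \<open>d h1\<close> and \<open>d h2\<close>, to which the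
  computation of the factor \<open>1/4\<close> applies.\<close>

lemma pbracket_push_Re:
  "pbracket D (push_bivec C D \<Phi> (Re_bivec \<pi>)) f1 f2 n = Re (pbracket C \<pi> h1 h2 (\<Psi> n)) / 4"
  unfolding pbracket_push Re_bivec_def bivector_Re_dif by simp

lemma pbracket_push_Im:
  "pbracket D (push_bivec C D \<Phi> (Im_bivec \<pi>)) f1 f2 n = Im (pbracket C \<pi> h1 h2 (\<Psi> n)) / 4"
  unfolding pbracket_push Im_bivec_def bivector_Re_dif by simp

end

end

section \<open>The linear structure of the fibres\<close>

text \<open>The chart of the total space given by a chart of the base and a trivialization.\<close>

definition total_chart :: "('x, 'a, 'f, 'z) vb_scheme \<Rightarrow> ('x, 'e) chart \<Rightarrow> 'x set \<times> ('a \<Rightarrow> 'f) \<Rightarrow> ('a, 'e \<times> 'f) chart" where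
  "total_chart A c t = ({a \<in> vtotal A. vproj A a \<in> fst c \<inter> fst t}, \<lambda>a. (snd c (vproj A a), snd t a))"

lemma total_atlas_eq: "total_atlas X A = {total_chart A c t | c t. c \<in> charts X \<and> t \<in> vtrivs A}"
  unfolding total_atlas_def total_chart_def by (simp only: split_paired_Ex fst_conv snd_conv)

lemma total_chart_in: "c \<in> charts X \<Longrightarrow> t \<in> vtrivs A \<Longrightarrow> total_chart A c t \<in> total_atlas X A"
  unfolding total_atlas_eq by blast

lemma points_total_atlas:
  assumes "\<And>a. a \<in> vtotal B \<Longrightarrow> vproj B a \<in> points (charts X) \<inter> \<Union> (fst ` vtrivs B)"
  shows "points (total_atlas X B) = vtotal B"
proof (intro equalityI subsetI)
  fix a assume a: "a \<in> vtotal B"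
  obtain t where t: "t \<in> vtrivs B" "vproj B a \<in> fst t" using assms[OF a] by blast
  obtain c where c: "c \<in> charts X" "vproj B a \<in> fst c" using assms[OF a] unfolding points_def by blast
  show "a \<in> points (total_atlas X B)"
    by (rule in_pointsI[OF total_chart_in[OF c(1) t(1)]]) (use a c t in \<open>simp add: total_chart_def\<close>)
qed (auto simp: points_def total_atlas_eq total_chart_def)

locale bij_fibres =
  fixes A :: "('x, 'a, 'f::real_normed_vector, 'z) vb_scheme"
  assumes triv_bij: "t \<in> vtrivs A \<Longrightarrow> x \<in> fst t \<Longrightarrow> bij_betw (snd t) (fibre A x) UNIV"
begin

lemma vproj_fibre: "a \<in> fibre A x \<Longrightarrow> vproj A a = x"
  by (simp add: fibre_def)

abbreviation "tinv t x \<equiv> inv_into (fibre A x) (snd t)"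

lemma triv_inv:
  assumes "t \<in> vtrivs A" "x \<in> fst t"
  shows triv_inv_in: "tinv t x v \<in> fibre A x"
    and triv_inv_right: "snd t (tinv t x v) = v"
    and triv_inv_left: "a \<in> fibre A x \<Longrightarrow> tinv t x (snd t a) = a"
  using triv_bij[OF assms] unfolding bij_betw_def
  by (auto simp: inv_into_into f_inv_into_f)

lemma triv_eqI:
  assumes "t \<in> vtrivs A" "x \<in> fst t" "a \<in> fibre A x" "b \<in> fibre A x" "snd t a = snd t b"
  shows "a = b"
  using triv_inv_left[OF assms(1,2)] assms(3-5) by metis

lemma mem_total_chart: "a \<in> fst (total_chart A c t) \<longleftrightarrow> (\<exists>x \<in> fst c \<inter> fst t. a \<in> fibre A x)"
  by (auto simp: total_chart_def fibre_def)

lemma snd_total_chart: "a \<in> fibre A x \<Longrightarrow> snd (total_chart A c t) a = (snd c x, snd t a)"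
  by (simp add: total_chart_def fibre_def)

lemma total_chart_image:
  assumes t: "t \<in> vtrivs A" and W: "W \<subseteq> fst t"
  shows "snd (total_chart A c t) ` (\<Union>x\<in>W. fibre A x) = (snd c ` W) \<times> UNIV"
proof (intro equalityI subsetI)
  fix p assume "p \<in> (snd c ` W) \<times> (UNIV :: 'f set)"
  then obtain x v where xv: "x \<in> W" "p = (snd c x, v)" by auto
  then have tx: "x \<in> fst t" using W by auto
  let ?a = "tinv t x v"
  have "p = snd (total_chart A c t) ?a"
    unfolding snd_total_chart[OF triv_inv_in[OF t tx]] triv_inv_right[OF t tx] by (rule xv(2))
  then show "p \<in> snd (total_chart A c t) ` (\<Union>x\<in>W. fibre A x)"
    using triv_inv_in[OF t tx] xv(1) by blast
qed (auto simp: snd_total_chart)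

lemma inj_total_chart:
  assumes t: "t \<in> vtrivs A" and c: "inj_on (snd c) (fst c)"
  shows "inj_on (snd (total_chart A c t)) (fst (total_chart A c t))"
proof (rule inj_onI)
  fix a b assume "a \<in> fst (total_chart A c t)" "b \<in> fst (total_chart A c t)"
  then obtain x y where x: "x \<in> fst c" "x \<in> fst t" "a \<in> fibre A x"
    and y: "y \<in> fst c" "y \<in> fst t" "b \<in> fibre A y" by (auto simp: mem_total_chart)
  assume "snd (total_chart A c t) a = snd (total_chart A c t) b"
  then have eq: "snd c x = snd c y" "snd t a = snd t b"
    unfolding snd_total_chart[OF x(3)] snd_total_chart[OF y(3)] by simp_all
  then have "x = y" using c x(1) y(1) by (auto dest: inj_onD)
  then show "a = b" using triv_eqI[OF t x(2)] x y eq by blast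
qed

lemma total_chart_inv:
  assumes t: "t \<in> vtrivs A" and c: "inj_on (snd c) (fst c)" and x: "x \<in> fst c" "x \<in> fst t"
  shows "a \<in> fibre A x \<Longrightarrow> chart_inv (total_chart A c t) (snd c x, snd t a) = a"
    and "chart_inv (total_chart A c t) (snd c x, v) = tinv t x v"
proof -
  show *: "chart_inv (total_chart A c t) (snd c x, snd t a) = a" if a: "a \<in> fibre A x" for a
  proof -
    have "a \<in> fst (total_chart A c t)" using x a by (auto simp: mem_total_chart)
    then show ?thesis
      using inv_into_f_f[OF inj_total_chart[OF t c]] snd_total_chart[OF a] by metis
  qed
  show "chart_inv (total_chart A c t) (snd c x, v) = tinv t x v"
    using *[OF triv_inv_in[OF t x(2)], of v] triv_inv_right[OF t x(2)] by simp
qed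

end

text \<open>The linear structure of the fibres is kept apart from the way in which it varies with the base point,
  since in this form it is common to \<open>A\<close> and to the tangent bundle.\<close>

locale linear_fibres = bij_fibres A
  for A :: "('x, 'a, 'f::real_normed_vector, 'z) vb_scheme" +
  assumes triv_linear: "t \<in> vtrivs A \<Longrightarrow> t' \<in> vtrivs A \<Longrightarrow> x \<in> fst t \<Longrightarrow> x \<in> fst t' \<Longrightarrow>
      linear (\<lambda>v. snd t' (tinv t x v))"
begin

definition base :: "'x set" where "base = \<Union> (fst ` vtrivs A)"

lemma triv_at:
  assumes "x \<in> base"
  obtains t where "t \<in> vtrivs A" "x \<in> fst t" "snd t = triv_at A x"
proof -
  have "\<exists>t. t \<in> vtrivs A \<and> x \<in> fst t" using assms by (auto simp: base_def)
  from someI_ex[OF this] show ?thesis using that unfolding triv_at_def by blast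
qed

lemma baseI: "t \<in> vtrivs A \<Longrightarrow> x \<in> fst t \<Longrightarrow> x \<in> base"
  by (auto simp: base_def)

lemma triv_change:
  assumes "t \<in> vtrivs A" "t' \<in> vtrivs A" "x \<in> fst t" "x \<in> fst t'"
  obtains g where "linear g" "\<And>a. a \<in> fibre A x \<Longrightarrow> snd t' a = g (snd t a)"
  using that[OF triv_linear[OF assms]] triv_inv_left[OF assms(1,3)] by simp

lemma
  assumes x: "x \<in> base"
  shows fib_inv_in: "fib_inv A x v \<in> fibre A x"
    and triv_at_fib_inv: "triv_at A x (fib_inv A x v) = v"
proof -
  obtain t where "t \<in> vtrivs A" "x \<in> fst t" "snd t = triv_at A x" using triv_at[OF x] .
  then show "fib_inv A x v \<in> fibre A x" "triv_at A x (fib_inv A x v) = v"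
    using triv_inv[of t x] unfolding fib_inv_def by metis+
qed

context
  fixes x a assumes x: "x \<in> base" and a: "a \<in> fibre A x"
begin

lemma fadd_in: "fadd A a b \<in> fibre A x"
  using fib_inv_in[OF x] vproj_fibre[OF a] by (simp add: fadd_def)

lemma fscaleR_in: "fscaleR A r a \<in> fibre A x"
  using fib_inv_in[OF x] vproj_fibre[OF a] by (simp add: fscaleR_def)

lemma triv_fadd:
  assumes b: "b \<in> fibre A x" and t: "t \<in> vtrivs A" "x \<in> fst t"
  shows "snd t (fadd A a b) = snd t a + snd t b"
proof -
  obtain s where s: "s \<in> vtrivs A" "x \<in> fst s" "snd s = triv_at A x" using triv_at[OF x] .
  obtain g where g: "linear g" "\<And>a. a \<in> fibre A x \<Longrightarrow> snd t a = g (snd s a)"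
    using triv_change[OF s(1) t(1) s(2) t(2)] by blast
  have "snd s (fadd A a b) = snd s a + snd s b"
    using triv_at_fib_inv[OF x] vproj_fibre[OF a] s(3) by (simp add: fadd_def)
  then show ?thesis using g a b fadd_in by (simp add: linear_add)
qed

lemma triv_fscaleR:
  assumes t: "t \<in> vtrivs A" "x \<in> fst t"
  shows "snd t (fscaleR A r a) = r *\<^sub>R snd t a"
proof -
  obtain s where s: "s \<in> vtrivs A" "x \<in> fst s" "snd s = triv_at A x" using triv_at[OF x] .
  obtain g where g: "linear g" "\<And>a. a \<in> fibre A x \<Longrightarrow> snd t a = g (snd s a)"
    using triv_change[OF s(1) t(1) s(2) t(2)] by blast
  have "snd s (fscaleR A r a) = r *\<^sub>R snd s a"
    using triv_at_fib_inv[OF x] vproj_fibre[OF a] s(3) by (simp add: fscaleR_def)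
  then show ?thesis using g a fscaleR_in by (simp add: linear_scale)
qed

end

lemma fscaleR_fadd:
  assumes x: "x \<in> base" and a: "a \<in> fibre A x" and b: "b \<in> fibre A x"
  shows "fscaleR A r (fadd A a b) = fadd A (fscaleR A r a) (fscaleR A r b)"
proof -
  obtain t where t: "t \<in> vtrivs A" "x \<in> fst t" "snd t = triv_at A x" using triv_at[OF x] .
  show ?thesis
    by (rule triv_eqI[OF t(1,2) fscaleR_in[OF x fadd_in[OF x a]] fadd_in[OF x fscaleR_in[OF x a]]])
      (simp add: triv_fscaleR[OF x fadd_in[OF x a] t(1,2)] triv_fadd[OF x a b t(1,2)]
        triv_fadd[OF x fscaleR_in[OF x a] fscaleR_in[OF x b] t(1,2)]
        triv_fscaleR[OF x a t(1,2)] triv_fscaleR[OF x b t(1,2)] scaleR_add_right)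
qed

lemma fscaleR_fscaleR:
  assumes x: "x \<in> base" and a: "a \<in> fibre A x"
  shows "fscaleR A r (fscaleR A s a) = fscaleR A (r * s) a"
proof -
  obtain t where t: "t \<in> vtrivs A" "x \<in> fst t" "snd t = triv_at A x" using triv_at[OF x] .
  show ?thesis
    by (rule triv_eqI[OF t(1,2) fscaleR_in[OF x fscaleR_in[OF x a]] fscaleR_in[OF x a]])
      (simp add: triv_fscaleR[OF x fscaleR_in[OF x a] t(1,2)] triv_fscaleR[OF x a t(1,2)])
qed

end

locale complex_fibres = linear_fibres A
  for A :: "('x, 'a, 'f::real_normed_vector) cvb" +
  assumes triv_J: "t \<in> vtrivs A \<Longrightarrow> t' \<in> vtrivs A \<Longrightarrow> x \<in> fst t \<Longrightarrow> x \<in> fst t' \<Longrightarrow>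
      snd t' (tinv t x (fJ A v)) = fJ A (snd t' (tinv t x v))"
    and fJ_linear: "linear (fJ A)" and fJ_fJ: "fJ A (fJ A v) = - v"
begin

context
  fixes x a assumes x: "x \<in> base" and a: "a \<in> fibre A x"
begin

lemma fmulI_in: "fmulI A a \<in> fibre A x"
  using fib_inv_in[OF x] vproj_fibre[OF a] by (simp add: fmulI_def)

lemma triv_fmulI:
  assumes t: "t \<in> vtrivs A" "x \<in> fst t"
  shows "snd t (fmulI A a) = fJ A (snd t a)"
proof -
  obtain s where s: "s \<in> vtrivs A" "x \<in> fst s" "snd s = triv_at A x" using triv_at[OF x] .
  have "snd s (fmulI A a) = fJ A (snd s a)"
    using triv_at_fib_inv[OF x] vproj_fibre[OF a] s(3) by (simp add: fmulI_def)
  then show ?thesis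
    using triv_J[OF s(1) t(1) s(2) t(2), of "snd s a"] triv_inv_left[OF s(1,2)] a fmulI_in by metis
qed

lemma fscaleC_in: "fscaleC A z a \<in> fibre A x"
  unfolding fscaleC_def by (rule fadd_in[OF x fscaleR_in[OF x a]])

lemma triv_fscaleC:
  assumes t: "t \<in> vtrivs A" "x \<in> fst t"
  shows "snd t (fscaleC A z a) = Re z *\<^sub>R snd t a + Im z *\<^sub>R fJ A (snd t a)"
  unfolding fscaleC_def
  using triv_fadd[OF x fscaleR_in[OF x a] fscaleR_in[OF x fmulI_in] t]
    triv_fscaleR[OF x a t] triv_fscaleR[OF x fmulI_in t] triv_fmulI[OF t] by simp

lemma fscaleC_i: "fscaleC A \<i> a = fmulI A a"
proof -
  obtain t where t: "t \<in> vtrivs A" "x \<in> fst t" "snd t = triv_at A x" using triv_at[OF x] .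
  show ?thesis
    by (rule triv_eqI[OF t(1,2) fscaleC_in fmulI_in]) (simp add: triv_fscaleC triv_fmulI t(1,2))
qed

end

end

section \<open>Smooth and holomorphic sections\<close>

lemma complex_fin_dim_bounded: "complex_fin_dim J \<Longrightarrow> bounded_linear J"
  unfolding complex_fin_dim_def using finite_dim_bounded_linear by blast

lemma complex_fin_dim_basis: "complex_fin_dim (J :: 'e::real_normed_vector \<Rightarrow> 'e) \<Longrightarrow> \<exists>B::'e set. finite B \<and> span B = UNIV"
  unfolding complex_fin_dim_def by blast

lemma cdiff_on_Pair_iff:
  "cdiff_on J (map_prod K K') S (\<lambda>x. (f x, g x)) \<longleftrightarrow> cdiff_on J K S f \<and> cdiff_on J K' S g"
proof
  assume P: "cdiff_on J (map_prod K K') S (\<lambda>x. (f x, g x))"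
  show "cdiff_on J K S f \<and> cdiff_on J K' S g"
    using cdiff_on_compose_linear[OF bounded_linear_fst _ P, of K]
      cdiff_on_compose_linear[OF bounded_linear_snd _ P, of K'] by auto
qed (auto intro: cdiff_on_Pair)

lemma smooth_on_Pair_iff:
  assumes "open S"
  shows "smooth_on S (\<lambda>x. (f x, g x)) \<longleftrightarrow> smooth_on S f \<and> smooth_on S g"
  using smooth_on_bounded_linear[OF assms bounded_linear_fst, of "\<lambda>x. (f x, g x)"]
    smooth_on_bounded_linear[OF assms bounded_linear_snd, of "\<lambda>x. (f x, g x)"]
    smooth_on_Pair[OF assms, of f g] by auto

lemma hol_on_Pair_iff:
  "open S \<Longrightarrow> hol_on J (map_prod K K') S (\<lambda>x. (f x, g x)) \<longleftrightarrow> hol_on J K S f \<and> hol_on J K' S g"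
  unfolding hol_on_iff cdiff_on_Pair_iff smooth_on_Pair_iff by auto

lemma hol_on_compose_linear:
  assumes "open S" "bounded_linear L" "\<And>v. L (K v) = K' (L v)" "hol_on J K S f"
  shows "hol_on J K' S (\<lambda>x. L (f x))"
  using assms smooth_on_bounded_linear cdiff_on_compose_linear unfolding hol_on_iff by blast

text \<open>The \<open>\<complex>\<close>-linear functional whose real part is \<open>l\<close>.\<close>

definition complexify :: "('v \<Rightarrow> 'v) \<Rightarrow> ('v \<Rightarrow> real) \<Rightarrow> 'v \<Rightarrow> complex" where
  "complexify J l v = of_real (l v) - \<i> * of_real (l (J v))"

locale hol_bundle =
  fixes X :: "('x, 'e::real_normed_vector) cmfd" and A :: "('x, 'a, 'f::real_normed_vector) cvb"
  assumes cm: "complex_manifold X" and vb: "holomorphic_vb X A"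
begin

abbreviation "Opn \<equiv> openin (mtop (charts X))"
abbreviation "\<Gamma> \<equiv> smooth_sections X A"
abbreviation "Hol \<equiv> hol_sections X A"

lemma hol_atlas: "atlas (hol_on (mJ X) (mJ X)) (charts X)"
  using cm unfolding complex_manifold_def by blast

lemma fin_dim_X: "complex_fin_dim (mJ X)"
  using cm unfolding complex_manifold_def by blast

lemma fin_dim_A: "complex_fin_dim (fJ A)"
  using vb unfolding holomorphic_vb_def by blast

lemmas mJ_bounded = complex_fin_dim_bounded[OF fin_dim_X]
lemmas fJ_bounded = complex_fin_dim_bounded[OF fin_dim_A]

lemma mJ_mJ: "mJ X (mJ X v) = - v"
  using fin_dim_X unfolding complex_fin_dim_def by blast

sublocale M: cdiff_atlas "charts X" "mJ X"
proof
  show "atlas (cdiff_on (mJ X) (mJ X)) (charts X)"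
    using hol_atlas unfolding atlas_def hol_on_iff by blast
  show "mJ X 0 = 0" using mJ_bounded bounded_linear.linear linear_0 by blast
qed

sublocale complex_fibres A
proof (intro complex_fibres.intro linear_fibres.intro bij_fibres.intro linear_fibres_axioms.intro
    complex_fibres_axioms.intro)
  have V: "\<forall>(U, \<phi>)\<in>vtrivs A. Opn U \<and> (\<forall>x\<in>U. bij_betw \<phi> (fibre A x) UNIV)"
    "\<forall>(U, \<phi>)\<in>vtrivs A. \<forall>(U', \<phi>')\<in>vtrivs A. \<forall>x \<in> U \<inter> U'. linear (\<lambda>v. \<phi>' (inv_into (fibre A x) \<phi> v)) \<and>
      (\<forall>v. \<phi>' (inv_into (fibre A x) \<phi> (fJ A v)) = fJ A (\<phi>' (inv_into (fibre A x) \<phi> v)))"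
    using vb unfolding holomorphic_vb_def Let_def by fast+
  show "bij_betw (snd t) (fibre A x) UNIV" if "t \<in> vtrivs A" "x \<in> fst t" for t x
    using V(1) that by (cases t) auto
  show "linear (\<lambda>v. snd t' (inv_into (fibre A x) (snd t) v))"
    if "t \<in> vtrivs A" "t' \<in> vtrivs A" "x \<in> fst t" "x \<in> fst t'" for t t' x
    using V(2) that by (cases t; cases t'; force)
  show "snd t' (inv_into (fibre A x) (snd t) (fJ A v)) = fJ A (snd t' (inv_into (fibre A x) (snd t) v))"
    if "t \<in> vtrivs A" "t' \<in> vtrivs A" "x \<in> fst t" "x \<in> fst t'" for t t' x v
    using V(2) that by (cases t; cases t'; force)
  show "linear (fJ A)" using fJ_bounded bounded_linear.linear by blast
  show "fJ A (fJ A v) = - v" for v using fin_dim_A unfolding complex_fin_dim_def by blast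
qed

lemma base_eq: "base = points (charts X)"
  using vb unfolding holomorphic_vb_def base_def by blast

lemma vproj_base: "a \<in> vtotal A \<Longrightarrow> vproj A a \<in> base"
  using vb base_eq unfolding holomorphic_vb_def by blast

lemma points_A: "points (total_atlas X A) = vtotal A"
  by (rule points_total_atlas) (use vproj_base base_eq in \<open>auto simp: base_def\<close>)

abbreviation "img c U t \<equiv> snd c ` (fst c \<inter> U \<inter> fst t)"
abbreviation "rep c t V \<equiv> snd t \<circ> V \<circ> chart_inv c"

lemma Opn_triv: "t \<in> vtrivs A \<Longrightarrow> Opn (fst t)"
  using vb unfolding holomorphic_vb_def by (cases t) auto

lemma Opn_subset: "Opn U \<Longrightarrow> U \<subseteq> base"
  by (simp add: M.openin_iff base_eq)

lemma Opn_image: "Opn U \<Longrightarrow> c \<in> charts X \<Longrightarrow> open (snd c ` (fst c \<inter> U))"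
  by (simp add: M.openin_iff)

lemma Opn_image_triv: "Opn U \<Longrightarrow> c \<in> charts X \<Longrightarrow> t \<in> vtrivs A \<Longrightarrow> open (img c U t)"
  using Opn_image[OF openin_Int[OF _ Opn_triv]] by (simp add: Int_assoc)

lemma chart_transition_hol:
  "c \<in> charts X \<Longrightarrow> d \<in> charts X \<Longrightarrow> hol_on (mJ X) (mJ X) (snd c ` (fst c \<inter> fst d)) (snd d \<circ> chart_inv c)"
  using hol_atlas unfolding atlas_def by blast

lemma triv_transition_hol:
  assumes "t \<in> vtrivs A" "t' \<in> vtrivs A" "c \<in> charts X"
  shows "hol_on (mJ X) (fJ A) (snd c ` (fst c \<inter> (fst t \<inter> fst t')))
    (\<lambda>y. snd t' (tinv t (chart_inv c y) v))"
proof -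
  have "\<forall>(U, \<phi>)\<in>vtrivs A. \<forall>(U', \<phi>')\<in>vtrivs A. \<forall>v.
      hol_map X \<lparr>charts = {(UNIV, id)}, mJ = fJ A\<rparr> (U \<inter> U') (\<lambda>x. \<phi>' (inv_into (fibre A x) \<phi> v))"
    using vb unfolding holomorphic_vb_def Let_def by fast
  then have "hol_map X \<lparr>charts = {(UNIV, id)}, mJ = fJ A\<rparr> (fst t \<inter> fst t')
      (\<lambda>x. snd t' (tinv t x v))"
    using assms(1,2) by (cases t; cases t'; force)
  then show ?thesis
    using assms(3) unfolding hol_map_def chart_map_def Let_def
    by (auto simp: o_def Int_def conj_assoc)
qed

text \<open>A section of \<open>A\<close> is as regular as its components in the trivializations.  The three predicates are
  the regularity classes of maps into \<open>'e \<times> 'f\<close>, \<open>'e\<close> and \<open>'f\<close>.\<close>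

lemma section_chart_map:
  fixes P :: "'e set \<Rightarrow> ('e \<Rightarrow> 'e \<times> 'f) \<Rightarrow> bool"
  assumes U: "Opn U" and s: "\<And>x. x \<in> U \<Longrightarrow> s x \<in> fibre A x"
    and cong: "\<And>S f g. open S \<Longrightarrow> (\<And>y. y \<in> S \<Longrightarrow> f y = g y) \<Longrightarrow> P S f \<Longrightarrow> P S g"
    and Pair: "\<And>S f g. open S \<Longrightarrow> P S (\<lambda>y. (f y, g y)) \<longleftrightarrow> PM S f \<and> PF S g"
    and subset: "\<And>S T f. S \<subseteq> T \<Longrightarrow> PF T f \<Longrightarrow> PF S f" "\<And>S T f. S \<subseteq> T \<Longrightarrow> PM T f \<Longrightarrow> PM S f"
    and trans: "\<And>c d. c \<in> charts X \<Longrightarrow> d \<in> charts X \<Longrightarrow> PM (snd c ` (fst c \<inter> fst d)) (snd d \<circ> chart_inv c)"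
  shows "chart_map P (charts X) (total_atlas X A) U s \<longleftrightarrow>
    (\<forall>c\<in>charts X. \<forall>t\<in>vtrivs A. PF (img c U t) (rep c t s))"
proof -
  have S: "{m \<in> fst c \<inter> U. s m \<in> fst (total_chart A d t)} = fst c \<inter> U \<inter> fst d \<inter> fst t"
    for c d :: "('x, 'e) chart" and t
    using s by (auto simp: total_chart_def fibre_def)
  have opn: "open (snd c ` (fst c \<inter> U \<inter> fst d \<inter> fst t))"
    if "c \<in> charts X" "d \<in> charts X" "t \<in> vtrivs A" for c d t
    using Opn_image_triv[OF openin_Int[OF U M.openin_chart[OF that(2)]] that(1,3)] by (simp add: Int_assoc)
  have rep: "P (snd c ` (fst c \<inter> U \<inter> fst d \<inter> fst t)) (snd (total_chart A d t) \<circ> s \<circ> chart_inv c) \<longleftrightarrow>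
      PF (snd c ` (fst c \<inter> U \<inter> fst d \<inter> fst t)) (rep c t s)"
    (is "P ?S ?f \<longleftrightarrow> PF ?S ?g")
    if cdt: "c \<in> charts X" "d \<in> charts X" "t \<in> vtrivs A" for c d t
  proof -
    have eq: "?f y = ((snd d \<circ> chart_inv c) y, ?g y)" if "y \<in> ?S" for y
      using that s cdt(1) by (auto simp: total_chart_def fibre_def)
    have "P ?S ?f \<longleftrightarrow> P ?S (\<lambda>y. ((snd d \<circ> chart_inv c) y, ?g y))"
    proof
      show "P ?S (\<lambda>y. ((snd d \<circ> chart_inv c) y, ?g y))" if "P ?S ?f"
        by (rule cong[OF opn[OF cdt] _ that]) (rule eq)
      show "P ?S ?f" if "P ?S (\<lambda>y. ((snd d \<circ> chart_inv c) y, ?g y))"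
        by (rule cong[OF opn[OF cdt] _ that]) (rule eq[symmetric])
    qed
    also have "\<dots> \<longleftrightarrow> PM ?S (snd d \<circ> chart_inv c) \<and> PF ?S ?g"
      by (rule Pair[OF opn[OF cdt]])
    finally have iff: "P ?S ?f \<longleftrightarrow> PM ?S (snd d \<circ> chart_inv c) \<and> PF ?S ?g" .
    have "PM ?S (snd d \<circ> chart_inv c)"
      by (rule subset(2)[OF _ trans[OF cdt(1,2)]]) auto
    then show ?thesis using iff by simp
  qed
  have img: "s ` U \<subseteq> points (total_atlas X A)"
    using s by (auto simp: points_A fibre_def)
  have "chart_map P (charts X) (total_atlas X A) U s \<longleftrightarrow>
    (\<forall>c\<in>charts X. \<forall>d\<in>charts X. \<forall>t\<in>vtrivs A.
      PF (snd c ` (fst c \<inter> U \<inter> fst d \<inter> fst t)) (rep c t s))"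
  proof -
    have ball: "(\<forall>c\<in>charts X. \<forall>e\<in>total_atlas X A. Q c e) \<longleftrightarrow>
      (\<forall>c\<in>charts X. \<forall>d\<in>charts X. \<forall>t\<in>vtrivs A. Q c (total_chart A d t))" for Q
      unfolding total_atlas_eq by blast
    show ?thesis unfolding chart_map_def Let_def ball S using img rep opn by (simp cong: ball_cong)
  qed
  also have "\<dots> \<longleftrightarrow> (\<forall>c\<in>charts X. \<forall>t\<in>vtrivs A. PF (img c U t) (rep c t s))"
    (is "?L \<longleftrightarrow> ?R")
  proof
    assume L: ?L
    show ?R
    proof (intro ballI)
      fix c t assume ct: "c \<in> charts X" "t \<in> vtrivs A"
      have "fst c \<inter> U \<inter> fst c \<inter> fst t = fst c \<inter> U \<inter> fst t" by blast
      then show "PF (img c U t) (rep c t s)"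
        using L ct by metis
    qed
  next
    assume R: ?R
    show ?L
    proof (intro ballI)
      fix c d t assume cdt: "c \<in> charts X" "d \<in> charts X" "t \<in> vtrivs A"
      show "PF (snd c ` (fst c \<inter> U \<inter> fst d \<inter> fst t)) (rep c t s)"
        by (rule subset(1)[of _ "img c U t"]) (use R cdt in auto)
    qed
  qed
  finally show ?thesis .
qed

lemma smooth_sections_iff:
  assumes U: "Opn U"
  shows "s \<in> \<Gamma> U \<longleftrightarrow> s \<in> extensional U \<and> (\<forall>x\<in>U. s x \<in> fibre A x) \<and>
    (\<forall>c\<in>charts X. \<forall>t\<in>vtrivs A. smooth_on (img c U t) (rep c t s))"
proof -
  have "smooth_map (charts X) (total_atlas X A) U s \<longleftrightarrow>
    (\<forall>c\<in>charts X. \<forall>t\<in>vtrivs A. smooth_on (img c U t) (rep c t s))"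
    if "\<forall>x\<in>U. s x \<in> fibre A x"
    unfolding smooth_map_def
  proof (rule section_chart_map[OF U, where PM = smooth_on])
    show "smooth_on S f \<Longrightarrow> smooth_on S g" if "open S" "\<And>y. y \<in> S \<Longrightarrow> f y = g y"
      for S and f g :: "'e \<Rightarrow> 'e \<times> 'f"
      using smooth_on_cong[of S f g, OF that] by blast
  qed (use that chart_transition_hol in \<open>auto simp: smooth_on_Pair_iff hol_on_iff intro: smooth_on_subset\<close>)
  then show ?thesis unfolding smooth_sections_def by blast
qed

lemma hol_sections_iff:
  assumes U: "Opn U"
  shows "s \<in> Hol U \<longleftrightarrow> s \<in> extensional U \<and> (\<forall>x\<in>U. s x \<in> fibre A x) \<and>
    (\<forall>c\<in>charts X. \<forall>t\<in>vtrivs A.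
      hol_on (mJ X) (fJ A) (img c U t) (rep c t s))"
proof -
  have "hol_map X (total_cmfd X A) U s \<longleftrightarrow> (\<forall>c\<in>charts X. \<forall>t\<in>vtrivs A.
      hol_on (mJ X) (fJ A) (img c U t) (rep c t s))"
    if "\<forall>x\<in>U. s x \<in> fibre A x"
    unfolding hol_map_def total_cmfd_def cmfd.simps
  proof (rule section_chart_map[OF U, where PM = "hol_on (mJ X) (mJ X)"])
    show "hol_on (mJ X) (map_prod (mJ X) (fJ A)) S f \<Longrightarrow> hol_on (mJ X) (map_prod (mJ X) (fJ A)) S g"
      if "open S" "\<And>y. y \<in> S \<Longrightarrow> f y = g y" for S and f g :: "'e \<Rightarrow> 'e \<times> 'f"
      using hol_on_cong[of S f g, OF that] by blast
  qed (use that chart_transition_hol in \<open>auto simp: hol_on_Pair_iff intro: hol_on_subset\<close>)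
  then show ?thesis unfolding hol_sections_def by blast
qed

lemma smooth_funs_iff:
  assumes "Opn U"
  shows "f \<in> smooth_funs X U \<longleftrightarrow> (\<forall>c\<in>charts X. smooth_on (snd c ` (fst c \<inter> U)) (f \<circ> chart_inv c))"
  using Opn_image[OF assms] unfolding smooth_funs_def smooth_map_def chart_map_def
  by (auto simp: points_def o_def Int_def)

lemma hol_funs_iff:
  assumes "Opn U"
  shows "f \<in> hol_funs X U \<longleftrightarrow>
    (\<forall>c\<in>charts X. hol_on (mJ X) ((*) \<i>) (snd c ` (fst c \<inter> U)) (f \<circ> chart_inv c))"
  using Opn_image[OF assms] unfolding hol_funs_def hol_map_def chart_map_def
  by (auto simp: points_def o_def Int_def)

lemma section_fibre: "V \<in> \<Gamma> U \<Longrightarrow> x \<in> U \<Longrightarrow> V x \<in> fibre A x"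
  by (simp add: smooth_sections_def)

lemma section_extensional: "V \<in> \<Gamma> U \<Longrightarrow> V \<in> extensional U"
  by (simp add: smooth_sections_def)

lemma hol_section_smooth: "Opn U \<Longrightarrow> V \<in> Hol U \<Longrightarrow> V \<in> \<Gamma> U"
  by (simp add: smooth_sections_iff hol_sections_iff hol_on_iff)

text \<open>Here \<open>r c t\<close> is the coordinate expression of the section in the chart \<open>c\<close> and the trivialization \<open>t\<close>.\<close>

lemma smooth_sectionI:
  assumes U: "Opn U" and "s \<in> extensional U" "\<And>x. x \<in> U \<Longrightarrow> s x \<in> fibre A x"
    and "\<And>c t. c \<in> charts X \<Longrightarrow> t \<in> vtrivs A \<Longrightarrow> smooth_on (img c U t) (r c t)"
    and "\<And>c t x. c \<in> charts X \<Longrightarrow> t \<in> vtrivs A \<Longrightarrow> x \<in> U \<Longrightarrow> x \<in> fst c \<Longrightarrow> x \<in> fst t \<Longrightarrow> r c t (snd c x) = snd t (s x)"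
  shows "s \<in> \<Gamma> U"
  unfolding smooth_sections_iff[OF U]
proof (intro conjI ballI)
  fix c t assume ct: "c \<in> charts X" "t \<in> vtrivs A"
  have "(rep c t s) y = r c t y" if "y \<in> img c U t" for y
    using that assms(5)[OF ct] ct(1) by auto
  from smooth_on_cong[of _ "rep c t s" "r c t", OF Opn_image_triv[OF U ct] this] assms(4)[OF ct]
  show "smooth_on (img c U t) (rep c t s)" by blast
qed (use assms in auto)

lemma hol_sectionI:
  assumes U: "Opn U" and "s \<in> extensional U" "\<And>x. x \<in> U \<Longrightarrow> s x \<in> fibre A x"
    and "\<And>c t. c \<in> charts X \<Longrightarrow> t \<in> vtrivs A \<Longrightarrow>
      hol_on (mJ X) (fJ A) (img c U t) (r c t)"
    and "\<And>c t x. c \<in> charts X \<Longrightarrow> t \<in> vtrivs A \<Longrightarrow> x \<in> U \<Longrightarrow> x \<in> fst c \<Longrightarrow> x \<in> fst t \<Longrightarrow> r c t (snd c x) = snd t (s x)"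
  shows "s \<in> Hol U"
  unfolding hol_sections_iff[OF U]
proof (intro conjI ballI)
  fix c t assume ct: "c \<in> charts X" "t \<in> vtrivs A"
  have "(rep c t s) y = r c t y" if "y \<in> img c U t" for y
    using that assms(5)[OF ct] ct(1) by auto
  from hol_on_cong[of _ "rep c t s" "r c t", OF Opn_image_triv[OF U ct] this] assms(4)[OF ct]
  show "hol_on (mJ X) (fJ A) (img c U t) (rep c t s)" by blast
qed (use assms in auto)

lemma section_rep_smooth:
  assumes "Opn U" "V \<in> \<Gamma> U" "c \<in> charts X" "t \<in> vtrivs A"
  shows "smooth_on (img c U t) (rep c t V)"
  using assms smooth_sections_iff by blast

definition sadd :: "'x set \<Rightarrow> ('x \<Rightarrow> 'a) \<Rightarrow> ('x \<Rightarrow> 'a) \<Rightarrow> 'x \<Rightarrow> 'a" where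
  "sadd U V W = (\<lambda>x\<in>U. fadd A (V x) (W x))"

definition sscale :: "'x set \<Rightarrow> ('x \<Rightarrow> real) \<Rightarrow> ('x \<Rightarrow> 'a) \<Rightarrow> 'x \<Rightarrow> 'a" where
  "sscale U f V = (\<lambda>x\<in>U. fscaleR A (f x) (V x))"

definition smulI :: "'x set \<Rightarrow> ('x \<Rightarrow> 'a) \<Rightarrow> 'x \<Rightarrow> 'a" where
  "smulI U V = (\<lambda>x\<in>U. fmulI A (V x))"

definition const_section :: "'x set \<Rightarrow> 'x set \<times> ('a \<Rightarrow> 'f) \<Rightarrow> 'f \<Rightarrow> 'x \<Rightarrow> 'a" where
  "const_section U t b = (\<lambda>x\<in>U. tinv t x b)"

lemma in_base: "Opn U \<Longrightarrow> x \<in> U \<Longrightarrow> x \<in> base"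
  using Opn_subset by blast

lemma sadd_section:
  assumes U: "Opn U" and V: "V \<in> \<Gamma> U" and W: "W \<in> \<Gamma> U"
  shows "sadd U V W \<in> \<Gamma> U"
proof (rule smooth_sectionI[OF U])
  fix c t assume ct: "c \<in> charts X" "t \<in> vtrivs A"
  show "smooth_on (img c U t)
      (\<lambda>y. (rep c t V) y + (rep c t W) y)"
    by (rule smooth_on_add[OF Opn_image_triv[OF U ct] section_rep_smooth[OF U V ct] section_rep_smooth[OF U W ct]])
next
  fix c t x assume t: "t \<in> vtrivs A" "x \<in> fst t" and x: "x \<in> U"
  show "(rep c t V) (snd c x) + (rep c t W) (snd c x) = snd t (sadd U V W x)"
    if "c \<in> charts X" "x \<in> fst c"
    using triv_fadd[OF in_base[OF U x] section_fibre[OF V x] section_fibre[OF W x] t] that x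
    by (simp add: sadd_def)
next
  show "sadd U V W x \<in> fibre A x" if "x \<in> U" for x
    using fadd_in[OF in_base[OF U that] section_fibre[OF V that]] that by (simp add: sadd_def)
qed (simp add: sadd_def)

lemma sscale_section:
  assumes U: "Opn U" and f: "f \<in> smooth_funs X U" and V: "V \<in> \<Gamma> U"
  shows "sscale U f V \<in> \<Gamma> U"
proof (rule smooth_sectionI[OF U])
  fix c t assume ct: "c \<in> charts X" "t \<in> vtrivs A"
  have "smooth_on (snd c ` (fst c \<inter> U)) (f \<circ> chart_inv c)" using f U ct smooth_funs_iff by blast
  then have "smooth_on (img c U t) (f \<circ> chart_inv c)"
    by (rule smooth_on_subset[rotated]) blast
  then show "smooth_on (img c U t)
      (\<lambda>y. (f \<circ> chart_inv c) y *\<^sub>R (rep c t V) y)"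
    by (rule smooth_on_scaleR[OF Opn_image_triv[OF U ct] _ section_rep_smooth[OF U V ct]])
next
  fix c t x assume t: "t \<in> vtrivs A" "x \<in> fst t" and x: "x \<in> U"
  show "(f \<circ> chart_inv c) (snd c x) *\<^sub>R (rep c t V) (snd c x) = snd t (sscale U f V x)"
    if "c \<in> charts X" "x \<in> fst c"
    using triv_fscaleR[OF in_base[OF U x] section_fibre[OF V x] t] that x by (simp add: sscale_def)
next
  show "sscale U f V x \<in> fibre A x" if "x \<in> U" for x
    using fscaleR_in[OF in_base[OF U that] section_fibre[OF V that]] that by (simp add: sscale_def)
qed (simp add: sscale_def)

lemma smulI_section:
  assumes U: "Opn U" and V: "V \<in> \<Gamma> U"
  shows "smulI U V \<in> \<Gamma> U"
proof (rule smooth_sectionI[OF U])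
  fix c t assume ct: "c \<in> charts X" "t \<in> vtrivs A"
  show "smooth_on (img c U t) (\<lambda>y. fJ A ((rep c t V) y))"
    by (rule smooth_on_bounded_linear[OF Opn_image_triv[OF U ct] fJ_bounded section_rep_smooth[OF U V ct]])
next
  fix c t x assume t: "t \<in> vtrivs A" "x \<in> fst t" and x: "x \<in> U"
  show "fJ A ((rep c t V) (snd c x)) = snd t (smulI U V x)"
    if "c \<in> charts X" "x \<in> fst c"
    using triv_fmulI[OF in_base[OF U x] section_fibre[OF V x] t] that x by (simp add: smulI_def)
next
  show "smulI U V x \<in> fibre A x" if "x \<in> U" for x
    using fmulI_in[OF in_base[OF U that] section_fibre[OF V that]] that by (simp add: smulI_def)
qed (simp add: smulI_def)

lemma smulI_hol_section:
  assumes U: "Opn U" and V: "V \<in> Hol U"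
  shows "smulI U V \<in> Hol U"
proof (rule hol_sectionI[OF U])
  fix c t assume ct: "c \<in> charts X" "t \<in> vtrivs A"
  have "hol_on (mJ X) (fJ A) (img c U t) (rep c t V)"
    using V hol_sections_iff[OF U] ct by blast
  from hol_on_compose_linear[where K = "fJ A" and K' = "fJ A", OF Opn_image_triv[OF U ct] fJ_bounded refl this]
  show "hol_on (mJ X) (fJ A) (img c U t) (\<lambda>y. fJ A ((rep c t V) y))" .
next
  fix c t x assume t: "t \<in> vtrivs A" "x \<in> fst t" and x: "x \<in> U"
  show "fJ A ((rep c t V) (snd c x)) = snd t (smulI U V x)"
    if "c \<in> charts X" "x \<in> fst c"
    using triv_fmulI[OF in_base[OF U x] section_fibre[OF hol_section_smooth[OF U V] x] t] that x
    by (simp add: smulI_def)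
next
  show "smulI U V x \<in> fibre A x" if "x \<in> U" for x
    using section_fibre[OF smulI_section[OF U hol_section_smooth[OF U V]] that] .
qed (simp add: smulI_def)

lemma restrict_section:
  assumes U: "Opn U" and U': "Opn U'" "U' \<subseteq> U" and V: "V \<in> \<Gamma> U"
  shows "restrict V U' \<in> \<Gamma> U'"
proof (rule smooth_sectionI[OF U'(1)])
  fix c t assume ct: "c \<in> charts X" "t \<in> vtrivs A"
  show "smooth_on (img c U' t) (rep c t V)"
    by (rule smooth_on_subset[OF _ section_rep_smooth[OF U V ct]]) (use U'(2) in blast)
qed (use U' section_fibre[OF V] in auto)

text \<open>In another trivialization the components are values of the coordinate change on the fixed vector \<open>b\<close>,
  and these depend holomorphically on the base point.\<close>

lemma const_section_hol:
  assumes U: "Opn U" and t: "t \<in> vtrivs A" "U \<subseteq> fst t"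
  shows "const_section U t b \<in> Hol U"
proof (rule hol_sectionI[OF U])
  fix c t' assume ct: "c \<in> charts X" "t' \<in> vtrivs A"
  show "hol_on (mJ X) (fJ A) (snd c ` (fst c \<inter> U \<inter> fst t'))
      (\<lambda>y. snd t' (tinv t (chart_inv c y) b))"
    by (rule hol_on_subset[OF _ triv_transition_hol[OF t(1) ct(2,1)]]) (use t(2) in blast)
qed (use t triv_inv_in[OF t(1)] in \<open>auto simp: const_section_def\<close>)

lemma const_section_smooth:
  "Opn U \<Longrightarrow> t \<in> vtrivs A \<Longrightarrow> U \<subseteq> fst t \<Longrightarrow> const_section U t b \<in> \<Gamma> U"
  using const_section_hol hol_section_smooth by blast

lemma const_smooth_fun: "Opn U \<Longrightarrow> (\<lambda>_. k) \<in> smooth_funs X U"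
  by (simp add: smooth_funs_iff o_def smooth_on_const)

lemma component_smooth_fun:
  assumes U: "Opn U" and V: "V \<in> \<Gamma> U" and t: "t \<in> vtrivs A" "U \<subseteq> fst t"
    and l: "bounded_linear l"
  shows "(\<lambda>x. l (snd t (V x))) \<in> smooth_funs X U"
  unfolding smooth_funs_iff[OF U]
proof
  fix c assume c: "c \<in> charts X"
  have "fst c \<inter> U \<inter> fst t = fst c \<inter> U" using t(2) by blast
  then show "smooth_on (snd c ` (fst c \<inter> U)) ((\<lambda>x. l (snd t (V x))) \<circ> chart_inv c)"
    using smooth_on_bounded_linear[OF Opn_image[OF U c] l, of "rep c t V"]
      section_rep_smooth[OF U V c t(1)] by (simp add: o_def)
qed

lemma Re_smooth_fun:
  assumes U: "Opn U" and h: "h \<in> hol_funs X U"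
  shows "(\<lambda>x. Re (h x)) \<in> smooth_funs X U"
  unfolding smooth_funs_iff[OF U]
proof
  fix c assume c: "c \<in> charts X"
  show "smooth_on (snd c ` (fst c \<inter> U)) ((\<lambda>x. Re (h x)) \<circ> chart_inv c)"
    using smooth_on_bounded_linear[OF Opn_image[OF U c] bounded_linear_Re, of "h \<circ> chart_inv c"]
      h c hol_funs_iff[OF U] by (simp add: o_def hol_on_iff)
qed

lemma bounded_linear_complexify:
  assumes l: "bounded_linear l"
  shows "bounded_linear (complexify (mJ X) l)"
  unfolding complexify_def[abs_def]
  by (intro bounded_linear_sub bounded_linear_const_mult bounded_linear_compose[OF bounded_linear_of_real]
      bounded_linear_compose[OF l] l mJ_bounded)

text \<open>The test functions that will determine the anchors.\<close>

lemma complexify_chart_hol: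
  assumes U: "Opn U" and c: "c \<in> charts X" "U \<subseteq> fst c" and l: "bounded_linear l"
  shows "(\<lambda>x. complexify (mJ X) l (snd c x)) \<in> hol_funs X U"
  unfolding hol_funs_iff[OF U]
proof
  fix d assume d: "d \<in> charts X"
  have J: "complexify (mJ X) l (mJ X v) = \<i> * complexify (mJ X) l v" for v
    using bounded_linear.linear[OF l] by (simp add: complexify_def mJ_mJ linear_neg algebra_simps)
  have "hol_on (mJ X) (mJ X) (snd d ` (fst d \<inter> U)) (snd c \<circ> chart_inv d)"
    by (rule hol_on_subset[OF _ chart_transition_hol[OF d c(1)]]) (use c(2) in blast)
  from hol_on_compose_linear[where K' = "(*) \<i>", OF Opn_image[OF U d] bounded_linear_complexify[OF l] J this]
  show "hol_on (mJ X) ((*) \<i>) (snd d ` (fst d \<inter> U)) ((\<lambda>x. complexify (mJ X) l (snd c x)) \<circ> chart_inv d)"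
    by (simp add: o_def)
qed

text \<open>Locally, the smooth sections are generated over the smooth functions by the constant sections of a
  trivialization, which are holomorphic.\<close>

lemma section_induct [consumes 4, case_names const add scale]:
  assumes U: "Opn U" and t: "t \<in> vtrivs A" "U \<subseteq> fst t" and V: "V \<in> \<Gamma> U"
    and const: "\<And>b. P (const_section U t b)"
    and add: "\<And>V W. V \<in> \<Gamma> U \<Longrightarrow> W \<in> \<Gamma> U \<Longrightarrow> P V \<Longrightarrow> P W \<Longrightarrow> P (sadd U V W)"
    and scale: "\<And>f V. f \<in> smooth_funs X U \<Longrightarrow> V \<in> \<Gamma> U \<Longrightarrow> P V \<Longrightarrow> P (sscale U f V)"
  shows "P V"
proof -
  obtain B :: "'f set" and \<kappa> where B: "finite B" "\<And>b. bounded_linear (\<kappa> b :: 'f \<Rightarrow> real)"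
    "\<And>v. (\<Sum>b\<in>B. \<kappa> b v *\<^sub>R b) = v"
    by (rule finite_dim_coordinates[OF complex_fin_dim_basis[OF fin_dim_A]]) blast
  \<comment> \<open>\<open>Q S\<close> is the part of the expansion of \<open>V\<close> in the constant frame that belongs to \<open>S\<close>.\<close>
  define Q where "Q S = (\<lambda>x\<in>U. tinv t x (\<Sum>b\<in>S. \<kappa> b (snd t (V x)) *\<^sub>R b))" for S
  have tx: "x \<in> fst t" "x \<in> base" if "x \<in> U" for x using that t(2) in_base[OF U] by auto
  have "Q S \<in> \<Gamma> U \<and> P (Q S)" if "finite S" for S
    using that
  proof (induction S rule: finite_induct)
    case empty
    have "Q {} = const_section U t 0" by (simp add: Q_def const_section_def)
    then show ?case using const const_section_smooth[OF U t] by simp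
  next
    case (insert b S)
    let ?f = "\<lambda>x. \<kappa> b (snd t (V x))" and ?e = "const_section U t b"
    have f: "?f \<in> smooth_funs X U" using component_smooth_fun[OF U V t B(2)] .
    have e: "?e \<in> \<Gamma> U" using const_section_smooth[OF U t] .
    have fe: "sscale U ?f ?e \<in> \<Gamma> U" using sscale_section[OF U f e] .
    have "Q (insert b S) = sadd U (sscale U ?f ?e) (Q S)"
    proof (rule extensionalityI[of _ U])
      fix x assume x: "x \<in> U"
      note tr = t(1) tx(1)[OF x] and m = tx(2)[OF x]
      have in1: "?e x \<in> fibre A x" and in2: "Q S x \<in> fibre A x"
        using e insert.IH x section_fibre by blast+
      have val: "snd t (?e x) = b" "snd t (Q S x) = (\<Sum>b\<in>S. \<kappa> b (snd t (V x)) *\<^sub>R b)"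
        using x triv_inv_right[OF tr] by (auto simp: const_section_def Q_def)
      have eq: "sadd U (sscale U ?f ?e) (Q S) x = fadd A (fscaleR A (?f x) (?e x)) (Q S x)"
        using x by (simp add: sadd_def sscale_def)
      show "Q (insert b S) x = sadd U (sscale U ?f ?e) (Q S) x"
        unfolding eq
      proof (rule triv_eqI[OF tr])
        show "Q (insert b S) x \<in> fibre A x" using x triv_inv_in[OF tr] by (simp add: Q_def)
        show "fadd A (fscaleR A (?f x) (?e x)) (Q S x) \<in> fibre A x"
          by (rule fadd_in[OF m fscaleR_in[OF m in1]])
        show "snd t (Q (insert b S) x) = snd t (fadd A (fscaleR A (?f x) (?e x)) (Q S x))"
          using x triv_inv_right[OF tr] insert.hyps
          by (simp add: triv_fadd[OF m fscaleR_in[OF m in1] in2 tr] triv_fscaleR[OF m in1 tr] val)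
            (simp add: Q_def)
      qed
    qed (auto simp: Q_def sadd_def)
    then show ?case
      using add[OF fe _ scale[OF f e const]] sadd_section[OF U fe] insert.IH by simp
  qed
  from this[OF B(1)] have "P (Q B)" by blast
  also have "Q B = V"
  proof (rule extensionalityI[of _ U])
    fix x assume "x \<in> U"
    then show "Q B x = V x"
      using triv_inv_left[OF t(1) tx(1)] section_fibre[OF V] by (simp add: Q_def B(3))
  qed (use section_extensional[OF V] in \<open>auto simp: Q_def\<close>)
  finally show ?thesis .
qed

end

section \<open>The tangent bundle\<close>

context cdiff_atlas
begin

text \<open>Coordinate vectors in all charts around \<open>m\<close> are obtained from the one in \<open>c\<close> by the coordinate changes; they
  are compatible by the chain rule.\<close>

lemma tangent_extend:
  assumes c: "c \<in> C" "m \<in> fst c"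
  obtains v where "v \<in> tangent_space C m" "v c = u"
proof -
  define v where "v d = (if d \<in> C \<and> m \<in> fst d
    then dchange c d m u else 0)" for d
  have "((snd c \<circ> chart_inv c) has_derivative (\<lambda>v. v)) (at (snd c m))"
  proof (rule iffD2[OF has_derivative_cong_open[OF open_image[OF c(1)]] has_derivative_ident])
    show "(snd c \<circ> chart_inv c) y = y" if "y \<in> snd c ` fst c" for y
      using that c(1) by auto
  qed (use c(2) in auto)
  then have "dchange c c m = (\<lambda>v. v)"
    by (rule frechet_derivative_unique)
  then have vc: "v c = u" using c by (simp add: v_def)
  moreover have "v \<in> tangent_space C m"
  proof (rule tangent_spaceI)
    fix d d' assume d: "d \<in> C" "d' \<in> C" "m \<in> fst d" "m \<in> fst d'"
    have "dchange c d' m =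
      (\<lambda>v. dchange d d' m
        (dchange c d m v))"
      by (rule frechet_derivative_unique[OF has_derivative_change_chart[OF d(1) c(1) d(3) c(2) transition(1)[OF d]]])
    then show "v d' = dchange d d' m (v d)"
      using d by (simp add: v_def)
  qed (auto simp: v_def)
  ultimately show ?thesis using that by blast
qed

end

context hol_bundle
begin

abbreviation "TX \<equiv> tangent_bundle X"

lemma fibre_TX: "fibre TX x = {(x, v) | v. x \<in> points (charts X) \<and> v \<in> tangent_space (charts X) x}"
  unfolding fibre_def tangent_bundle_def by auto

lemma vtrivs_TX: "t \<in> vtrivs TX \<longleftrightarrow> (\<exists>c\<in>charts X. t = (fst c, \<lambda>(x, v). v c))"
  unfolding tangent_bundle_def vb.select_convs by blast

lemma fJ_TX: "fJ TX = mJ X"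
  by (simp add: tangent_bundle_def)

lemma TX_bij:
  assumes c: "c \<in> charts X" "x \<in> fst c"
  shows "bij_betw (\<lambda>(x, v). v c) (fibre TX x) UNIV"
  unfolding bij_betw_def
proof
  show "inj_on (\<lambda>(x, v). v c) (fibre TX x)"
    by (rule inj_onI) (auto simp: fibre_TX intro: M.tangent_eqI[OF _ _ c])
  have "\<exists>a\<in>fibre TX x. u = (\<lambda>(x, v). v c) a" for u
  proof -
    obtain v where "v \<in> tangent_space (charts X) x" "v c = u" using M.tangent_extend[OF c] .
    then show ?thesis using in_pointsI[OF c] by (intro bexI[of _ "(x, v)"]) (auto simp: fibre_TX)
  qed
  then show "(\<lambda>(x, v). v c) ` fibre TX x = UNIV" by auto
qed

lemma TX_change:
  assumes c: "c \<in> charts X" "x \<in> fst c" and d: "d \<in> charts X" "x \<in> fst d"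
  shows "(\<lambda>(x, v). v d) (inv_into (fibre TX x) (\<lambda>(x, v). v c) u) =
    dchange c d x u"
proof -
  let ?a = "inv_into (fibre TX x) (\<lambda>(x, v). v c) u"
  have "?a \<in> fibre TX x" "(\<lambda>(x, v). v c) ?a = u"
    using TX_bij[OF c] unfolding bij_betw_def by (auto intro: inv_into_into f_inv_into_f)
  then obtain v where v: "?a = (x, v)" "v \<in> tangent_space (charts X) x" "v c = u"
    unfolding fibre_TX by auto
  show ?thesis unfolding v(1) using M.tangent_spaceD(2)[OF v(2) c(1) d(1) c(2) d(2)] v(3) by simp
qed

sublocale T: complex_fibres TX
proof (intro complex_fibres.intro linear_fibres.intro bij_fibres.intro linear_fibres_axioms.intro
    complex_fibres_axioms.intro)
  show "bij_betw (snd t) (fibre TX x) UNIV" if "t \<in> vtrivs TX" "x \<in> fst t" for t x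
    using that TX_bij unfolding vtrivs_TX by force
  fix t t' x assume "t \<in> vtrivs TX" "t' \<in> vtrivs TX" and x: "x \<in> fst t" "x \<in> fst t'"
  then obtain c d where c: "c \<in> charts X" "t = (fst c, \<lambda>(x, v). v c)"
    and d: "d \<in> charts X" "t' = (fst d, \<lambda>(x, v). v d)" unfolding vtrivs_TX by blast
  have xc: "x \<in> fst c" "x \<in> fst d" using x c d by auto
  have eq: "snd t' (inv_into (fibre TX x) (snd t) u) =
      dchange c d x u" for u
    using TX_change[OF c(1) xc(1) d(1) xc(2)] c(2) d(2) by simp
  show "linear (\<lambda>v. snd t' (inv_into (fibre TX x) (snd t) v))"
    unfolding eq using M.transition_linear[OF c(1) d(1) xc] by simp
  show "snd t' (inv_into (fibre TX x) (snd t) (fJ TX v)) = fJ TX (snd t' (inv_into (fibre TX x) (snd t) v))" for v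
    unfolding eq using M.transition(2)[OF c(1) d(1) xc] by (simp add: fJ_TX)
next
  show "linear (fJ TX)" using mJ_bounded bounded_linear.linear by (simp add: fJ_TX)
  show "fJ TX (fJ TX v) = - v" for v by (simp add: fJ_TX mJ_mJ)
qed

lemma T_base: "T.base = base"
  unfolding T.base_def base_eq points_def by (force simp: vtrivs_TX)

lemma points_TX: "points (total_atlas X TX) = vtotal TX"
proof (rule points_total_atlas)
  fix a assume "a \<in> vtotal TX"
  then have "vproj TX a \<in> points (charts X)" by (auto simp: tangent_bundle_def)
  then show "vproj TX a \<in> points (charts X) \<inter> \<Union> (fst ` vtrivs TX)"
    using T_base base_eq unfolding T.base_def by simp
qed

lemma
  assumes x: "x \<in> base" and v: "v \<in> tangent_space (charts X) x"
  shows fscaleR_TX: "fscaleR TX r (x, v) = (x, \<lambda>c. r *\<^sub>R v c)"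
    and fmulI_TX: "fmulI TX (x, v) = (x, \<lambda>c. mJ X (v c))"
proof -
  have xp: "x \<in> points (charts X)" using x base_eq by simp
  have xT: "x \<in> T.base" using x T_base by simp
  obtain c where c: "c \<in> charts X" "x \<in> fst c" using xp by (auto simp: points_def)
  have t: "(fst c, \<lambda>(x, v). v c) \<in> vtrivs TX" "x \<in> fst (fst c, \<lambda>(x, v). v c)"
    using c unfolding vtrivs_TX by auto
  have a: "(x, v) \<in> fibre TX x" using xp v by (simp add: fibre_TX)
  show "fscaleR TX r (x, v) = (x, \<lambda>c. r *\<^sub>R v c)"
    by (rule T.triv_eqI[OF t T.fscaleR_in[OF xT a]])
      (use xp M.tangent_scaleR[OF v] T.triv_fscaleR[OF xT a t] in \<open>simp_all add: fibre_TX\<close>)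
  show "fmulI TX (x, v) = (x, \<lambda>c. mJ X (v c))"
    by (rule T.triv_eqI[OF t T.fmulI_in[OF xT a]])
      (use xp M.tangent_J[OF v] T.triv_fmulI[OF xT a t] in \<open>simp_all add: fibre_TX fJ_TX\<close>)
qed

section \<open>Real Lie algebroids\<close>

lemma sadd_eq: "(\<lambda>x\<in>U. fadd A (V x) (W x)) = sadd U V W"
  and sscale_eq: "(\<lambda>x\<in>U. fscaleR A (f x) (V x)) = sscale U f V"
  by (simp_all add: sadd_def sscale_def)

text \<open>The conditions on a bracket that involve the anchor only through its action on functions.  On an
  open set over which \<open>A\<close> is trivial such a bracket is determined by its values on constant sections.\<close>

definition derivation_bracket :: "'x set \<Rightarrow> (('x \<Rightarrow> 'a) \<Rightarrow> ('x \<Rightarrow> real) \<Rightarrow> 'x \<Rightarrow> real)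
    \<Rightarrow> (('x \<Rightarrow> 'a) \<Rightarrow> ('x \<Rightarrow> 'a) \<Rightarrow> 'x \<Rightarrow> 'a) \<Rightarrow> bool" where
  "derivation_bracket U act br \<longleftrightarrow> (\<forall>V\<in>\<Gamma> U. \<forall>W\<in>\<Gamma> U.
     br V W = sscale U (\<lambda>_. - 1) (br W V) \<and>
     (\<forall>Z\<in>\<Gamma> U. br V (sadd U W Z) = sadd U (br V W) (br V Z)) \<and>
     (\<forall>f\<in>smooth_funs X U.
        br V (sscale U f W) = sadd U (sscale U (act V f) W) (sscale U f (br V W))))"

lemma derivation_bracketD:
  assumes "derivation_bracket U act br" "V \<in> \<Gamma> U" "W \<in> \<Gamma> U"
  shows "br V W = sscale U (\<lambda>_. - 1) (br W V)"
    and "Z \<in> \<Gamma> U \<Longrightarrow> br V (sadd U W Z) = sadd U (br V W) (br V Z)"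
    and "f \<in> smooth_funs X U \<Longrightarrow> br V (sscale U f W) = sadd U (sscale U (act V f) W) (sscale U f (br V W))"
  using assms unfolding derivation_bracket_def by blast+

text \<open>By the Leibniz rule, equality is preserved under sums and smooth multiples in the second argument, hence
  extends from constant sections to all sections there; antisymmetry then carries it to the first
  argument.\<close>

lemma derivation_brackets_agree:
  assumes U: "Opn U" and t: "t \<in> vtrivs A" "U \<subseteq> fst t"
    and d1: "derivation_bracket U act br1" and d2: "derivation_bracket U act br2"
    and const: "\<And>b b'. br1 (const_section U t b) (const_section U t b') = br2 (const_section U t b) (const_section U t b')"
    and V: "V \<in> \<Gamma> U" and W: "W \<in> \<Gamma> U"
  shows "br1 V W = br2 V W"
proof -
  note cs = const_section_smooth[OF U t]
  have second: "br1 Z W = br2 Z W"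
    if Z: "Z \<in> \<Gamma> U" and W: "W \<in> \<Gamma> U"
      and base: "\<And>b. br1 Z (const_section U t b) = br2 Z (const_section U t b)" for Z W
    using U t W
  proof (induction rule: section_induct)
    case (const b) show ?case by (rule base)
  next
    case (add V W)
    then show ?case
      using derivation_bracketD(2)[OF d1 Z add(1,2)] derivation_bracketD(2)[OF d2 Z add(1,2)] by simp
  next
    case (scale f V)
    then show ?case
      using derivation_bracketD(3)[OF d1 Z scale(2,1)] derivation_bracketD(3)[OF d2 Z scale(2,1)] by simp
  qed
  have "br1 V (const_section U t b) = br2 V (const_section U t b)" for b
    using second[OF cs V const, of b] derivation_bracketD(1)[OF d1 V cs] derivation_bracketD(1)[OF d2 V cs]
    by simp
  then show ?thesis by (rule second[OF V W])
qed

definition lie_axioms :: "'x set \<Rightarrow> ('x, 'a, 'e) algd \<Rightarrow> bool" where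
  "lie_axioms U L \<longleftrightarrow> derivation_bracket U (anchor_act X L) (bracket L U) \<and>
     (\<forall>V\<in>\<Gamma> U. \<forall>W\<in>\<Gamma> U.
        bracket L U V W \<in> \<Gamma> U \<and>
        (\<forall>U'. Opn U' \<and> U' \<subseteq> U \<longrightarrow>
           bracket L U' (restrict V U') (restrict W U') = restrict (bracket L U V W) U') \<and>
        (\<forall>k. bracket L U V (sscale U (\<lambda>_. k) W) = sscale U (\<lambda>_. k) (bracket L U V W)) \<and>
        (\<forall>Z\<in>\<Gamma> U. bracket L U V (bracket L U W Z) =
            sadd U (bracket L U (bracket L U V W) Z) (bracket L U W (bracket L U V Z))) \<and>
        (\<forall>f\<in>smooth_funs X U. \<forall>x\<in>U. anchor_act X L (bracket L U V W) f x =
            anchor_act X L V (anchor_act X L W f) x - anchor_act X L W (anchor_act X L V f) x))"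

lemma real_lie_sheaf_iff:
  "lie_sheaf X A (fscaleR A) \<Gamma> (smooth_funs X) L \<longleftrightarrow> (\<forall>U. Opn U \<longrightarrow> lie_axioms U L)"
  unfolding lie_sheaf_def Let_def lie_axioms_def derivation_bracket_def sadd_eq sscale_eq
  by (rule iff_allI, rule imp_cong[OF refl]) blast

lemma
  assumes L: "real_lie_algebroid X A L" and U: "Opn U"
  shows real_lie_derivation_bracket: "derivation_bracket U (anchor_act X L) (bracket L U)"
    and real_lie_bracket_section: "V \<in> \<Gamma> U \<Longrightarrow> W \<in> \<Gamma> U \<Longrightarrow>
      bracket L U V W \<in> \<Gamma> U"
    and real_lie_bracket_restrict: "V \<in> \<Gamma> U \<Longrightarrow> W \<in> \<Gamma> U \<Longrightarrow>
      Opn U' \<Longrightarrow> U' \<subseteq> U \<Longrightarrow> bracket L U' (restrict V U') (restrict W U') = restrict (bracket L U V W) U'"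
    and real_lie_bracket_const: "V \<in> \<Gamma> U \<Longrightarrow> W \<in> \<Gamma> U \<Longrightarrow>
      bracket L U V (sscale U (\<lambda>_. k) W) = sscale U (\<lambda>_. k) (bracket L U V W)"
    and real_lie_jacobi: "V \<in> \<Gamma> U \<Longrightarrow> W \<in> \<Gamma> U \<Longrightarrow>
      Z \<in> \<Gamma> U \<Longrightarrow> bracket L U V (bracket L U W Z) =
            sadd U (bracket L U (bracket L U V W) Z) (bracket L U W (bracket L U V Z))"
    and real_lie_anchor: "V \<in> \<Gamma> U \<Longrightarrow> W \<in> \<Gamma> U \<Longrightarrow>
      f \<in> smooth_funs X U \<Longrightarrow> x \<in> U \<Longrightarrow> anchor_act X L (bracket L U V W) f x =
            anchor_act X L V (anchor_act X L W f) x - anchor_act X L W (anchor_act X L V f) x"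
  using mp[OF spec[OF iffD1[OF real_lie_sheaf_iff
        conjunct2[OF L[unfolded real_lie_algebroid_def]]], of U] U]
  unfolding lie_axioms_def by blast+

lemma real_lie_smooth_anchor: "real_lie_algebroid X A L \<Longrightarrow> smooth_bundle_map X A TX (anchor L)"
  unfolding real_lie_algebroid_def by blast

lemma anchor_in: "smooth_bundle_map X A TX F \<Longrightarrow> a \<in> fibre A x \<Longrightarrow> F a \<in> fibre TX x"
  unfolding smooth_bundle_map_def fibre_def[of A] by auto

lemma sscale_sscale:
  assumes U: "Opn U" and V: "V \<in> \<Gamma> U"
  shows "sscale U f (sscale U g V) = sscale U (\<lambda>x. f x * g x) V"
  using fscaleR_fscaleR[OF in_base[OF U] section_fibre[OF V]] by (auto simp: sscale_def fun_eq_iff)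

lemma sscale_restrict: "U' \<subseteq> U \<Longrightarrow> sscale U' (\<lambda>_. k) (restrict V U') = restrict (sscale U (\<lambda>_. k) V) U'"
  by (auto simp: sscale_def fun_eq_iff)

text \<open>In bundle charts the multiplication by \<open>r\<close> is a bounded linear map, which preserves smoothness.\<close>

lemma smooth_bundle_map_rescale:
  assumes F: "smooth_bundle_map X A TX F"
    and G: "\<And>a. a \<in> vtotal A \<Longrightarrow> G a = fscaleR TX r (F a)"
  shows "smooth_bundle_map X A TX G"
  unfolding smooth_bundle_map_def
proof (intro conjI ballI allI)
  have fib: "a \<in> fibre A (vproj A a)" if "a \<in> vtotal A" for a using that by (simp add: fibre_def)
  have xT: "vproj A a \<in> T.base" if "a \<in> vtotal A" for a using vproj_base[OF that] T_base by simp
  note F_in = anchor_in[OF F fib]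
  have G_in: "G a \<in> fibre TX (vproj A a)" if "a \<in> vtotal A" for a
    using G[OF that] T.fscaleR_in[OF xT F_in] that by simp
  then show "G a \<in> fibre TX (vproj A a)" if "a \<in> vtotal A" for a using that .
  {
    fix a assume a: "a \<in> vtotal A"
    note x = vproj_base[OF a] and af = fib[OF a]
    show "G (fadd A a b) = fadd TX (G a) (G b)" if b: "b \<in> fibre A (vproj A a)" for b
    proof -
      have bt: "b \<in> vtotal A" "fadd A a b \<in> vtotal A" using b fadd_in[OF x af] by (auto simp: fibre_def)
      have "F (fadd A a b) = fadd TX (F a) (F b)" using F a b unfolding smooth_bundle_map_def by blast
      then show ?thesis
        using T.fscaleR_fadd[OF xT[OF a] F_in[OF a] anchor_in[OF F b]] G a bt by simp
    qed
    show "G (fscaleR A s a) = fscaleR TX s (G a)" for s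
    proof -
      have st: "fscaleR A s a \<in> vtotal A" using fscaleR_in[OF x af] by (auto simp: fibre_def)
      have "F (fscaleR A s a) = fscaleR TX s (F a)" using F a unfolding smooth_bundle_map_def by blast
      then show ?thesis
        using T.fscaleR_fscaleR[OF xT[OF a] F_in[OF a]] G a st by (simp add: mult.commute)
    qed
  }
  have sm: "smooth_map (total_atlas X A) (total_atlas X TX) (vtotal A) F"
    using F unfolding smooth_bundle_map_def by blast
  show "smooth_map (total_atlas X A) (total_atlas X TX) (vtotal A) G"
    unfolding smooth_map_def chart_map_def Let_def
  proof (intro conjI ballI)
    show "G ` vtotal A \<subseteq> points (total_atlas X TX)"
      using G_in by (auto simp: points_TX fibre_def)
    fix c d assume c: "c \<in> total_atlas X A" and "d \<in> total_atlas X TX"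
    then obtain c0 t0 c' t where d: "d = total_chart TX c' t" "c' \<in> charts X" "t \<in> vtrivs TX"
      and c0: "c = total_chart A c0 t0" "c0 \<in> charts X" "t0 \<in> vtrivs A"
      unfolding total_atlas_eq by blast
    let ?S = "snd c ` {m \<in> fst c \<inter> vtotal A. G m \<in> fst d}"
    have mem: "G m \<in> fst d \<longleftrightarrow> F m \<in> fst d" if m: "m \<in> vtotal A" for m
      using F_in[OF m] G_in[OF m] by (auto simp: d total_chart_def fibre_def)
    have S: "?S = snd c ` {m \<in> fst c \<inter> vtotal A. F m \<in> fst d}" using mem by (auto intro!: image_eqI)
    have F_sm: "open ?S" "smooth_on ?S (snd d \<circ> F \<circ> chart_inv c)"
      using sm c \<open>d \<in> total_atlas X TX\<close> unfolding S smooth_map_def chart_map_def Let_def by blast+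
    show "open ?S" by (rule F_sm(1))
    define B where "B = (\<lambda>p :: 'e \<times> 'e. (fst p, r *\<^sub>R snd p))"
    have B: "bounded_linear B" unfolding B_def
      by (intro bounded_linear_Pair bounded_linear_fst bounded_linear_const_scaleR bounded_linear_snd)
    have eq: "(snd d \<circ> G \<circ> chart_inv c) y = B ((snd d \<circ> F \<circ> chart_inv c) y)" if "y \<in> ?S" for y
    proof -
      obtain m where m: "m \<in> fst c" "m \<in> vtotal A" "F m \<in> fst d" "y = snd c m"
        using \<open>y \<in> ?S\<close> mem by blast
      have "chart_inv c y = m"
        using inj_total_chart[OF c0(3) M.inj[OF c0(2)]] m(1,4) c0(1) by simp
      moreover have "vproj A m \<in> fst t"
        using m(3) T.vproj_fibre[OF F_in[OF m(2)]] by (simp add: d total_chart_def)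
      moreover have "snd t (G m) = r *\<^sub>R snd t (F m)" if "vproj A m \<in> fst t"
        using T.triv_fscaleR[OF xT[OF m(2)] F_in[OF m(2)] d(3) that, of r] G[OF m(2)] by simp
      ultimately show ?thesis
        by (simp add: B_def d(1) T.snd_total_chart[OF F_in[OF m(2)]] T.snd_total_chart[OF G_in[OF m(2)]])
    qed
    show "smooth_on ?S (snd d \<circ> G \<circ> chart_inv c)"
      using smooth_on_cong[of ?S "snd d \<circ> G \<circ> chart_inv c" "\<lambda>y. B ((snd d \<circ> F \<circ> chart_inv c) y)", OF F_sm(1) eq]
        smooth_on_bounded_linear[OF F_sm(1) B F_sm(2)] by blast
  qed
qed

text \<open>The rescaled structure is the pull-back of \<open>L\<close> under the bundle endomorphism \<open>r\<close>: its anchor is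
  \<open>\<rho> \<circ> r\<close> and its bracket of \<open>V\<close> and \<open>W\<close> is \<open>[r V, W]\<close>, so that each axiom reduces to the same axiom
  of \<open>L\<close> for sections multiplied by \<open>r\<close>.\<close>

lemma real_lie_algebroid_rescale:
  assumes L: "real_lie_algebroid X A L"
    and anchor': "\<And>a. a \<in> vtotal A \<Longrightarrow> anchor L' a = fscaleR TX r (anchor L a)"
    and bracket': "\<And>U V W. Opn U \<Longrightarrow> V \<in> \<Gamma> U \<Longrightarrow> W \<in> \<Gamma> U \<Longrightarrow>
      bracket L' U V W = sscale U (\<lambda>_. r) (bracket L U V W)"
  shows "real_lie_algebroid X A L'"
  unfolding real_lie_algebroid_def
proof
  note F = real_lie_smooth_anchor[OF L]
  show "smooth_bundle_map X A TX (anchor L')"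
    by (rule smooth_bundle_map_rescale[OF F anchor'])
  show "lie_sheaf X A (fscaleR A) (\<Gamma>) (smooth_funs X) L'"
    unfolding real_lie_sheaf_iff
  proof (intro allI impI)
    fix U assume U: "Opn U"
        let ?s = "sscale U (\<lambda>_. r)" and ?br = "bracket L U" and ?br' = "bracket L' U"
    let ?neg = "sscale U (\<lambda>_. - 1)"
    have sc: "sscale U (\<lambda>_. k) V \<in> \<Gamma> U" if "V \<in> \<Gamma> U" for V k
      by (rule sscale_section[OF U const_smooth_fun[OF U] that])
    note br = real_lie_bracket_section[OF L U]
    note anti = derivation_bracketD(1)[OF real_lie_derivation_bracket[OF L U]]
    note cst = real_lie_bracket_const[OF L U]
    have cst1: "?br (sscale U (\<lambda>_. k) V) W = sscale U (\<lambda>_. k) (?br V W)" if V: "V \<in> \<Gamma> U" and W: "W \<in> \<Gamma> U" for V W k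
    proof -
      have "?br (sscale U (\<lambda>_. k) V) W = ?neg (sscale U (\<lambda>_. k) (?br W V))"
        using anti[OF sc[OF V] W] cst[OF W V] by simp
      also have "\<dots> = sscale U (\<lambda>_. k) (?neg (?br W V))"
        by (simp add: sscale_sscale[OF U br[OF W V]] mult.commute)
      also have "?neg (?br W V) = ?br V W" using anti[OF V W] by simp
      finally show ?thesis .
    qed
    have br': "?br' V W = ?br (?s V) W" if "V \<in> \<Gamma> U" "W \<in> \<Gamma> U" for V W
      using bracket'[OF U that] cst1[OF that] by simp
    have br'_in: "?br' V W \<in> \<Gamma> U" if "V \<in> \<Gamma> U" "W \<in> \<Gamma> U" for V W
      using br'[OF that] br[OF sc[OF that(1)] that(2)] by simp
    have act': "anchor_act X L' V f x = anchor_act X L (?s V) f x"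
      if V: "V \<in> \<Gamma> U" and x: "x \<in> U" for V x and f :: "'x \<Rightarrow> real"
    proof -
      have Vx: "V x \<in> vtotal A" using section_fibre[OF V x] by (simp add: fibre_def)
      have "anchor L (fscaleR A r (V x)) = fscaleR TX r (anchor L (V x))"
        using F Vx unfolding smooth_bundle_map_def by blast
      then show ?thesis using x anchor'[OF Vx] by (simp add: anchor_act_def sscale_def)
    qed
    show "lie_axioms U L'"
      unfolding lie_axioms_def derivation_bracket_def
    proof (intro conjI ballI allI impI; (elim conjE)?)
      fix V W assume V: "V \<in> \<Gamma> U" and W: "W \<in> \<Gamma> U"
      note sV = sc[OF V, of r] and sW = sc[OF W, of r]
      show "?br' V W = ?neg (?br' W V)"
        using anti[OF sV W] cst[OF W V] bracket'[OF U W V] br'[OF V W] by simp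
      show "?br' V W \<in> \<Gamma> U" by (rule br'_in[OF V W])
      show "?br' V (sscale U (\<lambda>_. k) W) = sscale U (\<lambda>_. k) (?br' V W)" for k
        using br'[OF V sc[OF W]] cst[OF sV W] br'[OF V W] by simp
      {
        fix Z assume Z: "Z \<in> \<Gamma> U"
        show "?br' V (sadd U W Z) = sadd U (?br' V W) (?br' V Z)"
          using derivation_bracketD(2)[OF real_lie_derivation_bracket[OF L U] sV W Z]
            br'[OF V sadd_section[OF U W Z]] br'[OF V W] br'[OF V Z] by simp
        have "?br' (?br' V W) Z = ?br (?br (?s V) (?s W)) Z"
          using br'[OF br'_in[OF V W] Z] br'[OF V W] cst[OF sV W] by simp
        then show "?br' V (?br' W Z) = sadd U (?br' (?br' V W) Z) (?br' W (?br' V Z))"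
          using br'[OF V br'_in[OF W Z]] br'[OF W br'_in[OF V Z]] br'[OF W Z] br'[OF V Z]
            real_lie_jacobi[OF L U sV sW Z] by simp
      next
        fix f assume f: "f \<in> smooth_funs X U"
        have "sscale U (anchor_act X L (?s V) f) W = sscale U (anchor_act X L' V f) W"
          using act'[OF V] by (simp add: sscale_def cong: restrict_cong)
        then show "?br' V (sscale U f W) = sadd U (sscale U (anchor_act X L' V f) W) (sscale U f (?br' V W))"
          using derivation_bracketD(3)[OF real_lie_derivation_bracket[OF L U] sV W f]
            br'[OF V sscale_section[OF U f W]] br'[OF V W] by simp
      next
        fix U' assume U': "Opn U'" "U' \<subseteq> U"
        show "bracket L' U' (restrict V U') (restrict W U') = restrict (?br' V W) U'"
          using bracket'[OF U'(1) restrict_section[OF U U' V] restrict_section[OF U U' W]]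
            real_lie_bracket_restrict[OF L U V W U'] sscale_restrict[OF U'(2)] bracket'[OF U V W] by simp
      next
        fix f x assume f: "f \<in> smooth_funs X U" and x: "x \<in> U"
        have act2: "anchor_act X L' V (anchor_act X L' W f) x =
            anchor_act X L (?s V) (anchor_act X L (?s W) f) x" if V: "V \<in> \<Gamma> U" and W: "W \<in> \<Gamma> U" for V W
        proof -
          have "dif (charts X) (anchor_act X L' W f) x = dif (charts X) (anchor_act X L (?s W) f) x"
            using act'[OF W] by (rule M.dif_cong_open[OF U x])
          then show ?thesis using act'[OF V x] by (simp add: anchor_act_def)
        qed
        have "anchor_act X L' (?br' V W) f x = anchor_act X L (?br (?s V) (?s W)) f x"
          using act'[OF br'_in[OF V W] x] br'[OF V W] cst[OF sV W] by simp
        then show "anchor_act X L' (?br' V W) f x =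
         anchor_act X L' V (anchor_act X L' W f) x - anchor_act X L' W (anchor_act X L' V f) x"
          using real_lie_anchor[OF L U sV sW f x] act2[OF V W] act2[OF W V] by simp
      }
    qed
  qed
qed

end

context hol_bundle
begin

lemma
  assumes U: "Opn U" and V: "V \<in> \<Gamma> U" and x: "x \<in> U"
    and t: "t \<in> vtrivs A" "x \<in> fst t"
  shows triv_sadd: "W \<in> \<Gamma> U \<Longrightarrow> snd t (sadd U V W x) = snd t (V x) + snd t (W x)"
    and triv_sscale: "snd t (sscale U f V x) = f x *\<^sub>R snd t (V x)"
    and triv_smulI: "snd t (smulI U V x) = fJ A (snd t (V x))"
  using x triv_fadd[OF in_base[OF U x] section_fibre[OF V x] _ t, of "W x"]
    section_fibre[of W U x]
    triv_fscaleR[OF in_base[OF U x] section_fibre[OF V x] t]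
    triv_fmulI[OF in_base[OF U x] section_fibre[OF V x] t]
  by (simp_all add: sadd_def sscale_def smulI_def)

lemma section_eqI:
  assumes U: "Opn U" and V: "V \<in> \<Gamma> U" and W: "W \<in> \<Gamma> U"
    and eq: "\<And>x t. x \<in> U \<Longrightarrow> t \<in> vtrivs A \<Longrightarrow> x \<in> fst t \<Longrightarrow> snd t (V x) = snd t (W x)"
  shows "V = W"
proof (rule extensionalityI[OF section_extensional[OF V] section_extensional[OF W]])
  fix x assume x: "x \<in> U"
  obtain t where t: "t \<in> vtrivs A" "x \<in> fst t" using triv_at[OF in_base[OF U x]] by blast
  show "V x = W x"
    by (rule triv_eqI[OF t section_fibre[OF V x] section_fibre[OF W x] eq[OF x t]])
qed

text \<open>Brackets commute with restriction, so that equality may be checked near each point, over a set on which \<open>A\<close>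
  is trivial.\<close>

lemma brackets_agree:
  assumes restrict1: "\<And>U U' V W. Opn U \<Longrightarrow> Opn U' \<Longrightarrow> U' \<subseteq> U \<Longrightarrow> V \<in> \<Gamma> U \<Longrightarrow>
      W \<in> \<Gamma> U \<Longrightarrow> br1 U' (restrict V U') (restrict W U') = restrict (br1 U V W) U'"
    and restrict2: "\<And>U U' V W. Opn U \<Longrightarrow> Opn U' \<Longrightarrow> U' \<subseteq> U \<Longrightarrow> V \<in> \<Gamma> U \<Longrightarrow>
      W \<in> \<Gamma> U \<Longrightarrow> br2 U' (restrict V U') (restrict W U') = restrict (br2 U V W) U'"
    and derivation: "\<And>U. Opn U \<Longrightarrow> derivation_bracket U act (br1 U)"
      "\<And>U. Opn U \<Longrightarrow> derivation_bracket U act (br2 U)"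
    and in_sections: "\<And>U V W. Opn U \<Longrightarrow> V \<in> \<Gamma> U \<Longrightarrow> W \<in> \<Gamma> U \<Longrightarrow>
      br1 U V W \<in> \<Gamma> U"
      "\<And>U V W. Opn U \<Longrightarrow> V \<in> \<Gamma> U \<Longrightarrow> W \<in> \<Gamma> U \<Longrightarrow>
      br2 U V W \<in> \<Gamma> U"
    and const: "\<And>U t b b'. Opn U \<Longrightarrow> t \<in> vtrivs A \<Longrightarrow> U \<subseteq> fst t \<Longrightarrow>
      br1 U (const_section U t b) (const_section U t b') = br2 U (const_section U t b) (const_section U t b')"
    and U: "Opn U" and V: "V \<in> \<Gamma> U" and W: "W \<in> \<Gamma> U"
  shows "br1 U V W = br2 U V W"
proof (rule extensionalityI)
  show "br1 U V W \<in> extensional U" "br2 U V W \<in> extensional U"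
    using in_sections section_extensional U V W by blast+
  fix x assume x: "x \<in> U"
  obtain t where t: "t \<in> vtrivs A" "x \<in> fst t" using triv_at[OF in_base[OF U x]] by blast
  let ?U = "U \<inter> fst t"
  have U': "Opn ?U" "?U \<subseteq> U" "?U \<subseteq> fst t" using openin_Int[OF U Opn_triv[OF t(1)]] by auto
  have "br1 ?U (restrict V ?U) (restrict W ?U) = br2 ?U (restrict V ?U) (restrict W ?U)"
    by (rule derivation_brackets_agree[OF U'(1) t(1) U'(3) derivation(1)[OF U'(1)] derivation(2)[OF U'(1)]
        const[OF U'(1) t(1) U'(3)] restrict_section[OF U U'(1,2) V] restrict_section[OF U U'(1,2) W]])
  then have "restrict (br1 U V W) ?U = restrict (br2 U V W) ?U"
    using restrict1[OF U U'(1,2) V W] restrict2[OF U U'(1,2) V W] by simp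
  then have "restrict (br1 U V W) ?U x = restrict (br2 U V W) ?U x" by simp
  then show "br1 U V W x = br2 U V W x" using x t by simp
qed

section \<open>The imaginary Lie algebroid\<close>

lemma imaginary_bracket:
  "bracket (imaginary_algd A R) U V W =
    sadd U (sadd U (bracket R U (smulI U V) W) (bracket R U V (smulI U W)))
      (sscale U (\<lambda>_. - 1) (smulI U (bracket R U V W)))"
  by (simp add: imaginary_algd_def Let_def sadd_def sscale_def smulI_def fun_eq_iff restrict_def)

lemma smulI_restrict: "U' \<subseteq> U \<Longrightarrow> smulI U' (restrict V U') = restrict (smulI U V) U'"
  by (auto simp: smulI_def fun_eq_iff)

lemma sadd_restrict: "U' \<subseteq> U \<Longrightarrow> sadd U' (restrict V U') (restrict W U') = restrict (sadd U V W) U'"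
  by (auto simp: sadd_def fun_eq_iff)

lemma imaginary_anchor_act:
  assumes "x \<in> U"
  shows "anchor_act X (imaginary_algd A R) V f x = anchor_act X R (smulI U V) f x"
  using assms by (simp add: anchor_act_def imaginary_algd_def smulI_def)

context
  fixes R assumes R: "real_lie_algebroid X A R"
begin

lemma imaginary_bracket_section:
  assumes U: "Opn U" and V: "V \<in> \<Gamma> U" and W: "W \<in> \<Gamma> U"
  shows "bracket (imaginary_algd A R) U V W \<in> \<Gamma> U"
  unfolding imaginary_bracket
  by (intro sadd_section sscale_section const_smooth_fun smulI_section real_lie_bracket_section[OF R] U V W)

lemma imaginary_bracket_restrict:
  assumes U: "Opn U" and U': "Opn U'" "U' \<subseteq> U"
    and V: "V \<in> \<Gamma> U" and W: "W \<in> \<Gamma> U"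
  shows "bracket (imaginary_algd A R) U' (restrict V U') (restrict W U') =
    restrict (bracket (imaginary_algd A R) U V W) U'"
  unfolding imaginary_bracket smulI_restrict[OF U'(2)]
    real_lie_bracket_restrict[OF R U V W U']
    real_lie_bracket_restrict[OF R U smulI_section[OF U V] W U']
    real_lie_bracket_restrict[OF R U V smulI_section[OF U W] U']
    sscale_restrict[OF U'(2)] sadd_restrict[OF U'(2)] ..

lemma triv_imaginary_bracket:
  assumes U: "Opn U" and V: "V \<in> \<Gamma> U" and W: "W \<in> \<Gamma> U"
    and x: "x \<in> U" and t: "t \<in> vtrivs A" "x \<in> fst t"
  shows "snd t (bracket (imaginary_algd A R) U V W x) =
    snd t (bracket R U (smulI U V) W x) + snd t (bracket R U V (smulI U W) x) - fJ A (snd t (bracket R U V W x))"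
proof -
  note br = real_lie_bracket_section[OF R U]
  have 1: "bracket R U (smulI U V) W \<in> \<Gamma> U" by (intro br smulI_section U V W)
  have 2: "bracket R U V (smulI U W) \<in> \<Gamma> U" by (intro br smulI_section U V W)
  have 3: "smulI U (bracket R U V W) \<in> \<Gamma> U" by (intro br smulI_section U V W)
  have 4: "sscale U (\<lambda>_. - 1) (smulI U (bracket R U V W)) \<in> \<Gamma> U"
    by (rule sscale_section[OF U const_smooth_fun[OF U] 3])
  show ?thesis
    unfolding imaginary_bracket
    by (simp add: triv_sadd[OF U sadd_section[OF U 1 2] x t 4] triv_sadd[OF U 1 x t 2]
        triv_sscale[OF U 3 x t] triv_smulI[OF U br[OF V W] x t])
qed

text \<open>The identities are checked in the components of a trivialization.  In the Leibniz rule, the term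
  \<open>\<rho>(V)f j W\<close> produced by \<open>[V, j (f W)]\<close> cancels against the one produced by \<open>- j [V, f W]\<close>; what remains is
  \<open>\<rho>(j V)f W\<close>, as the anchor \<open>\<rho> \<circ> j\<close> requires.\<close>

lemma imaginary_derivation_bracket:
  assumes U: "Opn U"
  shows "derivation_bracket U (anchor_act X (imaginary_algd A R)) (bracket (imaginary_algd A R) U)"
  unfolding derivation_bracket_def
proof (intro ballI conjI)
  fix V W assume V: "V \<in> \<Gamma> U" and W: "W \<in> \<Gamma> U"
  let ?I = "bracket (imaginary_algd A R) U"
  note br = real_lie_bracket_section[OF R U]
  note D = derivation_bracketD[OF real_lie_derivation_bracket[OF R U]]
  note I_in = imaginary_bracket_section[OF U] and I = triv_imaginary_bracket[OF U]
  note jV = smulI_section[OF U V] and jW = smulI_section[OF U W]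
  interpret J: linear "fJ A" by (rule fJ_linear)
  note J_simps = J.add J.scaleR J.neg J.diff
  have cs: "sscale U (\<lambda>_. k) Z \<in> \<Gamma> U" if "Z \<in> \<Gamma> U" for Z k
    by (rule sscale_section[OF U const_smooth_fun[OF U] that])
  show "?I V W = sscale U (\<lambda>_. - 1) (?I W V)"
  proof (rule section_eqI[OF U I_in[OF V W] cs[OF I_in[OF W V]]])
    fix x t assume x: "x \<in> U" and t: "t \<in> vtrivs A" "x \<in> fst t"
    have anti: "snd t (bracket R U V W x) = - snd t (bracket R U W V x)"
      if "V \<in> \<Gamma> U" "W \<in> \<Gamma> U" for V W
      using D(1)[OF that] triv_sscale[OF U br[OF that(2,1)] x t, of "\<lambda>_. - 1"] by simp
    show "snd t (?I V W x) = snd t (sscale U (\<lambda>_. - 1) (?I W V) x)"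
      unfolding triv_sscale[OF U I_in[OF W V] x t] I[OF V W x t] I[OF W V x t]
        anti[OF V W] anti[OF jV W] anti[OF V jW] by (simp add: J_simps)
  qed
  {
    fix Z assume Z: "Z \<in> \<Gamma> U"
    note jZ = smulI_section[OF U Z]
    note WZ = sadd_section[OF U W Z]
    have j: "smulI U (sadd U W Z) = sadd U (smulI U W) (smulI U Z)"
    proof (rule section_eqI[OF U smulI_section[OF U WZ] sadd_section[OF U jW jZ]])
      fix x t assume x: "x \<in> U" and t: "t \<in> vtrivs A" "x \<in> fst t"
      show "snd t (smulI U (sadd U W Z) x) = snd t (sadd U (smulI U W) (smulI U Z) x)"
        unfolding triv_smulI[OF U WZ x t] triv_sadd[OF U W x t Z] triv_sadd[OF U jW x t jZ]
          triv_smulI[OF U W x t] triv_smulI[OF U Z x t] by (simp add: J_simps)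
    qed
    show "?I V (sadd U W Z) = sadd U (?I V W) (?I V Z)"
    proof (rule section_eqI[OF U I_in[OF V WZ] sadd_section[OF U I_in[OF V W] I_in[OF V Z]]])
      fix x t assume x: "x \<in> U" and t: "t \<in> vtrivs A" "x \<in> fst t"
      have add: "snd t (bracket R U V (sadd U W Z) x) = snd t (bracket R U V W x) + snd t (bracket R U V Z x)"
        if "V \<in> \<Gamma> U" "W \<in> \<Gamma> U" "Z \<in> \<Gamma> U" for V W Z
        using D(2)[OF that] triv_sadd[OF U br[OF that(1,2)] x t br[OF that(1,3)]] by simp
      show "snd t (?I V (sadd U W Z) x) = snd t (sadd U (?I V W) (?I V Z) x)"
        unfolding triv_sadd[OF U I_in[OF V W] x t I_in[OF V Z]] I[OF V WZ x t] I[OF V W x t] I[OF V Z x t]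
          j add[OF V W Z] add[OF jV W Z] add[OF V jW jZ] by (simp add: J_simps)
    qed
  next
    fix f assume f: "f \<in> smooth_funs X U"
    let ?act = "anchor_act X (imaginary_algd A R)"
    note fW = sscale_section[OF U f W] and fjW = sscale_section[OF U f jW]
    have j: "smulI U (sscale U f W) = sscale U f (smulI U W)"
    proof (rule section_eqI[OF U smulI_section[OF U fW] fjW])
      fix x t assume x: "x \<in> U" and t: "t \<in> vtrivs A" "x \<in> fst t"
      show "snd t (smulI U (sscale U f W) x) = snd t (sscale U f (smulI U W) x)"
        unfolding triv_smulI[OF U fW x t] triv_sscale[OF U W x t] triv_sscale[OF U jW x t]
          triv_smulI[OF U W x t] by (simp add: J_simps)
    qed
    have val: "snd t (sadd U (sscale U g W) (sscale U f Z) x) = g x *\<^sub>R snd t (W x) + f x *\<^sub>R snd t (Z x)"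
      if x: "x \<in> U" and t: "t \<in> vtrivs A" "x \<in> fst t" and W: "W \<in> \<Gamma> U" and Z: "Z \<in> \<Gamma> U" for x t g W Z
    proof -
      note b = in_base[OF U x] and Wx = section_fibre[OF W x] and Zx = section_fibre[OF Z x]
      show ?thesis
        using x triv_fadd[OF b fscaleR_in[OF b Wx] fscaleR_in[OF b Zx] t]
          triv_fscaleR[OF b Wx t] triv_fscaleR[OF b Zx t] by (simp add: sadd_def sscale_def)
    qed
    show "?I V (sscale U f W) = sadd U (sscale U (?act V f) W) (sscale U f (?I V W))"
    proof (rule extensionalityI[of _ U])
      show "?I V (sscale U f W) \<in> extensional U" by (rule section_extensional[OF I_in[OF V fW]])
      show "sadd U (sscale U (?act V f) W) (sscale U f (?I V W)) \<in> extensional U" by (simp add: sadd_def)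
      fix x assume x: "x \<in> U"
      note b = in_base[OF U x]
      obtain t where t: "t \<in> vtrivs A" "x \<in> fst t" using triv_at[OF b] by blast
      have leib: "snd t (bracket R U V (sscale U f W) x) =
          anchor_act X R V f x *\<^sub>R snd t (W x) + f x *\<^sub>R snd t (bracket R U V W x)"
        if "V \<in> \<Gamma> U" "W \<in> \<Gamma> U" for V W
        using D(3)[OF that f] val[OF x t that(2) br[OF that]] by simp
      show "?I V (sscale U f W) x = sadd U (sscale U (?act V f) W) (sscale U f (?I V W)) x"
      proof (rule triv_eqI[OF t section_fibre[OF I_in[OF V fW] x]])
        show "sadd U (sscale U (?act V f) W) (sscale U f (?I V W)) x \<in> fibre A x"
          using x fadd_in[OF b fscaleR_in[OF b section_fibre[OF W x]]] by (simp add: sadd_def sscale_def)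
        show "snd t (?I V (sscale U f W) x) = snd t (sadd U (sscale U (?act V f) W) (sscale U f (?I V W)) x)"
          unfolding val[OF x t W I_in[OF V W]] I[OF V fW x t] I[OF V W x t] j
            leib[OF V W] leib[OF jV W] leib[OF V jW] imaginary_anchor_act[OF x] triv_smulI[OF U W x t]
          by (simp add: J_simps algebra_simps)
      qed
    qed
  }
qed

end

section \<open>Isomorphisms over the identity\<close>

lemma total_chart_inter:
  "fst (total_chart A c t) \<inter> fst (total_chart A d u) = (\<Union>x\<in>fst c \<inter> fst t \<inter> (fst d \<inter> fst u). fibre A x)"
  by (auto simp: total_chart_def fibre_def)

text \<open>The coordinate changes of the total space are smooth: in the fibre variable they are linear, so they
  are finite sums of coordinates times smooth functions of the base point.\<close>

lemma id_smooth_bundle_map: "smooth_bundle_map X A A (\<lambda>a. a)"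
  unfolding smooth_bundle_map_def
proof (intro conjI ballI allI)
  show "a \<in> fibre A (vproj A a)" if "a \<in> vtotal A" for a using that by (simp add: fibre_def)
  show "smooth_map (total_atlas X A) (total_atlas X A) (vtotal A) (\<lambda>a. a)"
    unfolding smooth_map_def chart_map_def Let_def
  proof (intro conjI ballI)
    show "(\<lambda>a. a) ` vtotal A \<subseteq> points (total_atlas X A)" by (simp add: points_A)
    fix e e' assume "e \<in> total_atlas X A" "e' \<in> total_atlas X A"
    then obtain c t d u where e: "e = total_chart A c t" "c \<in> charts X" "t \<in> vtrivs A"
      and e': "e' = total_chart A d u" "d \<in> charts X" "u \<in> vtrivs A"
      unfolding total_atlas_eq by blast
    define W where "W = fst c \<inter> fst t \<inter> (fst d \<inter> fst u)"
    have Wt: "W \<subseteq> fst t" by (auto simp: W_def)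
    have eqW: "{m \<in> fst e \<inter> vtotal A. m \<in> fst e'} = (\<Union>x\<in>W. fibre A x)"
      unfolding W_def total_chart_inter[symmetric] e(1) e'(1) by (auto simp: total_chart_def)
    have S: "snd e ` {m \<in> fst e \<inter> vtotal A. m \<in> fst e'} = (snd c ` W) \<times> UNIV"
      unfolding eqW using total_chart_image[OF e(3) Wt, of c] by (simp add: e(1))
    have W_eq: "W = fst c \<inter> (fst d \<inter> fst u) \<inter> fst t" by (auto simp: W_def)
    have op: "open (snd c ` W)"
      unfolding W_eq by (rule Opn_image_triv[OF openin_Int[OF M.openin_chart[OF e'(2)] Opn_triv[OF e'(3)]] e(2,3)])
    then have opS: "open ((snd c ` W) \<times> (UNIV :: 'f set))" by (simp add: open_Times)
    then show "open (snd e ` {m \<in> fst e \<inter> vtotal A. m \<in> fst e'})" unfolding S .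
    obtain B :: "'f set" and \<kappa> where B: "finite B" "\<And>b. bounded_linear (\<kappa> b :: 'f \<Rightarrow> real)"
      "\<And>v. (\<Sum>b\<in>B. \<kappa> b v *\<^sub>R b) = v"
      by (rule finite_dim_coordinates[OF complex_fin_dim_basis[OF fin_dim_A]]) blast
    define h where "h b y = snd u (tinv t (chart_inv c y) b)" for b y
    have h: "smooth_on (snd c ` W) (h b)" for b
      unfolding h_def
      by (rule smooth_on_subset[OF _ conjunct1[OF triv_transition_hol[OF e(3) e'(3) e(2), unfolded hol_on_iff]]])
        (auto simp: W_def)
    have tr: "smooth_on (snd c ` W) (snd d \<circ> chart_inv c)"
      by (rule smooth_on_subset[OF _ conjunct1[OF chart_transition_hol[OF e(2) e'(2), unfolded hol_on_iff]]])
        (auto simp: W_def)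
    define r where "r p = ((snd d \<circ> chart_inv c) (fst p), \<Sum>b\<in>B. \<kappa> b (snd p) *\<^sub>R h b (fst p))" for p
    have "smooth_on ((snd c ` W) \<times> UNIV) r"
      unfolding r_def
      by (intro smooth_on_Pair[OF opS] smooth_on_sum[OF opS] smooth_on_scaleR[OF opS]
          smooth_on_compose_fst[OF op] tr h smooth_on_linear
          bounded_linear_compose[OF B(2) bounded_linear_snd])
    moreover have "r p = (snd e' \<circ> (\<lambda>a. a) \<circ> chart_inv e) p" if p: "p \<in> (snd c ` W) \<times> UNIV" for p
    proof -
      obtain x v where x: "x \<in> W" "p = (snd c x, v)" using p by auto
      have xs: "x \<in> fst c" "x \<in> fst t" "x \<in> fst d" "x \<in> fst u" using x(1) by (auto simp: W_def)
      let ?\<tau> = "tinv t x"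
      have lin: "linear (\<lambda>v. snd u (?\<tau> v))" by (rule triv_linear[OF e(3) e'(3) xs(2,4)])
      have "snd u (?\<tau> v) = snd u (?\<tau> (\<Sum>b\<in>B. \<kappa> b v *\<^sub>R b))" by (simp add: B(3))
      also have "\<dots> = (\<Sum>b\<in>B. \<kappa> b v *\<^sub>R snd u (?\<tau> b))"
        using linear_sum[OF lin, of "\<lambda>b. \<kappa> b v *\<^sub>R b" B] linear_scale[OF lin] by simp
      finally have val: "snd u (?\<tau> v) = (\<Sum>b\<in>B. \<kappa> b v *\<^sub>R snd u (?\<tau> b))" .
      have "(snd e' \<circ> (\<lambda>a. a) \<circ> chart_inv e) p = (snd d x, snd u (?\<tau> v))"
        using total_chart_inv(2)[OF e(3) M.inj[OF e(2)] xs(1,2), of v]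
          snd_total_chart[OF triv_inv_in[OF e(3) xs(2)], of d u v] by (simp add: e(1) e'(1) x(2))
      then show ?thesis using M.chart_inv[OF e(2) xs(1)] by (simp add: r_def h_def x(2) val)
    qed
    ultimately show "smooth_on (snd e ` {m \<in> fst e \<inter> vtotal A. m \<in> fst e'}) (snd e' \<circ> (\<lambda>a. a) \<circ> chart_inv e)"
      unfolding S using smooth_on_cong[of _ r "snd e' \<circ> (\<lambda>a. a) \<circ> chart_inv e", OF opS] by blast
  qed
qed auto

lemma lie_algebroid_isomorphic_if_eq:
  assumes L: "real_lie_algebroid X A L" "real_lie_algebroid X A L'"
    and anchor: "\<And>a. a \<in> vtotal A \<Longrightarrow> anchor L' a = anchor L a"
    and bracket: "\<And>U V W. Opn U \<Longrightarrow> V \<in> \<Gamma> U \<Longrightarrow> W \<in> \<Gamma> U \<Longrightarrow>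
      bracket L' U V W = bracket L U V W"
  shows "lie_algebroid_isomorphic X A L A L'"
  unfolding lie_algebroid_isomorphic_def
proof (intro conjI exI[of _ "\<lambda>a. a"] L id_smooth_bundle_map)
  have ext: "(\<lambda>x\<in>U. V x) = V" if "V \<in> \<Gamma> U" for U V
    using section_extensional[OF that] extensional_restrict by blast
  show "\<forall>U. Opn U \<longrightarrow> (\<forall>V\<in>\<Gamma> U. \<forall>W\<in>\<Gamma> U.
      bracket L' U (\<lambda>x\<in>U. V x) (\<lambda>x\<in>U. W x) = (\<lambda>x\<in>U. bracket L U V W x))"
    using bracket ext real_lie_bracket_section[OF L(1)] by simp
qed (use anchor in auto)

end

section \<open>Derivatives in the charts of the dual bundles\<close>

lemma cdiff_on_compose_fst:
  assumes "cdiff_on J L S f"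
  shows "cdiff_on (map_prod J K) L (S \<times> UNIV) (\<lambda>p. f (fst p))"
proof (rule cdiff_onI)
  fix p assume "p \<in> S \<times> (UNIV :: 'c set)"
  then have p: "fst p \<in> S" by auto
  show "((\<lambda>p. f (fst p)) has_derivative (\<lambda>q. frechet_derivative f (at (fst p)) (fst q))) (at p)"
    by (rule has_derivative_compose[OF has_derivative_fst[OF has_derivative_ident] cdiff_onD(1)[OF assms p]])
  show "frechet_derivative f (at (fst p)) (fst (map_prod J K q)) =
      L (frechet_derivative f (at (fst p)) (fst q))" for q
    using cdiff_onD(2)[OF assms p] by simp
qed

lemma has_derivative_blinfun_pairing:
  assumes "(s has_derivative s') (at (fst p))"
  shows "((\<lambda>p. blinfun_apply (snd p) (s (fst p))) has_derivative
    (\<lambda>q. blinfun_apply (snd p) (s' (fst q)) + blinfun_apply (snd q) (s (fst p)))) (at p)"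
  by (rule bounded_bilinear.FDERIV[OF bounded_bilinear_blinfun_apply
        has_derivative_snd[OF has_derivative_ident]
        has_derivative_compose[OF has_derivative_fst[OF has_derivative_ident] assms]])

abbreviation dualJ :: "('f::real_normed_vector \<Rightarrow> 'f) \<Rightarrow> ('f \<Rightarrow>\<^sub>L real) \<Rightarrow> ('f \<Rightarrow>\<^sub>L real)" where
  "dualJ K \<equiv> \<lambda>\<alpha>. \<alpha> o\<^sub>L Blinfun K"

lemma cdiff_on_pairing:
  fixes s :: "'e::real_normed_vector \<Rightarrow> 'f::real_normed_vector"
  assumes s: "cdiff_on J K S s" and K: "bounded_linear K" "\<And>v. K (K v) = - v"
  shows "cdiff_on (map_prod J (dualJ K)) ((*) \<i>) (S \<times> UNIV)
    (\<lambda>p. complexify K (blinfun_apply (snd p)) (s (fst p)))"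
proof (rule cdiff_onI)
  fix p assume "p \<in> S \<times> (UNIV :: ('f \<Rightarrow>\<^sub>L real) set)"
  then have p: "fst p \<in> S" by auto
  let ?s' = "frechet_derivative s (at (fst p))"
  note s' = cdiff_onD(1)[OF s p]
  have Ks': "((\<lambda>y. K (s y)) has_derivative (\<lambda>v. K (?s' v))) (at (fst p))"
    by (rule bounded_linear.has_derivative[OF K(1) s'])
  show "((\<lambda>p. complexify K (blinfun_apply (snd p)) (s (fst p))) has_derivative
    (\<lambda>q. of_real (blinfun_apply (snd p) (?s' (fst q)) + blinfun_apply (snd q) (s (fst p))) -
      \<i> * of_real (blinfun_apply (snd p) (K (?s' (fst q))) + blinfun_apply (snd q) (K (s (fst p)))))) (at p)"
    unfolding complexify_def
    by (intro has_derivative_diff has_derivative_mult_right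
        bounded_linear.has_derivative[OF bounded_linear_of_real] has_derivative_blinfun_pairing s' Ks')
  show "of_real (blinfun_apply (snd p) (?s' (fst (map_prod J (dualJ K) q))) +
        blinfun_apply (snd (map_prod J (dualJ K) q)) (s (fst p))) -
      \<i> * of_real (blinfun_apply (snd p) (K (?s' (fst (map_prod J (dualJ K) q)))) +
        blinfun_apply (snd (map_prod J (dualJ K) q)) (K (s (fst p)))) =
    \<i> * (of_real (blinfun_apply (snd p) (?s' (fst q)) + blinfun_apply (snd q) (s (fst p))) -
      \<i> * of_real (blinfun_apply (snd p) (K (?s' (fst q))) + blinfun_apply (snd q) (K (s (fst p)))))" for q
    using cdiff_onD(2)[OF s p]
    by (simp add: K bounded_linear_Blinfun_apply[OF K(1)] blinfun.minus_right algebra_simps)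
qed

text \<open>The coordinate change of the dual bundle is \<open>\<alpha> \<mapsto> \<alpha> \<circ> g\<close> for the coordinate change \<open>g\<close> of the bundle.
  It is differentiable because it is a finite sum of pairings times fixed functionals; its
  derivative can then be computed on each vector separately.\<close>

lemma cdiff_on_dual_transition:
  fixes g :: "'e::real_normed_vector \<Rightarrow> 'f::real_normed_vector \<Rightarrow> 'f"
  assumes fin: "\<exists>B::'f set. finite B \<and> span B = UNIV" and K: "bounded_linear K" and S: "open S"
    and g: "\<And>v. cdiff_on J K S (\<lambda>y. g y v)" and lin: "\<And>y. y \<in> S \<Longrightarrow> linear (g y)"
    and gK: "\<And>y v. y \<in> S \<Longrightarrow> g y (K v) = K (g y v)"
  shows "cdiff_on (map_prod J (dualJ K)) (dualJ K) (S \<times> (UNIV :: ('f \<Rightarrow>\<^sub>L real) set))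
    (\<lambda>p. Blinfun (\<lambda>v. blinfun_apply (snd p) (g (fst p) v)))"
proof -
  obtain B :: "'f set" and \<kappa> where B: "finite B" "\<And>b. bounded_linear (\<kappa> b :: 'f \<Rightarrow> real)"
    "\<And>v. (\<Sum>b\<in>B. \<kappa> b v *\<^sub>R b) = v" by (rule finite_dim_coordinates[OF fin]) blast
  define \<beta> where "\<beta> b = Blinfun (\<kappa> b)" for b
  have \<beta>: "blinfun_apply (\<beta> b) v = \<kappa> b v" for b v
    unfolding \<beta>_def using bounded_linear_Blinfun_apply[OF B(2)] by simp
  define g' where "g' y v = frechet_derivative (\<lambda>y. g y v) (at y)" for y v
  define D where "D p q = (\<Sum>b\<in>B. (blinfun_apply (snd p) (g' (fst p) b (fst q)) +
      blinfun_apply (snd q) (g (fst p) b)) *\<^sub>R \<beta> b)" for p q :: "'e \<times> ('f \<Rightarrow>\<^sub>L real)"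
  have opS: "open (S \<times> (UNIV :: ('f \<Rightarrow>\<^sub>L real) set))" using S by (simp add: open_Times)
  have expand: "g y v = (\<Sum>b\<in>B. \<kappa> b v *\<^sub>R g y b)" if y: "y \<in> S" for y v
  proof -
    have "g y v = g y (\<Sum>b\<in>B. \<kappa> b v *\<^sub>R b)" by (simp add: B(3))
    then show ?thesis by (simp add: linear_sum[OF lin[OF y]] linear_scale[OF lin[OF y]])
  qed
  have g': "((\<lambda>y. g y v) has_derivative g' y v) (at y)" if y: "y \<in> S" for y v
    unfolding g'_def by (rule cdiff_onD(1)[OF g y])
  have g'_expand: "g' y v w = (\<Sum>b\<in>B. \<kappa> b v *\<^sub>R g' y b w)" if y: "y \<in> S" for y v w
  proof -
    have "((\<lambda>y. \<Sum>b\<in>B. \<kappa> b v *\<^sub>R g y b) has_derivative (\<lambda>w. \<Sum>b\<in>B. \<kappa> b v *\<^sub>R g' y b w)) (at y)"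
      by (intro has_derivative_sum has_derivative_scaleR_right g' y)
    then have "((\<lambda>y. g y v) has_derivative (\<lambda>w. \<Sum>b\<in>B. \<kappa> b v *\<^sub>R g' y b w)) (at y)"
      by (rule iffD2[OF has_derivative_cong_open[OF S y], rotated]) (rule expand)
    then show ?thesis using has_derivative_unique[OF g'[OF y]] by metis
  qed
  have g'_K: "g' y (K v) w = K (g' y v w)" if y: "y \<in> S" for y v w
  proof -
    have "((\<lambda>y. K (g y v)) has_derivative (\<lambda>w. K (g' y v w))) (at y)"
      by (rule bounded_linear.has_derivative[OF K g'[OF y]])
    then have "((\<lambda>y. g y (K v)) has_derivative (\<lambda>w. K (g' y v w))) (at y)"
      by (rule iffD2[OF has_derivative_cong_open[OF S y], rotated]) (rule gK)
    then show ?thesis using has_derivative_unique[OF g'[OF y]] by metis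
  qed
  have D_apply: "blinfun_apply (D p q) v =
      blinfun_apply (snd p) (g' (fst p) v (fst q)) + blinfun_apply (snd q) (g (fst p) v)"
    if y: "fst p \<in> S" for p q v
    unfolding D_def g'_expand[OF y, of v] expand[OF y, of v]
    by (simp add: blinfun.sum_left blinfun.sum_right blinfun.scaleR_left blinfun.scaleR_right
        blinfun.add_left \<beta> algebra_simps sum.distrib)
  have eq: "(\<Sum>b\<in>B. blinfun_apply (snd p) (g (fst p) b) *\<^sub>R \<beta> b) =
      Blinfun (\<lambda>v. blinfun_apply (snd p) (g (fst p) v))" if "p \<in> S \<times> UNIV" for p
  proof -
    have y: "fst p \<in> S" using that by auto
    have "blinfun_apply (\<Sum>b\<in>B. blinfun_apply (snd p) (g (fst p) b) *\<^sub>R \<beta> b) v =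
        blinfun_apply (snd p) (g (fst p) v)" for v
      unfolding expand[OF y, of v]
      by (simp add: blinfun.sum_left blinfun.sum_right blinfun.scaleR_left blinfun.scaleR_right \<beta>
          mult.commute)
    then have "(\<lambda>v. blinfun_apply (snd p) (g (fst p) v)) =
        blinfun_apply (\<Sum>b\<in>B. blinfun_apply (snd p) (g (fst p) b) *\<^sub>R \<beta> b)" by (simp add: fun_eq_iff)
    then show ?thesis by (simp only: blinfun_apply_inverse)
  qed
  have "cdiff_on (map_prod J (dualJ K)) (dualJ K) (S \<times> UNIV)
      (\<lambda>p. \<Sum>b\<in>B. blinfun_apply (snd p) (g (fst p) b) *\<^sub>R \<beta> b)"
  proof (rule cdiff_onI)
    fix p assume "p \<in> S \<times> (UNIV :: ('f \<Rightarrow>\<^sub>L real) set)"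
    then have y: "fst p \<in> S" by auto
    show "((\<lambda>p. \<Sum>b\<in>B. blinfun_apply (snd p) (g (fst p) b) *\<^sub>R \<beta> b) has_derivative D p) (at p)"
      unfolding D_def
      by (intro has_derivative_sum has_derivative_scaleR_left has_derivative_blinfun_pairing g' y)
    show "D p (map_prod J (dualJ K) q) = D p q o\<^sub>L Blinfun K" for q
    proof (rule blinfun_eqI)
      fix v
      have "g' (fst p) v (J w) = K (g' (fst p) v w)" for w
        unfolding g'_def using cdiff_onD(2)[OF g y] by simp
      then show "blinfun_apply (D p (map_prod J (dualJ K) q)) v =
          blinfun_apply (D p q o\<^sub>L Blinfun K) v"
        by (simp add: D_apply[OF y] bounded_linear_Blinfun_apply[OF K] g'_K[OF y] gK[OF y])
    qed
  qed
  then show ?thesis by (rule cdiff_on_eq[OF _ opS]) (rule eq)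
qed

section \<open>The dual bundles\<close>

context complex_fibres
begin

lemma
  assumes t: "t \<in> vtrivs A" "x \<in> fst t"
  shows triv_inv_add: "tinv t x (v + w) =
      fadd A (tinv t x v) (tinv t x w)"
    and triv_inv_scaleR: "tinv t x (r *\<^sub>R v) = fscaleR A r (tinv t x v)"
    and triv_inv_J: "tinv t x (fJ A v) = fmulI A (tinv t x v)"
proof -
  note x = baseI[OF t] and i = triv_inv_in[OF t] and r = triv_inv_right[OF t]
  show "tinv t x (v + w) =
      fadd A (tinv t x v) (tinv t x w)"
    by (rule triv_eqI[OF t i fadd_in[OF x i]]) (simp add: r triv_fadd[OF x i i t])
  show "tinv t x (r *\<^sub>R v) = fscaleR A r (tinv t x v)"
    by (rule triv_eqI[OF t i fscaleR_in[OF x i]]) (simp add: r triv_fscaleR[OF x i t])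
  show "tinv t x (fJ A v) = fmulI A (tinv t x v)"
    by (rule triv_eqI[OF t i fmulI_in[OF x i]]) (simp add: r triv_fmulI[OF x i t])
qed

lemma fscaleC_of_real:
  assumes x: "x \<in> base" and a: "a \<in> fibre A x"
  shows "fscaleC A (of_real r) a = fscaleR A r a"
proof -
  obtain t where t: "t \<in> vtrivs A" "x \<in> fst t" using triv_at[OF x] by blast
  show ?thesis
    by (rule triv_eqI[OF t fscaleC_in[OF x a] fscaleR_in[OF x a]])
      (simp add: triv_fscaleC[OF x a t] triv_fscaleR[OF x a t])
qed

lemma fmulI_fscaleC:
  assumes x: "x \<in> base" and a: "a \<in> fibre A x"
  shows "fmulI A (fscaleC A z a) = fscaleC A z (fmulI A a)"
proof -
  obtain t where t: "t \<in> vtrivs A" "x \<in> fst t" using triv_at[OF x] by blast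
  show ?thesis
    by (rule triv_eqI[OF t fmulI_in[OF x fscaleC_in[OF x a]] fscaleC_in[OF x fmulI_in[OF x a]]])
      (simp add: triv_fmulI[OF x fscaleC_in[OF x a] t] triv_fscaleC[OF x fmulI_in[OF x a] t]
        triv_fscaleC[OF x a t] triv_fmulI[OF x a t] linear_add[OF fJ_linear] linear_scale[OF fJ_linear])
qed

lemma fmulI_fadd:
  assumes x: "x \<in> base" and a: "a \<in> fibre A x" and b: "b \<in> fibre A x"
  shows "fmulI A (fadd A a b) = fadd A (fmulI A a) (fmulI A b)"
proof -
  obtain t where t: "t \<in> vtrivs A" "x \<in> fst t" using triv_at[OF x] by blast
  show ?thesis
    by (rule triv_eqI[OF t fmulI_in[OF x fadd_in[OF x a]] fadd_in[OF x fmulI_in[OF x a]]])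
      (simp add: triv_fmulI[OF x fadd_in[OF x a] t] triv_fadd[OF x fmulI_in[OF x a] fmulI_in[OF x b] t]
        triv_fadd[OF x a b t] triv_fmulI[OF x a t] triv_fmulI[OF x b t] linear_add[OF fJ_linear])
qed

lemma fmulI_fmulI:
  assumes x: "x \<in> base" and a: "a \<in> fibre A x"
  shows "fmulI A (fmulI A a) = fscaleR A (- 1) a"
proof -
  obtain t where t: "t \<in> vtrivs A" "x \<in> fst t" using triv_at[OF x] by blast
  show ?thesis
    by (rule triv_eqI[OF t fmulI_in[OF x fmulI_in[OF x a]] fscaleR_in[OF x a]])
      (simp add: triv_fmulI[OF x fmulI_in[OF x a] t] triv_fmulI[OF x a t] triv_fscaleR[OF x a t] fJ_fJ)
qed

lemma mem_homC: "(x, \<xi>) \<in> vtotal (homC A) \<longleftrightarrow> x \<in> base \<and> (\<forall>a. a \<notin> fibre A x \<longrightarrow> \<xi> a = 0) \<and>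
    (\<forall>a\<in>fibre A x. \<forall>b\<in>fibre A x. \<xi> (fadd A a b) = \<xi> a + \<xi> b) \<and>
    (\<forall>a\<in>fibre A x. \<forall>z. \<xi> (fscaleC A z a) = z * \<xi> a)"
  by (simp add: homC_def base_def)

lemma mem_homR: "(x, \<alpha>) \<in> vtotal (homR A) \<longleftrightarrow> x \<in> base \<and> (\<forall>a. a \<notin> fibre A x \<longrightarrow> \<alpha> a = 0) \<and>
    (\<forall>a\<in>fibre A x. \<forall>b\<in>fibre A x. \<alpha> (fadd A a b) = \<alpha> a + \<alpha> b) \<and>
    (\<forall>a\<in>fibre A x. \<forall>r. \<alpha> (fscaleR A r a) = r * \<alpha> a)"
  by (simp add: homR_def base_def)

lemma homC_eval:
  assumes m: "(x, \<xi>) \<in> vtotal (homC A)" and a: "a \<in> fibre A x"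
  shows "\<xi> (fscaleR A r a) = of_real r * \<xi> a" "\<xi> (fmulI A a) = \<i> * \<xi> a"
proof -
  have x: "x \<in> base" and h: "\<And>z. \<xi> (fscaleC A z a) = z * \<xi> a" using m a unfolding mem_homC by blast+
  show "\<xi> (fscaleR A r a) = of_real r * \<xi> a"
    using h[of "of_real r"] fscaleC_of_real[OF x a] by simp
  show "\<xi> (fmulI A a) = \<i> * \<xi> a" using h[of \<i>] fscaleC_i[OF x a] by simp
qed

definition dual_trivC :: "'x set \<times> ('a \<Rightarrow> 'f) \<Rightarrow> 'x set \<times> ('x \<times> ('a \<Rightarrow> complex) \<Rightarrow> ('f \<Rightarrow>\<^sub>L real))" where
  "dual_trivC t = (fst t, \<lambda>(x, \<xi>). Blinfun (\<lambda>v. Re (\<xi> (tinv t x v))))"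

definition dual_trivR :: "'x set \<times> ('a \<Rightarrow> 'f) \<Rightarrow> 'x set \<times> ('x \<times> ('a \<Rightarrow> real) \<Rightarrow> ('f \<Rightarrow>\<^sub>L real))" where
  "dual_trivR t = (fst t, \<lambda>(x, \<alpha>). Blinfun (\<lambda>v. \<alpha> (tinv t x v)))"

lemma vtrivs_homC: "vtrivs (homC A) = dual_trivC ` vtrivs A"
  unfolding homC_def vb.select_convs dual_trivC_def by (force simp: image_iff)

lemma vtrivs_homR: "vtrivs (homR A) = dual_trivR ` vtrivs A"
  unfolding homR_def vb.select_convs dual_trivR_def by (force simp: image_iff)

lemma fst_dual_triv [simp]: "fst (dual_trivC t) = fst t" "fst (dual_trivR t) = fst t"
  by (simp_all add: dual_trivC_def dual_trivR_def)

lemma vproj_dual [simp]: "vproj (homC A) = fst" "vproj (homR A) = fst"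
  by (simp_all add: homC_def homR_def)

lemma complexify_scaleC:
  assumes l: "linear l"
  shows "complexify (fJ A) l (Re z *\<^sub>R v + Im z *\<^sub>R fJ A v) = z * complexify (fJ A) l v"
  by (simp add: complexify_def complex_eq_iff fJ_fJ linear_add[OF l] linear_scale[OF l] linear_neg[OF l]
      linear_diff[OF l] linear_add[OF fJ_linear] linear_scale[OF fJ_linear] algebra_simps)

text \<open>The inverse of the trivialization of the complex dual belonging to \<open>t\<close>.\<close>

definition dual_invC :: "'x set \<times> ('a \<Rightarrow> 'f) \<Rightarrow> 'x \<Rightarrow> ('f \<Rightarrow>\<^sub>L real) \<Rightarrow> 'x \<times> ('a \<Rightarrow> complex)" where
  "dual_invC t x \<alpha> = (x, \<lambda>a. if a \<in> fibre A x then complexify (fJ A) (blinfun_apply \<alpha>) (snd t a) else 0)"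

text \<open>The complex linear functional with real part \<open>\<alpha>\<close> is the complexification of \<open>\<alpha>\<close>.\<close>

lemma dual_invC_in:
  assumes t: "t \<in> vtrivs A" "x \<in> fst t"
  shows "dual_invC t x \<alpha> \<in> fibre (homC A) x"
proof -
  note x = baseI[OF t]
  have lin: "linear (blinfun_apply \<alpha>)" using blinfun.bounded_linear_right bounded_linear.linear by blast
  have "dual_invC t x \<alpha> \<in> vtotal (homC A)"
    unfolding dual_invC_def mem_homC
  proof (intro conjI ballI allI impI)
    fix a assume a: "a \<in> fibre A x"
    show "(if fadd A a b \<in> fibre A x then complexify (fJ A) (blinfun_apply \<alpha>) (snd t (fadd A a b)) else 0) =
        (if a \<in> fibre A x then complexify (fJ A) (blinfun_apply \<alpha>) (snd t a) else 0) +
        (if b \<in> fibre A x then complexify (fJ A) (blinfun_apply \<alpha>) (snd t b) else 0)" if b: "b \<in> fibre A x" for b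
      using a b fadd_in[OF x a]
      by (simp add: triv_fadd[OF x a b t] complexify_def linear_add[OF fJ_linear] linear_add[OF lin] algebra_simps)
    show "(if fscaleC A z a \<in> fibre A x then complexify (fJ A) (blinfun_apply \<alpha>) (snd t (fscaleC A z a)) else 0) =
        z * (if a \<in> fibre A x then complexify (fJ A) (blinfun_apply \<alpha>) (snd t a) else 0)" for z
      using a fscaleC_in[OF x a] by (simp add: triv_fscaleC[OF x a t] complexify_scaleC[OF lin])
  qed (use x in auto)
  then show ?thesis by (simp add: fibre_def dual_invC_def)
qed

end

context hol_bundle
begin

abbreviation "atlC \<equiv> total_atlas X (homC A)"
abbreviation "atlR \<equiv> total_atlas X (homR A)"

lemma homC_inv_linear:
  assumes m: "(x, \<xi>) \<in> vtotal (homC A)" and t: "t \<in> vtrivs A" "x \<in> fst t"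
  shows "bounded_linear (\<lambda>v. Re (\<xi> (tinv t x v)))"
proof (rule finite_dim_bounded_linear[OF complex_fin_dim_basis[OF fin_dim_A]], rule linearI)
  note i = triv_inv_in[OF t]
  show "Re (\<xi> (tinv t x (v + w))) =
    Re (\<xi> (tinv t x v)) + Re (\<xi> (tinv t x w))" for v w
    using m i unfolding triv_inv_add[OF t] mem_homC by simp
  show "Re (\<xi> (tinv t x (r *\<^sub>R v))) = r *\<^sub>R Re (\<xi> (tinv t x v))" for r v
    unfolding triv_inv_scaleR[OF t] by (simp add: homC_eval[OF m i])
qed

lemma dual_trivC_apply:
  assumes m: "(x, \<xi>) \<in> vtotal (homC A)" and t: "t \<in> vtrivs A" "x \<in> fst t"
  shows "blinfun_apply (snd (dual_trivC t) (x, \<xi>)) v = Re (\<xi> (tinv t x v))"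
  using bounded_linear_Blinfun_apply[OF homC_inv_linear[OF assms]] by (simp add: dual_trivC_def)

lemma dual_trivC_left:
  assumes t: "t \<in> vtrivs A" "x \<in> fst t"
  shows "snd (dual_trivC t) (dual_invC t x \<alpha>) = \<alpha>"
proof (rule blinfun_eqI)
  fix v
  have m: "(x, snd (dual_invC t x \<alpha>)) \<in> vtotal (homC A)"
    using dual_invC_in[OF t, of \<alpha>] by (simp add: fibre_def dual_invC_def)
  have "dual_invC t x \<alpha> = (x, snd (dual_invC t x \<alpha>))" by (simp add: dual_invC_def)
  then have "blinfun_apply (snd (dual_trivC t) (dual_invC t x \<alpha>)) v =
      Re (snd (dual_invC t x \<alpha>) (tinv t x v))"
    using dual_trivC_apply[OF m t] by metis
  then show "blinfun_apply (snd (dual_trivC t) (dual_invC t x \<alpha>)) v = blinfun_apply \<alpha> v"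
    by (simp add: dual_invC_def triv_inv_in[OF t] triv_inv_right[OF t] complexify_def)
qed

lemma dual_trivC_right:
  assumes m: "m \<in> fibre (homC A) x" and t: "t \<in> vtrivs A" "x \<in> fst t"
  shows "dual_invC t x (snd (dual_trivC t) m) = m"
proof -
  obtain \<xi> where \<xi>: "m = (x, \<xi>)" "(x, \<xi>) \<in> vtotal (homC A)" using m by (cases m) (auto simp: fibre_def)
  have "snd (dual_invC t x (snd (dual_trivC t) m)) a = \<xi> a" for a
  proof (cases "a \<in> fibre A x")
    case True
    note x = baseI[OF t]
    have inv: "tinv t x (fJ A (snd t a)) = fmulI A a"
      unfolding triv_inv_J[OF t] triv_inv_left[OF t True] ..
    show ?thesis
      using True triv_inv_left[OF t True] homC_eval(2)[OF \<xi>(2) True]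
      by (simp add: dual_invC_def complexify_def \<xi>(1) dual_trivC_apply[OF \<xi>(2) t] inv complex_eq_iff)
  next
    case False
    then show ?thesis using \<xi>(2) by (simp add: dual_invC_def mem_homC)
  qed
  then show ?thesis by (simp add: \<xi>(1) dual_invC_def fun_eq_iff)
qed

sublocale HC: bij_fibres "homC A"
proof
  fix s x assume "s \<in> vtrivs (homC A)" "x \<in> fst s"
  then obtain t where t: "t \<in> vtrivs A" "x \<in> fst t" "s = dual_trivC t" by (auto simp: vtrivs_homC)
  show "bij_betw (snd s) (fibre (homC A) x) UNIV"
    by (rule bij_betw_byWitness[where f' = "dual_invC t x"])
      (auto simp: t dual_trivC_left dual_trivC_right dual_invC_in)
qed

lemma homC_chart_inv:
  assumes c: "c \<in> charts X" "x \<in> fst c" and t: "t \<in> vtrivs A" "x \<in> fst t"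
  shows "chart_inv (total_chart (homC A) c (dual_trivC t)) (snd c x, \<alpha>) = dual_invC t x \<alpha>"
proof -
  have t': "dual_trivC t \<in> vtrivs (homC A)" "x \<in> fst (dual_trivC t)" using t by (auto simp: vtrivs_homC)
  show ?thesis
    using HC.total_chart_inv(1)[OF t'(1) M.inj[OF c(1)] c(2) t'(2) dual_invC_in[OF t]]
    by (simp add: dual_trivC_left[OF t])
qed

lemma total_atlas_homC: "atlC = {total_chart (homC A) c (dual_trivC t) | c t. c \<in> charts X \<and> t \<in> vtrivs A}"
  unfolding total_atlas_eq vtrivs_homC by blast

lemma total_atlas_homR: "atlR = {total_chart (homR A) c (dual_trivR t) | c t. c \<in> charts X \<and> t \<in> vtrivs A}"
  unfolding total_atlas_eq vtrivs_homR by blast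

lemma chart_triv_around:
  assumes "x \<in> base"
  obtains c t where "c \<in> charts X" "x \<in> fst c" "t \<in> vtrivs A" "x \<in> fst t"
proof -
  obtain t where "t \<in> vtrivs A" "x \<in> fst t" using triv_at[OF assms] by blast
  moreover obtain c where "c \<in> charts X" "x \<in> fst c" using assms unfolding base_eq points_def by blast
  ultimately show ?thesis using that by blast
qed

lemma points_homC: "points (atlC) = vtotal (homC A)"
proof (rule points_total_atlas)
  fix m assume "m \<in> vtotal (homC A)"
  then have "fst m \<in> base" by (cases m) (simp add: mem_homC)
  then show "vproj (homC A) m \<in> points (charts X) \<inter> \<Union> (fst ` vtrivs (homC A))"
    using base_eq unfolding base_def by (simp add: vtrivs_homC image_image)
qed

lemma points_homR: "points (atlR) = vtotal (homR A)"
proof (rule points_total_atlas)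
  fix m assume "m \<in> vtotal (homR A)"
  then have "fst m \<in> base" by (cases m) (simp add: mem_homR)
  then show "vproj (homR A) m \<in> points (charts X) \<inter> \<Union> (fst ` vtrivs (homR A))"
    using base_eq unfolding base_def by (simp add: vtrivs_homR image_image)
qed

abbreviation "JC \<equiv> map_prod (mJ X) (dualJ (fJ A))"

text \<open>The trivialization of the dual is contravariant: passing from \<open>t\<close> to \<open>u\<close> composes functionals with the
  coordinate change from \<open>u\<close> to \<open>t\<close>.\<close>

lemma homC_transition:
  assumes c: "c \<in> charts X" "d \<in> charts X" and t: "t \<in> vtrivs A" "u \<in> vtrivs A"
  defines "e \<equiv> total_chart (homC A) c (dual_trivC t)" and "e' \<equiv> total_chart (homC A) d (dual_trivC u)"
  shows "open (snd e ` (fst e \<inter> fst e'))" "cdiff_on JC JC (snd e ` (fst e \<inter> fst e')) (snd e' \<circ> chart_inv e)"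
proof -
  define W where "W = fst c \<inter> fst t \<inter> (fst d \<inter> fst u)"
  have dt: "dual_trivC t \<in> vtrivs (homC A)" using t by (simp add: vtrivs_homC)
  have Wt: "W \<subseteq> fst (dual_trivC t)" by (auto simp: W_def)
  have "fst e \<inter> fst e' = (\<Union>x\<in>W. fibre (homC A) x)"
    by (auto simp: W_def e_def e'_def total_chart_def fibre_def)
  then have S: "snd e ` (fst e \<inter> fst e') = (snd c ` W) \<times> UNIV"
    using HC.total_chart_image[OF dt Wt, of c] by (simp add: e_def)
  have W_eq: "W = fst c \<inter> (fst d \<inter> fst u) \<inter> fst t" by (auto simp: W_def)
  have op: "open (snd c ` W)"
    unfolding W_eq by (rule Opn_image_triv[OF openin_Int[OF M.openin_chart[OF c(2)] Opn_triv[OF t(2)]] c(1) t(1)])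
  then have opS: "open ((snd c ` W) \<times> (UNIV :: ('f \<Rightarrow>\<^sub>L real) set))" by (simp add: open_Times)
  then show "open (snd e ` (fst e \<inter> fst e'))" unfolding S .
  define g where "g y v = snd t (tinv u (chart_inv c y) v)" for y v
  have W_img: "chart_inv c y \<in> W" if "y \<in> snd c ` W" for y
    using that M.chart_inv[OF c(1)] by (auto simp: W_def)
  have g: "cdiff_on (mJ X) (fJ A) (snd c ` W) (\<lambda>y. g y v)" for v
    unfolding g_def
    by (rule cdiff_on_subset[OF _ conjunct2[OF triv_transition_hol[OF t(2,1) c(1), unfolded hol_on_iff]]])
      (auto simp: W_def)
  have lin: "linear (g y)" if "y \<in> snd c ` W" for y
    unfolding g_def[abs_def] by (rule triv_linear[OF t(2,1)]) (use W_img[OF that] in \<open>auto simp: W_def\<close>)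
  have gJ: "g y (fJ A v) = fJ A (g y v)" if "y \<in> snd c ` W" for y v
    unfolding g_def by (rule triv_J[OF t(2,1)]) (use W_img[OF that] in \<open>auto simp: W_def\<close>)
  have tr: "cdiff_on (mJ X) (mJ X) (snd c ` W) (snd d \<circ> chart_inv c)"
    by (rule cdiff_on_subset[OF _ conjunct2[OF chart_transition_hol[OF c, unfolded hol_on_iff]]])
      (auto simp: W_def)
  have first: "cdiff_on JC (mJ X) ((snd c ` W) \<times> (UNIV :: ('f \<Rightarrow>\<^sub>L real) set)) (\<lambda>p. (snd d \<circ> chart_inv c) (fst p))"
    by (rule cdiff_on_compose_fst[OF tr])
  have second: "cdiff_on JC (dualJ (fJ A)) ((snd c ` W) \<times> (UNIV :: ('f \<Rightarrow>\<^sub>L real) set))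
      (\<lambda>p. Blinfun (\<lambda>v. blinfun_apply (snd p) (g (fst p) v)))"
    by (rule cdiff_on_dual_transition[OF complex_fin_dim_basis[OF fin_dim_A] fJ_bounded op])
      (fact g lin gJ)+
  have "cdiff_on JC JC ((snd c ` W) \<times> (UNIV :: ('f \<Rightarrow>\<^sub>L real) set))
      (\<lambda>p. ((snd d \<circ> chart_inv c) (fst p), Blinfun (\<lambda>v. blinfun_apply (snd p) (g (fst p) v))))"
    using cdiff_on_Pair[OF first second] .
  then show "cdiff_on JC JC (snd e ` (fst e \<inter> fst e')) (snd e' \<circ> chart_inv e)"
    unfolding S
  proof (rule cdiff_on_eq[OF _ opS])
    show "((snd d \<circ> chart_inv c) (fst p), Blinfun (\<lambda>v. blinfun_apply (snd p) (g (fst p) v))) =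
      (snd e' \<circ> chart_inv e) p" if p: "p \<in> (snd c ` W) \<times> UNIV" for p
  proof -
    obtain x \<alpha> where x: "x \<in> W" "p = (snd c x, \<alpha>)" using p by auto
    have xs: "x \<in> fst c" "x \<in> fst t" "x \<in> fst d" "x \<in> fst u" using x(1) by (auto simp: W_def)
    have "(snd e' \<circ> chart_inv e) p = (snd d x, snd (dual_trivC u) (dual_invC t x \<alpha>))"
      using HC.snd_total_chart[OF dual_invC_in[OF t(1) xs(2)], of d]
      by (simp add: x(2) e_def e'_def homC_chart_inv[OF c(1) xs(1) t(1) xs(2)])
    also have "snd (dual_trivC u) (dual_invC t x \<alpha>) = Blinfun (\<lambda>v. blinfun_apply \<alpha> (g (snd c x) v))"
      using triv_inv_in[OF t(2) xs(4)] M.chart_inv[OF c(1) xs(1)]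
      by (simp add: dual_trivC_def dual_invC_def complexify_def g_def)
    finally show ?thesis using M.chart_inv[OF c(1) xs(1)] by (simp add: x(2))
  qed
  qed
qed

lemma Blinfun_0_compose: "0 o\<^sub>L Blinfun (fJ A) = 0"
  by (rule blinfun_eqI) simp

lemma atlas_homC: "atlas (cdiff_on JC JC) (atlC)"
  unfolding atlas_def
proof (intro conjI ballI)
  fix e assume "e \<in> atlC"
  then obtain c t where e: "e = total_chart (homC A) c (dual_trivC t)" "c \<in> charts X" "t \<in> vtrivs A"
    unfolding total_atlas_homC by blast
  show "inj_on (snd e) (fst e)"
    using HC.inj_total_chart[OF _ M.inj[OF e(2)]] e by (simp add: vtrivs_homC)
  show "open (snd e ` fst e)" using homC_transition(1)[OF e(2,2,3,3)] by (simp add: e(1))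
  fix e' assume "e' \<in> atlC"
  then obtain d u where e': "e' = total_chart (homC A) d (dual_trivC u)" "d \<in> charts X" "u \<in> vtrivs A"
    unfolding total_atlas_homC by blast
  show "open (snd e ` (fst e \<inter> fst e'))" "cdiff_on JC JC (snd e ` (fst e \<inter> fst e')) (snd e' \<circ> chart_inv e)"
    using homC_transition[OF e(2) e'(2) e(3) e'(3)] by (simp_all add: e(1) e'(1))
qed

text \<open>A function near \<open>m\<close> is given by its coordinate expressions \<open>r c t\<close>; one chart around \<open>m\<close> decides.\<close>

lemma homC_cdiff_atI:
  assumes m: "m \<in> vtotal (homC A)" and U: "Opn U" "fst m \<in> U"
    and h: "\<And>c t. c \<in> charts X \<Longrightarrow> t \<in> vtrivs A \<Longrightarrow>
      cdiff_on JC ((*) \<i>) (img c U t \<times> UNIV) (r c t)"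
    and r: "\<And>c t x \<alpha>. c \<in> charts X \<Longrightarrow> t \<in> vtrivs A \<Longrightarrow> x \<in> fst c \<Longrightarrow> x \<in> U \<Longrightarrow> x \<in> fst t \<Longrightarrow>
      h (dual_invC t x \<alpha>) = r c t (snd c x, \<alpha>)"
  shows "cdiff_at (atlC) JC h m"
proof -
  have "fst m \<in> base" using U in_base by blast
  then obtain c t where ct: "c \<in> charts X" "fst m \<in> fst c" "t \<in> vtrivs A" "fst m \<in> fst t" by (rule chart_triv_around)
  define e where "e = total_chart (homC A) c (dual_trivC t)"
  have e: "e \<in> atlC" unfolding e_def total_atlas_homC using ct by blast
  have me: "m \<in> fst e" using m ct by (simp add: e_def total_chart_def)
  let ?S = "img c U t \<times> (UNIV :: ('f \<Rightarrow>\<^sub>L real) set)"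
  have op: "open ?S" using Opn_image_triv[OF U(1) ct(1,3)] by (simp add: open_Times)
  have eq: "r c t p = (h \<circ> chart_inv e) p" if "p \<in> ?S" for p
    using that r[OF ct(1,3)] homC_chart_inv[OF ct(1) _ ct(3)] by (auto simp: e_def)
  have "cdiff_on JC ((*) \<i>) ?S (h \<circ> chart_inv e)"
    by (rule cdiff_on_eq[OF h[OF ct(1,3)] op]) (rule eq)
  moreover have "snd e m \<in> ?S" using ct U(2) by (simp add: e_def total_chart_def)
  ultimately have "cdiff_on JC ((*) \<i>) {snd e m} (h \<circ> chart_inv e)"
    by (metis cdiff_on_subset empty_subsetI insert_subset)
  then show ?thesis unfolding cdiff_at_def using e me by blast
qed

text \<open>In bundle charts \<open>l\<^sub>V\<close> is the pairing of the fibre variable with the components of \<open>V\<close>.\<close>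

lemma lin_fun_cdiff_at:
  assumes m: "m \<in> vtotal (homC A)" and U: "Opn U" "fst m \<in> U" and V: "V \<in> Hol U"
  shows "cdiff_at (atlC) JC (lin_fun V) m"
proof (rule homC_cdiff_atI[OF m U])
  fix c t assume ct: "c \<in> charts X" "t \<in> vtrivs A"
  have "cdiff_on (mJ X) (fJ A) (img c U t) (rep c t V)"
    using V ct unfolding hol_sections_iff[OF U(1)] hol_on_iff by blast
  then show "cdiff_on JC ((*) \<i>) (img c U t \<times> UNIV)
      (\<lambda>p. complexify (fJ A) (blinfun_apply (snd p)) ((rep c t V) (fst p)))"
    by (rule cdiff_on_pairing[OF _ fJ_bounded fJ_fJ])
  fix x \<alpha> assume x: "x \<in> fst c" "x \<in> U" "x \<in> fst t"
  show "lin_fun V (dual_invC t x \<alpha>) = complexify (fJ A) (blinfun_apply (snd (snd c x, \<alpha>)))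
      ((rep c t V) (fst (snd c x, \<alpha>)))"
    using section_fibre[OF hol_section_smooth[OF U(1) V] x(2)] M.chart_inv[OF ct(1) x(1)]
    by (simp add: lin_fun_def dual_invC_def)
qed

lemma base_fun_cdiff_at:
  assumes m: "m \<in> vtotal (homC A)" and U: "Opn U" "fst m \<in> U" and f: "f \<in> hol_funs X U"
  shows "cdiff_at (atlC) JC (f \<circ> fst) m"
proof (rule homC_cdiff_atI[OF m U])
  fix c t assume ct: "c \<in> charts X" "t \<in> vtrivs A"
  have "cdiff_on (mJ X) ((*) \<i>) (snd c ` (fst c \<inter> U)) (f \<circ> chart_inv c)"
    using f ct(1) unfolding hol_funs_iff[OF U(1)] hol_on_iff by blast
  then have "cdiff_on (mJ X) ((*) \<i>) (img c U t) (f \<circ> chart_inv c)"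
    by (rule cdiff_on_subset[rotated]) blast
  then show "cdiff_on JC ((*) \<i>) (img c U t \<times> UNIV) (\<lambda>p. (f \<circ> chart_inv c) (fst p))"
    by (rule cdiff_on_compose_fst)
  fix x and \<alpha> :: "'f \<Rightarrow>\<^sub>L real" assume x: "x \<in> fst c" "x \<in> U" "x \<in> fst t"
  show "(f \<circ> fst) (dual_invC t x \<alpha>) = (f \<circ> chart_inv c) (fst (snd c x, \<alpha>))"
    using M.chart_inv[OF ct(1) x(1)] by (simp add: dual_invC_def)
qed

section \<open>The isomorphism between the real and the complex dual\<close>

lemma Psi_in:
  assumes m: "(x, \<alpha>) \<in> vtotal (homR A)"
  shows "Psi A (x, \<alpha>) \<in> vtotal (homC A)"
proof -
  have x: "x \<in> base" and add: "\<And>a b. a \<in> fibre A x \<Longrightarrow> b \<in> fibre A x \<Longrightarrow> \<alpha> (fadd A a b) = \<alpha> a + \<alpha> b"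
    and scale: "\<And>a r. a \<in> fibre A x \<Longrightarrow> \<alpha> (fscaleR A r a) = r * \<alpha> a"
    using m unfolding mem_homR by blast+
  have scaleC: "\<alpha> (fscaleC A z a) = Re z * \<alpha> a + Im z * \<alpha> (fmulI A a)" if a: "a \<in> fibre A x" for a z
    unfolding fscaleC_def
    by (simp add: add[OF fscaleR_in[OF x a] fscaleR_in[OF x fmulI_in[OF x a]]] scale[OF a] scale[OF fmulI_in[OF x a]])
  have jj: "\<alpha> (fmulI A (fmulI A a)) = - \<alpha> a" if a: "a \<in> fibre A x" for a
    using fmulI_fmulI[OF x a] scale[OF a, of "- 1"] by simp
  show ?thesis
    unfolding Psi_def prod.case mem_homC
  proof (intro conjI ballI allI impI)
    fix a assume a: "a \<in> fibre A x"
    show "(if fadd A a b \<in> fibre A x then complex_of_real (\<alpha> (fadd A a b)) - \<i> * of_real (\<alpha> (fmulI A (fadd A a b))) else 0) =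
      (if a \<in> fibre A x then of_real (\<alpha> a) - \<i> * of_real (\<alpha> (fmulI A a)) else 0) +
      (if b \<in> fibre A x then of_real (\<alpha> b) - \<i> * of_real (\<alpha> (fmulI A b)) else 0)" if b: "b \<in> fibre A x" for b
      using a b fadd_in[OF x a] add[OF a b] add[OF fmulI_in[OF x a] fmulI_in[OF x b]] fmulI_fadd[OF x a b]
      by (simp add: algebra_simps)
    show "(if fscaleC A z a \<in> fibre A x then complex_of_real (\<alpha> (fscaleC A z a)) - \<i> * of_real (\<alpha> (fmulI A (fscaleC A z a))) else 0) =
      z * (if a \<in> fibre A x then of_real (\<alpha> a) - \<i> * of_real (\<alpha> (fmulI A a)) else 0)" for z
      using a fscaleC_in[OF x a] fmulI_fscaleC[OF x a] scaleC[OF a] scaleC[OF fmulI_in[OF x a]] jj[OF a]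
      by (simp add: complex_eq_iff algebra_simps)
  qed (use x in auto)
qed

lemma Re_homC_in:
  assumes m: "(x, \<xi>) \<in> vtotal (homC A)"
  shows "(x, \<lambda>a. Re (\<xi> a)) \<in> vtotal (homR A)"
  using m homC_eval(1)[OF m] unfolding mem_homR mem_homC by simp

lemma Psi_Re:
  assumes m: "(x, \<xi>) \<in> vtotal (homC A)"
  shows "Psi A (x, \<lambda>a. Re (\<xi> a)) = (x, \<xi>)"
proof -
  have "\<xi> a = 0" if "a \<notin> fibre A x" for a using m that unfolding mem_homC by blast
  then show ?thesis using homC_eval(2)[OF m] by (auto simp: Psi_def fun_eq_iff complex_eq_iff)
qed

lemma Re_Psi:
  assumes m: "(x, \<alpha>) \<in> vtotal (homR A)"
  shows "Re (snd (Psi A (x, \<alpha>)) a) = \<alpha> a"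
  using m unfolding mem_homR Psi_def by simp

lemma fst_Psi [simp]: "fst (Psi A m) = fst m"
  by (cases m) (simp add: Psi_def)

text \<open>The inverse of \<open>\<Psi>\<close> takes real parts, because a complex linear \<open>\<xi>\<close> satisfies \<open>Re (\<xi> (j a)) = - Im (\<xi> a)\<close>.\<close>

lemma Psi_bij: "bij_betw (Psi A) (vtotal (homR A)) (vtotal (homC A))"
proof (rule bij_betw_byWitness[where f' = "\<lambda>m. (fst m, \<lambda>a. Re (snd m a))"])
  show "\<forall>m\<in>vtotal (homR A). (fst (Psi A m), \<lambda>a. Re (snd (Psi A m) a)) = m"
    using Re_Psi by force
  show "\<forall>m\<in>vtotal (homC A). Psi A (fst m, \<lambda>a. Re (snd m a)) = m"
    using Psi_Re by force
  show "Psi A ` vtotal (homR A) \<subseteq> vtotal (homC A)" using Psi_in by force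
  show "(\<lambda>m. (fst m, \<lambda>a. Re (snd m a))) ` vtotal (homC A) \<subseteq> vtotal (homR A)" using Re_homC_in by force
qed

text \<open>The charts of both duals record the real part of a functional, and \<open>\<Psi> \<alpha>\<close> has real part \<open>\<alpha>\<close>.\<close>

sublocale P: chart_transport "atlC" JC "atlR" "Psi A"
proof
  show "atlas (cdiff_on JC JC) (atlC)" by (rule atlas_homC)
  show "JC 0 = 0" using M.J0 Blinfun_0_compose by (simp add: zero_prod_def)
  show "bij_betw (Psi A) (points (atlR)) (points (atlC))"
    unfolding points_homR points_homC by (rule Psi_bij)
  fix d assume "d \<in> atlR"
  then obtain c t where d: "d = total_chart (homR A) c (dual_trivR t)" "c \<in> charts X" "t \<in> vtrivs A"
    unfolding total_atlas_homR by blast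
  let ?e = "total_chart (homC A) c (dual_trivC t)"
  show "\<exists>e\<in>atlC. fst e = Psi A ` fst d \<and> (\<forall>n\<in>fst d. snd e (Psi A n) = snd d n)"
  proof (intro bexI conjI ballI)
    show "?e \<in> atlC" unfolding total_atlas_homC using d by blast
    have "vtotal (homC A) = Psi A ` vtotal (homR A)" using Psi_bij by (simp add: bij_betw_def)
    then show "fst ?e = Psi A ` fst d" by (auto simp: d total_chart_def)
    fix n assume n: "n \<in> fst d"
    obtain x \<alpha> where x: "n = (x, \<alpha>)" by (cases n)
    have m: "(x, \<alpha>) \<in> vtotal (homR A)" "x \<in> fst t" using n by (auto simp: x d total_chart_def)
    have "snd (dual_trivC t) (Psi A (x, \<alpha>)) = snd (dual_trivR t) (x, \<alpha>)"
      using triv_inv_in[OF d(3) m(2)] by (simp add: dual_trivC_def dual_trivR_def Psi_def)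
    then show "snd ?e (Psi A n) = snd d n" by (simp add: x d total_chart_def)
  qed
qed

end

section \<open>Comparison of the Lie algebroids\<close>

lemma (in cdiff_atlas) dif_linear_chart:
  assumes v: "v \<in> tangent_space C m" and c: "c \<in> C" "m \<in> fst c" and l: "bounded_linear l"
  shows "dif C (\<lambda>x. l (snd c x)) m v = l (v c)"
proof (rule dif_eq[OF v c])
  show "((\<lambda>x. l (snd c x)) \<circ> chart_inv c has_derivative l) (at (snd c m))"
  proof (rule iffD2[OF has_derivative_cong_open[OF open_image[OF c(1)]] bounded_linear_imp_has_derivative[OF l]])
    show "((\<lambda>x. l (snd c x)) \<circ> chart_inv c) y = l y" if "y \<in> snd c ` fst c" for y
      using that c(1) by auto
  qed (use c(2) in blast)
qed

context hol_bundle
begin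

text \<open>Real functionals separate the points of a fibre, so that a section is determined by its fibrewise linear
  function on the real dual.\<close>

lemma dual_separates:
  assumes x: "x \<in> base" and ab: "a \<in> fibre A x" "b \<in> fibre A x"
    and eq: "\<And>\<alpha>. (x, \<alpha>) \<in> vtotal (homR A) \<Longrightarrow> \<alpha> a = \<alpha> b"
  shows "a = b"
proof -
  obtain t where t: "t \<in> vtrivs A" "x \<in> fst t" using triv_at[OF x] by blast
  have "snd t a = snd t b"
  proof (rule finite_dim_functionals_separate[OF complex_fin_dim_basis[OF fin_dim_A]])
    fix l :: "'f \<Rightarrow> real" assume l: "bounded_linear l"
    interpret l: bounded_linear l by (rule l)
    let ?\<alpha> = "\<lambda>a. if a \<in> fibre A x then l (snd t a) else 0"
    have "(x, ?\<alpha>) \<in> vtotal (homR A)"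
      unfolding mem_homR
    proof (intro conjI ballI allI impI)
      fix c assume c: "c \<in> fibre A x"
      show "?\<alpha> (fadd A c d) = ?\<alpha> c + ?\<alpha> d" if "d \<in> fibre A x" for d
        using c that fadd_in[OF x c] by (simp add: triv_fadd[OF x c that t] l.add)
      show "?\<alpha> (fscaleR A r c) = r * ?\<alpha> c" for r
        using c fscaleR_in[OF x c] by (simp add: triv_fscaleR[OF x c t] l.scaleR)
    qed (use x in auto)
    from eq[OF this] show "l (snd t a) = l (snd t b)" using ab by simp
  qed
  then show ?thesis by (rule triv_eqI[OF t ab])
qed

lemma derivation_bracket_cong:
  assumes "\<And>V f x. V \<in> \<Gamma> U \<Longrightarrow> x \<in> U \<Longrightarrow> act V f x = act' V f x"
    and "derivation_bracket U act br"
  shows "derivation_bracket U act' br"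
proof -
  have eq: "sscale U (act V f) W = sscale U (act' V f) W" if "V \<in> \<Gamma> U" for V W f
    using assms(1)[OF that] by (simp add: sscale_def cong: restrict_cong)
  note D = derivation_bracketD[OF assms(2)]
  show ?thesis
    unfolding derivation_bracket_def
  proof (intro ballI conjI)
    fix V W assume V: "V \<in> \<Gamma> U" and W: "W \<in> \<Gamma> U"
    show "br V W = sscale U (\<lambda>_. - 1) (br W V)" by (rule D(1)[OF V W])
    show "br V (sadd U W Z) = sadd U (br V W) (br V Z)" if "Z \<in> \<Gamma> U" for Z
      by (rule D(2)[OF V W that])
    show "br V (sscale U f W) = sadd U (sscale U (act' V f) W) (sscale U f (br V W))"
      if "f \<in> smooth_funs X U" for f
      using D(3)[OF V W that] unfolding eq[OF V] .
  qed
qed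

lemma
  shows anchor_scale_algd: "anchor (scale_algd r X A K) a = fscaleR TX r (anchor K a)"
    and bracket_scale_algd: "bracket (scale_algd r X A K) U V W = sscale U (\<lambda>_. r) (bracket K U V W)"
  by (simp_all add: scale_algd_def sscale_def)

text \<open>Constant sections are holomorphic, so agreement on holomorphic sections is enough for \<open>K'\<close> to be
  the rescaled algebroid on all smooth sections.  In particular \<open>K'\<close> inherits the Jacobi identity and the
  compatibility with the anchor from \<open>K\<close>, which is how the imaginary structure is seen to be a Lie
  algebroid.\<close>

lemma isomorphic_if_agree_on_hol_sections:
  assumes K: "real_lie_algebroid X A K"
    and anchor: "\<And>a. a \<in> vtotal A \<Longrightarrow> anchor K' a = fscaleR TX r (anchor K a)"
    and hol: "\<And>U V W. Opn U \<Longrightarrow> V \<in> Hol U \<Longrightarrow> W \<in> Hol U \<Longrightarrow>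
      bracket K' U V W = sscale U (\<lambda>_. r) (bracket K U V W)"
    and derivation': "\<And>U. Opn U \<Longrightarrow> derivation_bracket U (anchor_act X K') (bracket K' U)"
    and section': "\<And>U V W. Opn U \<Longrightarrow> V \<in> \<Gamma> U \<Longrightarrow> W \<in> \<Gamma> U \<Longrightarrow>
      bracket K' U V W \<in> \<Gamma> U"
    and restrict': "\<And>U U' V W. Opn U \<Longrightarrow> Opn U' \<Longrightarrow> U' \<subseteq> U \<Longrightarrow> V \<in> \<Gamma> U \<Longrightarrow>
      W \<in> \<Gamma> U \<Longrightarrow> bracket K' U' (restrict V U') (restrict W U') = restrict (bracket K' U V W) U'"
  shows "lie_algebroid_isomorphic X A (scale_algd r X A K) A K'"
proof -
  let ?S = "scale_algd r X A K"
  have S: "real_lie_algebroid X A ?S"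
    by (rule real_lie_algebroid_rescale[OF K anchor_scale_algd bracket_scale_algd])
  have act: "anchor_act X ?S V f x = anchor_act X K' V f x"
    if "V \<in> \<Gamma> U" "x \<in> U" for U V x and f :: "'x \<Rightarrow> real"
    using anchor[of "V x"] section_fibre[OF that] by (simp add: anchor_act_def anchor_scale_algd fibre_def)
  have eq: "bracket ?S U V W = bracket K' U V W"
    if "Opn U" "V \<in> \<Gamma> U" "W \<in> \<Gamma> U" for U V W
  proof (rule brackets_agree[where act = "anchor_act X K'", OF _ restrict' _ derivation' _ section' _ that])
    show "derivation_bracket U (anchor_act X K') (bracket ?S U)" if U: "Opn U" for U
      by (rule derivation_bracket_cong[OF act real_lie_derivation_bracket[OF S U]])
    show "bracket ?S U (const_section U t b) (const_section U t b') =
      bracket K' U (const_section U t b) (const_section U t b')"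
      if "Opn U" "t \<in> vtrivs A" "U \<subseteq> fst t" for U t b b'
      using hol[OF that(1) const_section_hol[OF that] const_section_hol[OF that]]
      by (simp add: bracket_scale_algd)
  qed (assumption | (rule real_lie_bracket_restrict[OF S] real_lie_bracket_section[OF S]; assumption))+
  have "real_lie_algebroid X A K'"
    by (rule real_lie_algebroid_rescale[OF K anchor]) (simp_all add: eq[symmetric] bracket_scale_algd)
  then show ?thesis
    by (intro lie_algebroid_isomorphic_if_eq[OF S]) (simp_all add: anchor anchor_scale_algd eq)
qed

lemma pi_Re_eq: "pi_Re X A \<pi> = push_bivec (atlC) (atlR) P.\<Phi> (Re_bivec \<pi>)"
  by (simp add: pi_Re_def points_homR)

lemma pi_Im_eq: "pi_Im X A \<pi> = push_bivec (atlC) (atlR) P.\<Phi> (Im_bivec \<pi>)"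
  by (simp add: pi_Im_def points_homR)

text \<open>On the real dual \<open>l'\<^sub>V\<close> is the real part of \<open>l\<^sub>V \<circ> \<Psi>\<close>.\<close>

lemma lin_fun_Psi:
  assumes "n \<in> vtotal (homR A)"
  shows "lin_fun V n = Re (lin_fun V (Psi A n))"
  using assms Re_Psi[of "fst n" "snd n" "V (fst n)"] fst_Psi[of n]
  by (simp add: lin_fun_def case_prod_beta)

text \<open>The imaginary part of \<open>l\<^sub>V \<circ> \<Psi>\<close> is minus the linear function of \<open>j V\<close>.\<close>

lemma Im_Psi:
  assumes "a \<in> fibre A x"
  shows "Im (snd (Psi A (x, \<alpha>)) a) = - \<alpha> (fmulI A a)"
  using assms by (simp add: Psi_def)

end

locale lie_poisson_bundle = hol_bundle X A
  for X :: "('x, 'e::real_normed_vector) cmfd" and A :: "('x, 'a, 'f::real_normed_vector) cvb" +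
  fixes L A\<^sub>R :: "('x, 'a, 'e) algd" and \<pi> :: "('x \<times> ('a \<Rightarrow> complex), 'e \<times> ('f \<Rightarrow>\<^sub>L real), complex) bivec"
  assumes L: "holomorphic_lie_algebroid X A L" and R: "underlying_real X A L A\<^sub>R"
    and \<pi>: "holomorphic_lie_poisson X A L \<pi>"
begin

lemma AR_real: "real_lie_algebroid X A A\<^sub>R"
  using R unfolding underlying_real_def by blast

lemma AR_anchor: "a \<in> vtotal A \<Longrightarrow> anchor A\<^sub>R a = anchor L a"
  using R unfolding underlying_real_def by blast

lemma AR_bracket: "Opn U \<Longrightarrow> V \<in> Hol U \<Longrightarrow> W \<in> Hol U \<Longrightarrow>
    bracket A\<^sub>R U V W = bracket L U V W"
  using R unfolding underlying_real_def by blast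

lemma hol_anchor: "hol_bundle_map X A TX (anchor L)"
  and hol_lie_sheaf: "lie_sheaf X A (fscaleC A) (Hol) (hol_funs X) L"
  using L unfolding holomorphic_lie_algebroid_def by blast+

lemma hol_anchor_in: "a \<in> fibre A x \<Longrightarrow> anchor L a \<in> fibre TX x"
  using hol_anchor unfolding hol_bundle_map_def fibre_def[of A] by auto

lemma hol_anchor_fmulI:
  assumes x: "x \<in> base" and a: "a \<in> fibre A x"
  shows "anchor L (fmulI A a) = fmulI TX (anchor L a)"
proof -
  have "anchor L (fscaleC A \<i> a) = fscaleC TX \<i> (anchor L a)"
    using hol_anchor a unfolding hol_bundle_map_def fibre_def by blast
  moreover have "x \<in> T.base" using x T_base by simp
  ultimately show ?thesis using fscaleC_i[OF x a] T.fscaleC_i[OF _ hol_anchor_in[OF a]] by simp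
qed

lemma
  assumes U: "Opn U" and V: "V \<in> Hol U" and W: "W \<in> Hol U"
  shows hol_bracket_section: "bracket L U V W \<in> Hol U"
    and hol_bracket_anti: "bracket L U V W = (\<lambda>x\<in>U. fscaleC A (- 1) (bracket L U W V x))"
    and hol_bracket_const: "bracket L U V (\<lambda>x\<in>U. fscaleC A k (W x)) = (\<lambda>x\<in>U. fscaleC A k (bracket L U V W x))"
proof -
  note h = bspec[OF bspec[OF mp[OF spec[OF hol_lie_sheaf[unfolded lie_sheaf_def Let_def], of U] U] V] W]
  show "bracket L U V W \<in> Hol U" using h by (rule conjunct1)
  note h = conjunct2[OF conjunct2[OF h]]
  show "bracket L U V W = (\<lambda>x\<in>U. fscaleC A (- 1) (bracket L U W V x))" using h by (rule conjunct1)
  show "bracket L U V (\<lambda>x\<in>U. fscaleC A k (W x)) = (\<lambda>x\<in>U. fscaleC A k (bracket L U V W x))"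
    by (rule spec[OF conjunct1[OF conjunct2[OF h]]])
qed

lemma smulI_fscaleC:
  assumes U: "Opn U" and V: "V \<in> Hol U"
  shows "smulI U V = (\<lambda>x\<in>U. fscaleC A \<i> (V x))"
  using fscaleC_i[OF in_base[OF U] section_fibre[OF hol_section_smooth[OF U V]]]
  by (simp add: smulI_def cong: restrict_cong)

text \<open>Complex linearity in the second argument is an axiom, applied with the scalar \<open>\<i>\<close>; antisymmetry gives it
  in the first.\<close>

lemma hol_bracket_smulI:
  assumes U: "Opn U" and V: "V \<in> Hol U" and W: "W \<in> Hol U"
  shows "bracket L U V (smulI U W) = smulI U (bracket L U V W)"
    and "bracket L U (smulI U V) W = smulI U (bracket L U V W)"
proof -
  have right: "bracket L U V (smulI U W) = smulI U (bracket L U V W)"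
    if V: "V \<in> Hol U" and W: "W \<in> Hol U" for V W
    unfolding smulI_fscaleC[OF U W] smulI_fscaleC[OF U hol_bracket_section[OF U V W]]
    by (rule hol_bracket_const[OF U V W])
  show "bracket L U V (smulI U W) = smulI U (bracket L U V W)" by (rule right[OF V W])
  have WV: "bracket L U W V x \<in> fibre A x" if "x \<in> U" for x
    by (rule section_fibre[OF hol_section_smooth[OF U hol_bracket_section[OF U W V]] that])
  have "bracket L U (smulI U V) W = (\<lambda>x\<in>U. fscaleC A (- 1) (smulI U (bracket L U W V) x))"
    using hol_bracket_anti[OF U smulI_hol_section[OF U V] W] right[OF W V] by simp
  also have "\<dots> = (\<lambda>x\<in>U. fmulI A (fscaleC A (- 1) (bracket L U W V x)))"
    using fmulI_fscaleC[OF in_base[OF U] WV] by (simp add: smulI_def cong: restrict_cong)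
  also have "\<dots> = smulI U (bracket L U V W)"
    unfolding hol_bracket_anti[OF U V W] by (simp add: smulI_def cong: restrict_cong)
  finally show "bracket L U (smulI U V) W = smulI U (bracket L U V W)" .
qed

text \<open>On holomorphic sections the bracket of the imaginary Lie algebroid is \<open>j[V, W] + j[V, W] - j[V, W]\<close>.\<close>

lemma imaginary_bracket_hol:
  assumes U: "Opn U" and V: "V \<in> Hol U" and W: "W \<in> Hol U"
  shows "bracket (imaginary_algd A A\<^sub>R) U V W = smulI U (bracket L U V W)"
proof -
  let ?B = "smulI U (bracket L U V W)"
  have B: "?B \<in> \<Gamma> U"
    by (rule hol_section_smooth[OF U smulI_hol_section[OF U hol_bracket_section[OF U V W]]])
  have cB: "sscale U (\<lambda>_. - 1) ?B \<in> \<Gamma> U"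
    by (rule sscale_section[OF U const_smooth_fun[OF U] B])
  have "bracket (imaginary_algd A A\<^sub>R) U V W = sadd U (sadd U ?B ?B) (sscale U (\<lambda>_. - 1) ?B)"
    unfolding imaginary_bracket
    by (simp add: AR_bracket[OF U] smulI_hol_section[OF U] V W hol_bracket_smulI[OF U V W])
  also have "\<dots> = ?B"
  proof (rule section_eqI[OF U sadd_section[OF U sadd_section[OF U B B] cB] B])
    fix x t assume "x \<in> U" "t \<in> vtrivs A" "x \<in> fst t"
    note xt = this
    show "snd t (sadd U (sadd U ?B ?B) (sscale U (\<lambda>_. - 1) ?B) x) = snd t (?B x)"
      unfolding triv_sadd[OF U sadd_section[OF U B B] xt cB] triv_sadd[OF U B xt B]
        triv_sscale[OF U B xt] by simp
  qed
  finally show ?thesis .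
qed

lemma poisson_bivector:
  "bivector_field (atlC) \<pi>"
  "\<forall>m\<in>points (atlC). \<forall>\<omega>\<in>cotangent_space (atlC) m.
     \<forall>\<eta>\<in>cotangent_space (atlC) m.
      (\<forall>v\<in>tangent_space (atlC) m. \<omega> (\<lambda>c. JC (v c)) = - \<i> * \<omega> v) \<longrightarrow> \<pi> m \<omega> \<eta> = 0"
proof -
  have "fJ (homC A) = (dualJ (fJ A))" by (simp add: homC_def)
  then have c: "charts (total_cmfd X (homC A)) = atlC" "mJ (total_cmfd X (homC A)) = JC"
    by (simp_all add: total_cmfd_def)
  have "holomorphic_bivector_field (total_cmfd X (homC A)) \<pi>"
    using \<pi> unfolding holomorphic_lie_poisson_def holomorphic_poisson_def by blast
  note h = this[unfolded holomorphic_bivector_field_def c]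
  show "bivector_field (atlC) \<pi>" using h by (rule conjunct1)
  show "\<forall>m\<in>points (atlC). \<forall>\<omega>\<in>cotangent_space (atlC) m.
     \<forall>\<eta>\<in>cotangent_space (atlC) m.
      (\<forall>v\<in>tangent_space (atlC) m. \<omega> (\<lambda>c. JC (v c)) = - \<i> * \<omega> v) \<longrightarrow> \<pi> m \<omega> \<eta> = 0"
    using h by (elim conjE)
qed

lemma
  assumes U: "Opn U" and V: "V \<in> Hol U" and m: "m \<in> vtotal (homC A)" "fst m \<in> U"
  shows poisson_sections: "W \<in> Hol U \<Longrightarrow>
      pbracket (atlC) \<pi> (lin_fun V) (lin_fun W) m = lin_fun (bracket L U V W) m"
    and poisson_anchor: "f \<in> hol_funs X U \<Longrightarrow>
      pbracket (atlC) \<pi> (lin_fun V) (f \<circ> fst) m = anchor_act X L V f (fst m)"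
proof -
  have h: "\<forall>V\<in>Hol U. \<forall>W\<in>Hol U. \<forall>f\<in>hol_funs X U. \<forall>g\<in>hol_funs X U.
        \<forall>m\<in>vtotal (homC A). fst m \<in> U \<longrightarrow>
          pbracket (atlC) \<pi> (lin_fun V) (lin_fun W) m = lin_fun (bracket L U V W) m \<and>
          pbracket (atlC) \<pi> (lin_fun V) (f \<circ> fst) m = anchor_act X L V f (fst m) \<and>
          pbracket (atlC) \<pi> (f \<circ> fst) (g \<circ> fst) m = 0"
    using mp[OF spec[OF conjunct2[OF \<pi>[unfolded holomorphic_lie_poisson_def Let_def]], of U] U] .
  \<comment> \<open>The identities are given jointly for all sections and functions over \<open>U\<close>; the one for two sections is
    obtained with this function.\<close>
  have zero: "(\<lambda>_. 0) \<in> hol_funs X U"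
    unfolding hol_funs_iff[OF U] hol_on_iff o_def by (auto intro: smooth_on_const cdiff_on_const)
  show "W \<in> Hol U \<Longrightarrow>
      pbracket (atlC) \<pi> (lin_fun V) (lin_fun W) m = lin_fun (bracket L U V W) m"
    using h V m zero by blast
  show "f \<in> hol_funs X U \<Longrightarrow>
      pbracket (atlC) \<pi> (lin_fun V) (f \<circ> fst) m = anchor_act X L V f (fst m)"
    using h V m by blast
qed

lemma
  assumes U: "Opn U" and V: "V \<in> Hol U" and n: "n \<in> vtotal (homR A)" "fst n \<in> U"
  shows pi_Re_sections: "W \<in> Hol U \<Longrightarrow>
      pbracket (atlR) (pi_Re X A \<pi>) (lin_fun V) (lin_fun W) n =
        Re (lin_fun (bracket L U V W) (Psi A n)) / 4"
    and pi_Im_sections: "W \<in> Hol U \<Longrightarrow>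
      pbracket (atlR) (pi_Im X A \<pi>) (lin_fun V) (lin_fun W) n =
        Im (lin_fun (bracket L U V W) (Psi A n)) / 4"
    and pi_Re_anchor: "f \<in> hol_funs X U \<Longrightarrow>
      pbracket (atlR) (pi_Re X A \<pi>) (lin_fun V) ((\<lambda>x. Re (f x)) \<circ> fst) n =
        Re (anchor_act X L V f (fst n)) / 4"
    and pi_Im_anchor: "f \<in> hol_funs X U \<Longrightarrow>
      pbracket (atlR) (pi_Im X A \<pi>) (lin_fun V) ((\<lambda>x. Re (f x)) \<circ> fst) n =
        Im (anchor_act X L V f (fst n)) / 4"
proof -
  have m: "Psi A n \<in> vtotal (homC A)" "fst (Psi A n) \<in> U"
    using Psi_bij n bij_betwE by auto
  have n': "n \<in> points (atlR)" using n points_homR by simp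
  note l = lin_fun_cdiff_at[OF m(1) U m(2)]
  note lR = lin_fun_Psi[folded points_homR]
  {
    assume W: "W \<in> Hol U"
    note args = n' poisson_bivector l[OF V] l[OF W]
    show "pbracket (atlR) (pi_Re X A \<pi>) (lin_fun V) (lin_fun W) n =
        Re (lin_fun (bracket L U V W) (Psi A n)) / 4"
      unfolding pi_Re_eq poisson_sections[OF U V m W, symmetric]
      by (rule P.pbracket_push_Re[OF args]) (auto intro: lR)
    show "pbracket (atlR) (pi_Im X A \<pi>) (lin_fun V) (lin_fun W) n =
        Im (lin_fun (bracket L U V W) (Psi A n)) / 4"
      unfolding pi_Im_eq poisson_sections[OF U V m W, symmetric]
      by (rule P.pbracket_push_Im[OF args]) (auto intro: lR)
  next
    assume f: "f \<in> hol_funs X U"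
    note args = n' poisson_bivector l[OF V] base_fun_cdiff_at[OF m(1) U m(2) f]
    show "pbracket (atlR) (pi_Re X A \<pi>) (lin_fun V) ((\<lambda>x. Re (f x)) \<circ> fst) n =
        Re (anchor_act X L V f (fst n)) / 4"
      unfolding pi_Re_eq poisson_anchor[OF U V m f, unfolded fst_Psi, symmetric]
      by (rule P.pbracket_push_Re[OF args]) (auto intro: lR)
    show "pbracket (atlR) (pi_Im X A \<pi>) (lin_fun V) ((\<lambda>x. Re (f x)) \<circ> fst) n =
        Im (anchor_act X L V f (fst n)) / 4"
      unfolding pi_Im_eq poisson_anchor[OF U V m f, unfolded fst_Psi, symmetric]
      by (rule P.pbracket_push_Im[OF args]) (auto intro: lR)
  }
qed

lemma
  assumes K: "corresponding_algebroid X A \<beta> K" and U: "Opn U"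
    and V: "V \<in> \<Gamma> U" and m: "m \<in> vtotal (homR A)" "fst m \<in> U"
  shows corresponding_sections: "W \<in> \<Gamma> U \<Longrightarrow>
      pbracket (atlR) \<beta> (lin_fun V) (lin_fun W) m = lin_fun (bracket K U V W) m"
    and corresponding_anchor: "f \<in> smooth_funs X U \<Longrightarrow>
      pbracket (atlR) \<beta> (lin_fun V) (f \<circ> fst) m = anchor_act X K V f (fst m)"
proof -
  have h: "\<forall>V\<in>\<Gamma> U. \<forall>W\<in>\<Gamma> U. \<forall>f\<in>smooth_funs X U.
        \<forall>m\<in>vtotal (homR A). fst m \<in> U \<longrightarrow>
          pbracket (atlR) \<beta> (lin_fun V) (lin_fun W) m = lin_fun (bracket K U V W) m \<and>
          pbracket (atlR) \<beta> (lin_fun V) (f \<circ> fst) m = anchor_act X K V f (fst m)"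
    using mp[OF spec[OF conjunct2[OF K[unfolded corresponding_algebroid_def Let_def]], of U] U] .
  show "W \<in> \<Gamma> U \<Longrightarrow>
      pbracket (atlR) \<beta> (lin_fun V) (lin_fun W) m = lin_fun (bracket K U V W) m"
    using h V m const_smooth_fun[OF U] by blast
  show "f \<in> smooth_funs X U \<Longrightarrow>
      pbracket (atlR) \<beta> (lin_fun V) (f \<circ> fst) m = anchor_act X K V f (fst m)"
    using h V m by blast
qed

text \<open>A point of the real dual over \<open>x\<close>, at which the bracket of \<open>l'\<^sub>V\<close> with a function of the base can be
  evaluated.\<close>

lemma zero_homR: "x \<in> base \<Longrightarrow> (x, \<lambda>_. 0) \<in> vtotal (homR A)"
  by (simp add: mem_homR)

text \<open>A tangent vector is determined by the derivatives of the functions \<open>Re f\<close> with \<open>f\<close> a complex linear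
  function of the coordinates of a chart.\<close>

lemma anchor_coordinates:
  assumes K: "smooth_bundle_map X A TX (anchor K)"
    and act: "\<And>U V f x. Opn U \<Longrightarrow> V \<in> Hol U \<Longrightarrow> f \<in> hol_funs X U \<Longrightarrow> x \<in> U \<Longrightarrow>
      anchor_act X K V (\<lambda>x. Re (f x)) x = \<phi> (anchor_act X L V f x)"
    and x: "x \<in> base" and a: "a \<in> fibre A x" and c: "c \<in> charts X" "x \<in> fst c" and l: "bounded_linear l"
  shows "l (snd (anchor K a) c) = \<phi> (complexify (mJ X) l (snd (anchor L a) c))"
proof -
  obtain t where t: "t \<in> vtrivs A" "x \<in> fst t" using triv_at[OF x] by blast
  define U where "U = fst c \<inter> fst t"
  have U: "Opn U" "U \<subseteq> fst t" "U \<subseteq> fst c" "x \<in> U"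
    using openin_Int[OF M.openin_chart[OF c(1)] Opn_triv[OF t(1)]] c t by (auto simp: U_def)
  define V where "V = const_section U t (snd t a)"
  have Vx: "V x = a" using U(4) triv_inv_left[OF t a] by (simp add: V_def const_section_def)
  have V: "V \<in> Hol U" unfolding V_def by (rule const_section_hol[OF U(1) t(1) U(2)])
  let ?f = "\<lambda>x. complexify (mJ X) l (snd c x)"
  have f: "?f \<in> hol_funs X U" by (rule complexify_chart_hol[OF U(1) c(1) U(3) l])
  have Ka: "snd (anchor K a) \<in> tangent_space (charts X) x"
    using anchor_in[OF K a] by (auto simp: fibre_TX)
  have La: "snd (anchor L a) \<in> tangent_space (charts X) x"
    using hol_anchor_in[OF a] by (auto simp: fibre_TX)
  have "(\<lambda>x. Re (?f x)) = (\<lambda>x. l (snd c x))" by (simp add: complexify_def)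
  then have "anchor_act X K V (\<lambda>x. Re (?f x)) x = l (snd (anchor K a) c)"
    using M.dif_linear_chart[OF Ka c l] by (simp add: anchor_act_def Vx)
  moreover have "anchor_act X L V ?f x = complexify (mJ X) l (snd (anchor L a) c)"
    using M.dif_linear_chart[OF La c bounded_linear_complexify[OF l]] by (simp add: anchor_act_def Vx)
  ultimately show ?thesis using act[OF U(1) V f U(4)] by simp
qed

lemma anchor_eqI:
  assumes x: "x \<in> base" and p: "p \<in> fibre TX x" and q: "q \<in> fibre TX x"
    and eq: "\<And>c l. c \<in> charts X \<Longrightarrow> x \<in> fst c \<Longrightarrow> bounded_linear l \<Longrightarrow> (l (snd p c) :: real) = l (snd q c)"
  shows "p = q"
proof -
  obtain v w where v: "p = (x, v)" "v \<in> tangent_space (charts X) x"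
    and w: "q = (x, w)" "w \<in> tangent_space (charts X) x" using p q by (auto simp: fibre_TX)
  obtain c t where c: "c \<in> charts X" "x \<in> fst c" using chart_triv_around[OF x] by metis
  have "v c = w c"
    by (rule finite_dim_functionals_separate[OF complex_fin_dim_basis[OF fin_dim_X]])
      (use eq[OF c] in \<open>simp add: v(1) w(1)\<close>)
  then show ?thesis using M.tangent_eqI[OF v(2) w(2) c] by (simp add: v w)
qed

text \<open>For \<open>\<beta> = \<pi>\<^sub>\<Re>\<close> and \<open>\<beta> = \<pi>\<^sub>\<Im>\<close> the function \<open>\<phi>\<close> is a quarter of the real and of the imaginary part.  The
  assumption \<open>eq\<close> compares tangent vectors through real functionals \<open>l\<close> of their coordinates.\<close>

lemma corresponding_anchor_eq:
  assumes K: "corresponding_algebroid X A \<beta> K"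
    and act: "\<And>U V f n. Opn U \<Longrightarrow> V \<in> Hol U \<Longrightarrow> n \<in> vtotal (homR A) \<Longrightarrow> fst n \<in> U \<Longrightarrow>
      f \<in> hol_funs X U \<Longrightarrow> pbracket (atlR) \<beta> (lin_fun V) ((\<lambda>x. Re (f x)) \<circ> fst) n =
        \<phi> (anchor_act X L V f (fst n))"
    and x: "x \<in> base" and a: "a \<in> fibre A x" and p: "p \<in> fibre TX x"
    and eq: "\<And>c l. c \<in> charts X \<Longrightarrow> x \<in> fst c \<Longrightarrow> bounded_linear l \<Longrightarrow>
      l (snd p c) = r * \<phi> (complexify (mJ X) l (snd (anchor L a) c))"
  shows "p = fscaleR TX r (anchor K a)"
proof -
  have Ks: "smooth_bundle_map X A TX (anchor K)"
    using K real_lie_smooth_anchor unfolding corresponding_algebroid_def by blast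
  have xT: "x \<in> T.base" using x T_base by simp
  note Ka = anchor_in[OF Ks a]
  obtain v where v: "anchor K a = (x, v)" "v \<in> tangent_space (charts X) x"
    using Ka by (auto simp: fibre_TX)
  show ?thesis
  proof (rule anchor_eqI[OF x p T.fscaleR_in[OF xT Ka]])
    fix c and l :: "'e \<Rightarrow> real" assume c: "c \<in> charts X" "x \<in> fst c" and l: "bounded_linear l"
    have "l (snd (anchor K a) c) = \<phi> (complexify (mJ X) l (snd (anchor L a) c))"
    proof (rule anchor_coordinates[OF Ks _ x a c l])
      fix U V f x assume U: "Opn U" and V: "V \<in> Hol U" and f: "f \<in> hol_funs X U" and x: "x \<in> U"
      note n = zero_homR[OF in_base[OF U x]]
      show "anchor_act X K V (\<lambda>x. Re (f x)) x = \<phi> (anchor_act X L V f x)"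
        using act[OF U V n _ f] corresponding_anchor[OF K U hol_section_smooth[OF U V] n _ Re_smooth_fun[OF U f]] x
        by simp
    qed
    then show "l (snd p c) = l (snd (fscaleR TX r (anchor K a)) c)"
      using eq[OF c l] v fscaleR_TX[OF x v(2)] linear_scale[OF bounded_linear.linear[OF l], of r "v c"] by simp
  qed
qed

text \<open>The analogue for brackets, where sections are compared through the functionals on the fibres.\<close>

lemma corresponding_bracket_eq:
  assumes K: "corresponding_algebroid X A \<beta> K"
    and U: "Opn U" and V: "V \<in> Hol U" and W: "W \<in> Hol U"
    and br: "\<And>n. n \<in> vtotal (homR A) \<Longrightarrow> fst n \<in> U \<Longrightarrow>
      pbracket (atlR) \<beta> (lin_fun V) (lin_fun W) n = \<phi> (lin_fun (bracket L U V W) (Psi A n))"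
    and S: "S \<in> \<Gamma> U"
    and eq: "\<And>x \<alpha>. x \<in> U \<Longrightarrow> (x, \<alpha>) \<in> vtotal (homR A) \<Longrightarrow>
      \<alpha> (S x) = r * \<phi> (lin_fun (bracket L U V W) (Psi A (x, \<alpha>)))"
  shows "S = sscale U (\<lambda>_. r) (bracket K U V W)"
proof (rule extensionalityI[OF section_extensional[OF S]])
  have Kr: "real_lie_algebroid X A K" using K unfolding corresponding_algebroid_def by blast
  note V' = hol_section_smooth[OF U V] and W' = hol_section_smooth[OF U W]
  show "sscale U (\<lambda>_. r) (bracket K U V W) \<in> extensional U" by (simp add: sscale_def)
  fix x assume x: "x \<in> U"
  note b = in_base[OF U x]
  note Kx = section_fibre[OF real_lie_bracket_section[OF Kr U V' W'] x]
  have "S x = fscaleR A r (bracket K U V W x)"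
  proof (rule dual_separates[OF b section_fibre[OF S x] fscaleR_in[OF b Kx]])
    fix \<alpha> assume \<alpha>: "(x, \<alpha>) \<in> vtotal (homR A)"
    have "\<alpha> (bracket K U V W x) = \<phi> (lin_fun (bracket L U V W) (Psi A (x, \<alpha>)))"
      using br[OF \<alpha>] x corresponding_sections[OF K U V' \<alpha> _ W'] by (simp add: lin_fun_def)
    then show "\<alpha> (S x) = \<alpha> (fscaleR A r (bracket K U V W x))"
      using eq[OF x \<alpha>] \<alpha> Kx by (simp add: mem_homR)
  qed
  then show "S x = sscale U (\<lambda>_. r) (bracket K U V W) x" using x by (simp add: sscale_def)
qed

text \<open>Here \<open>4 (Re (l\<^sub>B) / 4)\<close> is the linear function of \<open>B = [V, W]\<close> itself.\<close>

lemma real_part: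
  assumes K: "corresponding_algebroid X A (pi_Re X A \<pi>) K"
  shows "lie_algebroid_isomorphic X A (scale_algd 4 X A K) A A\<^sub>R"
proof (rule isomorphic_if_agree_on_hol_sections)
  show "real_lie_algebroid X A K" using K unfolding corresponding_algebroid_def by blast
  show "anchor A\<^sub>R a = fscaleR TX 4 (anchor K a)" if a: "a \<in> vtotal A" for a
  proof -
    have af: "a \<in> fibre A (vproj A a)" using a by (simp add: fibre_def)
    have "anchor L a = fscaleR TX 4 (anchor K a)"
      by (rule corresponding_anchor_eq[OF K pi_Re_anchor vproj_base[OF a] af hol_anchor_in[OF af]])
        (simp_all add: complexify_def)
    then show ?thesis using AR_anchor[OF a] by simp
  qed
  fix U V W
  assume U: "Opn U" and V: "V \<in> Hol U" and W: "W \<in> Hol U"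
  have "bracket L U V W = sscale U (\<lambda>_. 4) (bracket K U V W)"
  proof (rule corresponding_bracket_eq[OF K U V W pi_Re_sections[OF U V _ _ W]
        hol_section_smooth[OF U hol_bracket_section[OF U V W]]])
    show "\<alpha> (bracket L U V W x) = 4 * (Re (lin_fun (bracket L U V W) (Psi A (x, \<alpha>))) / 4)"
      if "(x, \<alpha>) \<in> vtotal (homR A)" for x \<alpha>
      using lin_fun_Psi[OF that, of "bracket L U V W"] by (simp add: lin_fun_def)
  qed
  then show "bracket A\<^sub>R U V W = sscale U (\<lambda>_. 4) (bracket K U V W)" using AR_bracket[OF U V W] by simp
qed (rule real_lie_derivation_bracket[OF AR_real] real_lie_bracket_section[OF AR_real]
    real_lie_bracket_restrict[OF AR_real]; assumption)+

text \<open>Here \<open>- 4 (Im (l\<^sub>B) / 4)\<close> is the linear function of \<open>j B\<close> for \<open>B = [V, W]\<close>.\<close>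

lemma imaginary_part:
  assumes K: "corresponding_algebroid X A (pi_Im X A \<pi>) K"
  shows "lie_algebroid_isomorphic X A (scale_algd (- 4) X A K) A (imaginary_algd A A\<^sub>R)"
proof (rule isomorphic_if_agree_on_hol_sections)
  show "real_lie_algebroid X A K" using K unfolding corresponding_algebroid_def by blast
  show "anchor (imaginary_algd A A\<^sub>R) a = fscaleR TX (- 4) (anchor K a)" if a: "a \<in> vtotal A" for a
  proof -
    have af: "a \<in> fibre A (vproj A a)" using a by (simp add: fibre_def)
    note x = vproj_base[OF a]
    have xT: "vproj A a \<in> T.base" using x T_base by simp
    obtain w where w: "anchor L a = (vproj A a, w)" "w \<in> tangent_space (charts X) (vproj A a)"
      using hol_anchor_in[OF af] by (auto simp: fibre_TX)
    have "fmulI TX (anchor L a) = fscaleR TX (- 4) (anchor K a)"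
      by (rule corresponding_anchor_eq[OF K pi_Im_anchor x af T.fmulI_in[OF xT hol_anchor_in[OF af]]])
        (simp_all add: complexify_def w fmulI_TX[OF x w(2)])
    moreover have "fmulI A a \<in> vtotal A" using fmulI_in[OF x af] by (simp add: fibre_def)
    ultimately show ?thesis using AR_anchor hol_anchor_fmulI[OF x af] by (simp add: imaginary_algd_def)
  qed
  fix U V W
  assume U: "Opn U" and V: "V \<in> Hol U" and W: "W \<in> Hol U"
  note LS = hol_bracket_section[OF U V W]
  have "smulI U (bracket L U V W) = sscale U (\<lambda>_. - 4) (bracket K U V W)"
  proof (rule corresponding_bracket_eq[OF K U V W pi_Im_sections[OF U V _ _ W]
        smulI_section[OF U hol_section_smooth[OF U LS]]])
    show "\<alpha> (smulI U (bracket L U V W) x) = - 4 * (Im (lin_fun (bracket L U V W) (Psi A (x, \<alpha>))) / 4)"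
      if "x \<in> U" for x \<alpha>
      using that Im_Psi[OF section_fibre[OF hol_section_smooth[OF U LS] that], of \<alpha>] fst_Psi[of "(x, \<alpha>)"]
      by (simp add: lin_fun_def case_prod_beta smulI_def)
  qed
  then show "bracket (imaginary_algd A A\<^sub>R) U V W = sscale U (\<lambda>_. - 4) (bracket K U V W)"
    using imaginary_bracket_hol[OF U V W] by simp
qed (rule imaginary_derivation_bracket[OF AR_real] imaginary_bracket_section[OF AR_real]
    imaginary_bracket_restrict[OF AR_real]; assumption)+

end

theorem proposition3p10:
  fixes X :: "('x, 'e::real_normed_vector) cmfd"
    and A :: "('x, 'a, 'f::real_normed_vector) cvb"
    and L A\<^sub>R L\<^sub>R\<^sub>e L\<^sub>I\<^sub>m :: "('x, 'a, 'e) algd"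
    and \<pi> :: "('x \<times> ('a \<Rightarrow> complex), 'e \<times> ('f \<Rightarrow>\<^sub>L real), complex) bivec"
  assumes "holomorphic_lie_algebroid X A L"
    and "underlying_real X A L A\<^sub>R"
    and "holomorphic_lie_poisson X A L \<pi>"
    and "corresponding_algebroid X A (pi_Re X A \<pi>) L\<^sub>R\<^sub>e"
    and "corresponding_algebroid X A (pi_Im X A \<pi>) L\<^sub>I\<^sub>m"
  shows "lie_algebroid_isomorphic X A (scale_algd 4 X A L\<^sub>R\<^sub>e) A A\<^sub>R \<and>
         lie_algebroid_isomorphic X A (scale_algd (- 4) X A L\<^sub>I\<^sub>m) A (imaginary_algd A A\<^sub>R)"
proof -
  interpret lie_poisson_bundle X A L A\<^sub>R \<pi>
    using assms(1-3) by unfold_locales (auto simp: holomorphic_lie_algebroid_def)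
  show ?thesis using real_part[OF assms(4)] imaginary_part[OF assms(5)] by blast
qed

end
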